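(* Let $h>0$, $\omega_h=(-h,h)$, and let $\lambda,\mu,\rho,\omega$ be real numbers with $\mu>0$, $3\lambda+2\mu>0$, $\rho>0$, $\omega>0$. Put $$A=\begin{pmatrix}\lambda+2\mu&0\\0&\mu\end{pmatrix},\quad B=\begin{pmatrix}0&\lambda+\mu\\\lambda+\mu&0\end{pmatrix},\quad C=\begin{pmatrix}\mu&0\\0&\lambda+2\mu\end{pmatrix},\quad D=\begin{pmatrix}0&\lambda\\\mu&0\end{pmatrix}.$$ Let $W=H^2(\omega_h,\mathbb C^2)$, $V=H^1(\omega_h,\mathbb C^2)$, $H=L^2(\omega_h,\mathbb C^2)$, $\mathcal H=V\times H$ with its product Hilbert structure, $\mathcal V=W\times V$, and let $\mathcal A$ be the unbounded operator in $\mathcal H$ with domain $D(\mathcal A)=\{U=(U_1,U_2)\in\mathcal V:\ A\partial_1U_1(\pm h)+DU_2(\pm h)=0\}$ defined by $\mathcal AU=\big(U_2,\ -C^{-1}(\omega^2\rho U_1+A\partial_{11}U_1)-C^{-1}B\partial_1U_2\big)$. Let $0<\theta_0<\pi/2$ and $B_{\theta_0}=\{\beta=|\beta|e^{i\theta}\in\mathbb C:\ |\theta|\le\theta_0\ \text{or}\ |\theta-\pi|\le\theta_0\}$. Then there exist constants $B_0>0$ and $K>0$ such that for every $\beta\in B_{\theta_0}$ with $|\beta|\ge B_0$, $i\beta$ belongs to the resolvent set of $\mathcal A$, $\|(\mathcal A-i\beta I)^{-1}\|\le K$ (operator norm on $\mathcal H$), and $(\mathcal A-i\beta I)^{-1}$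 is a Hilbert–Schmidt operator in $\mathcal H$.
   Context: The resolvent set of a closed operator $T$ is the set of $z\in\mathbb C$ such that $T-zI$ is a bijection from $D(T)$ onto $\mathcal H$. A bounded operator $T$ on a separable Hilbert space is Hilbert–Schmidt if $\sum_n\|Tx_n\|^2<\infty$ for some (equivalently any) complete orthonormal sequence $(x_n)$. *)

theory Defs
  imports "HOL-Analysis.Analysis"
begin

type_synonym cvec = "complex^2"
type_synonym cfun = "real \<Rightarrow> complex^2"
type_synonym hpair = "cfun \<times> cfun"

abbreviation Mh :: "real \<Rightarrow> real measure" where
  "Mh h \<equiv> lebesgue_on {-h<..<h}"

definition cdot :: "cvec \<Rightarrow> cvec \<Rightarrow> complex" where
  "cdot x y = (\<Sum>i\<in>UNIV. x$i * cnj (y$i))"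

text \<open>L^2(omega_h, C^2), as a set of representatives (functions equal a.e. represent the same element).\<close>
definition L2 :: "real \<Rightarrow> cfun set" where
  "L2 h = {f. f \<in> borel_measurable (Mh h) \<and> integrable (Mh h) (\<lambda>x. (norm (f x))^2)}"

text \<open>Test functions C_c^1(omega_h) (as in Brezis' definition of Sobolev spaces on an interval).\<close>
definition test_fun :: "real \<Rightarrow> (real \<Rightarrow> real) \<Rightarrow> bool" where
  "test_fun h \<phi> \<longleftrightarrow> \<phi> C1_differentiable_on UNIV \<and>
     (\<exists>a b. -h < a \<and> b < h \<and> (\<forall>x. x \<notin> {a..b} \<longrightarrow> \<phi> x = 0))"

definition weak_deriv :: "real \<Rightarrow> cfun \<Rightarrow> cfun \<Rightarrow> bool" where
  "weak_deriv h f g \<longleftrightarrow>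
     (\<forall>a b. -h < a \<longrightarrow> b < h \<longrightarrow>
        integrable (lebesgue_on {a..b}) f \<and> integrable (lebesgue_on {a..b}) g) \<and>
     (\<forall>\<phi>. test_fun h \<phi> \<longrightarrow>
        (\<integral>x. vector_derivative \<phi> (at x) *\<^sub>R f x \<partial>Mh h) = - (\<integral>x. \<phi> x *\<^sub>R g x \<partial>Mh h))"

definition H1 :: "real \<Rightarrow> cfun set" where
  "H1 h = {f \<in> L2 h. \<exists>g \<in> L2 h. weak_deriv h f g}"

definition H2 :: "real \<Rightarrow> cfun set" where
  "H2 h = {f \<in> H1 h. \<exists>g \<in> H1 h. weak_deriv h f g}"

text \<open>A chosen (a.e. unique) weak derivative in L^2.\<close>
definition wd :: "real \<Rightarrow> cfun \<Rightarrow> cfun" where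
  "wd h f = (SOME g. g \<in> L2 h \<and> weak_deriv h f g)"

definition Hspace :: "real \<Rightarrow> hpair set" where
  "Hspace h = H1 h \<times> L2 h"

definition L2_inner :: "real \<Rightarrow> cfun \<Rightarrow> cfun \<Rightarrow> complex" where
  "L2_inner h f g = (\<integral>x. cdot (f x) (g x) \<partial>Mh h)"

definition H1_inner :: "real \<Rightarrow> cfun \<Rightarrow> cfun \<Rightarrow> complex" where
  "H1_inner h f g = L2_inner h f g + L2_inner h (wd h f) (wd h g)"

definition H_inner :: "real \<Rightarrow> hpair \<Rightarrow> hpair \<Rightarrow> complex" where
  "H_inner h U V = H1_inner h (fst U) (fst V) + L2_inner h (snd U) (snd V)"

definition H_norm :: "real \<Rightarrow> hpair \<Rightarrow> real" where
  "H_norm h U = sqrt (Re (H_inner h U U))"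

definition pair_diff :: "hpair \<Rightarrow> hpair \<Rightarrow> hpair" where
  "pair_diff U V = ((\<lambda>x. fst U x - fst V x), (\<lambda>x. snd U x - snd V x))"

text \<open>Complete orthonormal sequence in \<H> (elements of norm 0 are the zero element of \<H>).\<close>
definition complete_orthonormal_seq :: "real \<Rightarrow> (nat \<Rightarrow> hpair) \<Rightarrow> bool" where
  "complete_orthonormal_seq h e \<longleftrightarrow>
     (\<forall>n. e n \<in> Hspace h) \<and>
     (\<forall>m n. H_inner h (e m) (e n) = (if m = n then 1 else 0)) \<and>
     (\<forall>y \<in> Hspace h. (\<forall>n. H_inner h y (e n) = 0) \<longrightarrow> H_norm h y = 0)"

definition matA :: "real \<Rightarrow> real \<Rightarrow> complex^2^2" where
  "matA lam mu = vector [vector [of_real (lam + 2*mu), 0], vector [0, of_real mu]]"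
definition matB :: "real \<Rightarrow> real \<Rightarrow> complex^2^2" where
  "matB lam mu = vector [vector [0, of_real (lam + mu)], vector [of_real (lam + mu), 0]]"
definition matC :: "real \<Rightarrow> real \<Rightarrow> complex^2^2" where
  "matC lam mu = vector [vector [of_real mu, 0], vector [0, of_real (lam + 2*mu)]]"
definition matD :: "real \<Rightarrow> real \<Rightarrow> complex^2^2" where
  "matD lam mu = vector [vector [0, of_real lam], vector [of_real mu, 0]]"

definition has_trace :: "real \<Rightarrow> cfun \<Rightarrow> real \<Rightarrow> cvec \<Rightarrow> bool" where
  "has_trace h f x c \<longleftrightarrow> (\<exists>g. continuous_on {-h..h} g \<and>
       (AE y in Mh h. f y = g y) \<and> g x = c)"

definition domA :: "real \<Rightarrow> real \<Rightarrow> real \<Rightarrow> hpair set" where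
  "domA h lam mu = {U. fst U \<in> H2 h \<and> snd U \<in> H1 h \<and>
     (\<exists>d. weak_deriv h (fst U) d \<and>
       (\<forall>x \<in> {-h, h}. \<exists>a b. has_trace h d x a \<and> has_trace h (snd U) x b \<and>
           matA lam mu *v a + matD lam mu *v b = 0))}"

text \<open>opA_minus h lam mu rho om z U F means: (\<A> - z I) U = F as elements of \<H>
  (i.e. almost everywhere), where
  \<A> U = (U_2, -C^{-1}(om^2 rho U_1 + A \<partial>_11 U_1) - C^{-1} B \<partial>_1 U_2).\<close>
definition opA_minus :: "real \<Rightarrow> real \<Rightarrow> real \<Rightarrow> real \<Rightarrow> real \<Rightarrow> complex \<Rightarrow> hpair \<Rightarrow> hpair \<Rightarrow> bool" where
  "opA_minus h lam mu rho om z U F \<longleftrightarrow>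
     (\<exists>d1 d2 e. weak_deriv h (fst U) d1 \<and> weak_deriv h d1 d2 \<and> weak_deriv h (snd U) e \<and>
       (AE x in Mh h.
          fst F x = snd U x - z *s fst U x \<and>
          snd F x = - (matrix_inv (matC lam mu) *v
                         (of_real (om^2 * rho) *s fst U x + matA lam mu *v d2 x))
                    - matrix_inv (matC lam mu) *v (matB lam mu *v e x)
                    - z *s snd U x))"

definition in_resolvent_set :: "real \<Rightarrow> real \<Rightarrow> real \<Rightarrow> real \<Rightarrow> real \<Rightarrow> complex \<Rightarrow> bool" where
  "in_resolvent_set h lam mu rho om z \<longleftrightarrow>
     (\<forall>U \<in> domA h lam mu. \<forall>F. opA_minus h lam mu rho om z U F \<longrightarrow> F \<in> Hspace h) \<and>
     (\<forall>F \<in> Hspace h. \<exists>U \<in> domA h lam mu. opA_minus h lam mu rho om z U F) \<and>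
     (\<forall>U \<in> domA h lam mu. \<forall>V \<in> domA h lam mu. \<forall>F.
        opA_minus h lam mu rho om z U F \<and> opA_minus h lam mu rho om z V F
        \<longrightarrow> H_norm h (pair_diff U V) = 0)"

definition resolvent_norm_le :: "real \<Rightarrow> real \<Rightarrow> real \<Rightarrow> real \<Rightarrow> real \<Rightarrow> complex \<Rightarrow> real \<Rightarrow> bool" where
  "resolvent_norm_le h lam mu rho om z K \<longleftrightarrow>
     (\<forall>F \<in> Hspace h. \<forall>U \<in> domA h lam mu.
        opA_minus h lam mu rho om z U F \<longrightarrow> H_norm h U \<le> K * H_norm h F)"

definition resolvent_hilbert_schmidt :: "real \<Rightarrow> real \<Rightarrow> real \<Rightarrow> real \<Rightarrow> real \<Rightarrow> complex \<Rightarrow> bool" where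
  "resolvent_hilbert_schmidt h lam mu rho om z \<longleftrightarrow>
     (\<exists>e U. complete_orthonormal_seq h e \<and>
        (\<forall>n. U n \<in> domA h lam mu \<and> opA_minus h lam mu rho om z (U n) (e n)) \<and>
        summable (\<lambda>n. (H_norm h (U n))^2))"

definition sector :: "real \<Rightarrow> complex set" where
  "sector \<theta>0 = {\<beta>. \<exists>\<theta>. \<beta> = complex_of_real (cmod \<beta>) * cis \<theta> \<and>
                      (\<bar>\<theta>\<bar> \<le> \<theta>0 \<or> \<bar>\<theta> - pi\<bar> \<le> \<theta>0)}"

end

theory Submission
  imports Defs
begin

text \<open>
  Write \<open>i \<beta> = s k\<close> with \<open>s = \<plusminus>i\<close> and \<open>Re k \<ge> cos \<theta>\<^sub>0 |k|\<close>. With \<open>w = k U\<^sub>1\<close> and the stress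
  \<open>S = A \<partial>U\<^sub>1 + D U\<^sub>2\<close>, which vanishes at \<open>\<plusminus>h\<close>, the resolvent equation becomes a first-order system
  for \<open>(w, S)\<close> whose principal matrix is \<open>k\<close> times a constant one with double eigenvalues \<open>\<plusminus>1\<close>.
  In the eigen-coordinates one block grows and the other decays, and \<open>S = 0\<close> lets each block control
  the other at the end where its data enter. A difference of the two block energies with linear weights
  gives the uniform \<open>L\<^sup>2\<close> bound in one integration; the zeroth-order term \<open>\<omega>\<^sup>2 \<rho>\<close> is absorbed for large \<open>|k|\<close>.
  Existence follows from the initial value problem, since the bound makes the 2 by 2 system for the
  missing initial data regular. Finally, solutions are bounded pointwise by the norm of the data, so
  Bessel's inequality, integrated over the interval, gives the Hilbert-Schmidt property.
\<close>

section \<open>Primitives of integrable functions\<close>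

text \<open>The double eigenvalues are defective: each block is a Jordan block whose off-diagonal
  entry (l + m) k is of the same order as its diagonal. The plain norm need not have a signed
  derivative, so a block is measured by |zeta|^2 + \<delta> |eta|^2 with \<delta> small enough to
  absorb the coupling; the sector enters here, as |k| \<le> Re k / c with c = cos \<theta>0. At a
  stress-free end the blocks bound each other only up to a constant above 1, so constant weights
  cannot serve both ends; the slope of varying weights is harmless because Re k is large.

  With w = k U1 the loads coming from the data grow like |k|, and the estimate of squared norms
  gains 1 / |k|^2, so the bound is uniform in k. Using the stress instead of the derivative of U1
  makes the boundary condition homogeneous and puts only first derivatives of the first datum into
  the loads, which an H^1 datum provides.

  The Hilbert-Schmidt property is stated through a complete orthonormal sequence, so an explicit one
  is built; its completeness rests on Stone-Weierstrass.\<close>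

lemma AE_zero_of_halfline_integrals_real:
  fixes w :: "real \<Rightarrow> real"
  assumes int: "integrable lebesgue w"
    and z: "\<And>x. (\<integral>t. indicator {x<..} t * w t \<partial>lebesgue) = 0"
  shows "AE t in lebesgue. w t = 0"
proof -
  have wm: "w \<in> borel_measurable lebesgue" using int by auto
  \<comment> \<open>The measures compared below live on Borel sets, so \<open>w\<close> is replaced
    by a Borel version.\<close>
  obtain v where v[measurable]: "v \<in> borel_measurable lborel" and ae: "AE x in lborel. w x = v x"
    using completion_ex_borel_measurable_real[OF wm] by auto
  have ae': "AE x in lebesgue. w x = v x" using AE_completion[OF ae] .
  have vint: "integrable lborel v"
  proof -
    have "integrable lebesgue v"
      using integrable_cong_AE_imp[OF int, of v] ae' measurable_completion[OF v] by auto
    then show ?thesis using integrable_completion[of v lborel] v by simp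
  qed
  have z': "(\<integral>t. indicator {x<..} t * v t \<partial>lborel) = 0" for x
  proof -
    have "(\<integral>t. indicator {x<..} t * v t \<partial>lborel) = (\<integral>t. indicator {x<..} t * v t \<partial>lebesgue)"
      by (rule integral_completion[symmetric]) measurable
    also have "\<dots> = (\<integral>t. indicator {x<..} t * w t \<partial>lebesgue)"
    proof (rule integral_cong_AE)
      show "(\<lambda>t. indicator {x<..} t * v t) \<in> borel_measurable lebesgue"
        by (rule measurable_completion) measurable
      show "(\<lambda>t. indicator {x<..} t * w t) \<in> borel_measurable lebesgue"
        by (intro borel_measurable_times wm measurable_completion) measurable
      show "AE t in lebesgue. indicator {x<..} t * v t = indicator {x<..} t * w t"
        using ae' by eventually_elim auto
    qed
    finally show ?thesis using z by simp
  qed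
  let ?p = "\<lambda>t. ennreal (max 0 (v t))" and ?n = "\<lambda>t. ennreal (max 0 (- v t))"
  have pint: "integrable lborel (\<lambda>t. max 0 (v t))" "integrable lborel (\<lambda>t. max 0 (- v t))"
    using vint by auto
  have pI: "integrable lborel (\<lambda>t. indicator {x<..} t * max 0 (v t))"
    "integrable lborel (\<lambda>t. indicator {x<..} t * max 0 (- v t))" for x
    using integrable_real_mult_indicator[OF _ pint(1), of "{x<..}"] integrable_real_mult_indicator[OF _ pint(2), of "{x<..}"]
    by (auto simp: mult.commute)
  have e: "emeasure (density lborel ?p) {x<..} = ennreal (\<integral>t. indicator {x<..} t * max 0 (v t) \<partial>lborel)" for x
  proof -
    have "emeasure (density lborel ?p) {x<..} = (\<integral>\<^sup>+ t. ennreal (indicator {x<..} t * max 0 (v t)) \<partial>lborel)"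
      by (subst emeasure_density) (auto intro!: nn_integral_cong simp: indicator_def)
    also have "\<dots> = ennreal (\<integral>t. indicator {x<..} t * max 0 (v t) \<partial>lborel)"
      by (rule nn_integral_eq_integral[OF pI(1)]) auto
    finally show ?thesis .
  qed
  have e2: "emeasure (density lborel ?n) {x<..} = ennreal (\<integral>t. indicator {x<..} t * max 0 (- v t) \<partial>lborel)" for x
  proof -
    have "emeasure (density lborel ?n) {x<..} = (\<integral>\<^sup>+ t. ennreal (indicator {x<..} t * max 0 (- v t)) \<partial>lborel)"
      by (subst emeasure_density) (auto intro!: nn_integral_cong simp: indicator_def)
    also have "\<dots> = ennreal (\<integral>t. indicator {x<..} t * max 0 (- v t) \<partial>lborel)"
      by (rule nn_integral_eq_integral[OF pI(2)]) auto
    finally show ?thesis .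
  qed
  have eq: "(\<integral>t. indicator {x<..} t * max 0 (v t) \<partial>lborel) = (\<integral>t. indicator {x<..} t * max 0 (- v t) \<partial>lborel)" for x
  proof -
    have "(\<integral>t. indicator {x<..} t * max 0 (v t) \<partial>lborel) - (\<integral>t. indicator {x<..} t * max 0 (- v t) \<partial>lborel)
      = (\<integral>t. indicator {x<..} t * max 0 (v t) - indicator {x<..} t * max 0 (- v t) \<partial>lborel)"
      by (rule Bochner_Integration.integral_diff[symmetric, OF pI])
    also have "\<dots> = (\<integral>t. indicator {x<..} t * v t \<partial>lborel)"
      by (rule Bochner_Integration.integral_cong) (auto simp: indicator_def max_def)
    finally show ?thesis using z' by simp
  qed
  \<comment> \<open>Positive and negative part, read as densities, give every half-line the same
    finite mass, and half-lines determine a Borel measure. Uniqueness of densities then equates the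
    two parts.\<close>
  have "density lborel ?p = density lborel ?n"
    by (rule measure_eqI_lessThan) (auto simp: e e2 eq)
  then have "AE x in lborel. ?p x = ?n x"
    by (intro sigma_finite_measure.density_unique sigma_finite_lborel) auto
  then have "AE x in lborel. w x = 0"
    using ae by eventually_elim (auto simp: max_def split: if_splits)
  then show ?thesis by (rule AE_completion)
qed

lemma borel_measurable_Mh_borel: "f \<in> borel_measurable borel \<Longrightarrow> f \<in> borel_measurable (Mh h)"
  by (intro measurable_restrict_space1 measurable_completion) (simp add: measurable_lborel1)

lemma finite_measure_Mh: "finite_measure (Mh h)"
  by (rule finite_measure_lebesgue_on) auto

lemma borel_measurable_Mh_continuous:
  "continuous_on {-h..h} f \<Longrightarrow> f \<in> borel_measurable (Mh h)"
  by (rule continuous_imp_measurable_on_sets_lebesgue) (auto intro: continuous_on_subset)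

lemma indicator_measurable_Mh:
  "A \<in> sets borel \<Longrightarrow> (indicator A :: real \<Rightarrow> real) \<in> borel_measurable (Mh h)"
  by (rule borel_measurable_Mh_borel) simp

lemma integrable_indicator_Mh:
  fixes g :: "real \<Rightarrow> 'a::{banach, second_countable_topology}"
  assumes "integrable (Mh h) g" "A \<in> sets borel"
  shows "integrable (Mh h) (\<lambda>t. indicator A t *\<^sub>R g t)"
proof (rule Bochner_Integration.integrable_bound[OF assms(1)])
  show "(\<lambda>t. indicator A t *\<^sub>R g t) \<in> borel_measurable (Mh h)"
    using assms by (intro borel_measurable_scaleR indicator_measurable_Mh) auto
qed (auto simp: indicator_def)

text \<open>Pairing with each basis vector and extending by zero outside the interval reduces this
  to the scalar case on the whole line.\<close>

lemma AE_zero_of_halfline_integrals: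
  fixes w :: "real \<Rightarrow> 'a::euclidean_space"
  assumes int: "integrable (Mh h) w"
    and z: "\<And>x. (\<integral>t. indicator {x<..} t *\<^sub>R w t \<partial>Mh h) = 0"
  shows "AE t in Mh h. w t = 0"
proof -
  have comp: "AE t in Mh h. w t \<bullet> b = 0" for b
  proof -
    let ?w = "\<lambda>t. indicator {-h<..<h} t * (w t \<bullet> b)"
    have i1: "integrable (Mh h) (\<lambda>t. w t \<bullet> b)" using int by simp
    have "AE t in lebesgue. ?w t = 0"
    proof (rule AE_zero_of_halfline_integrals_real)
      show "integrable lebesgue ?w" using i1 by (simp add: integrable_restrict_space)
      fix x
      have "(\<integral>t. indicator {x<..} t * ?w t \<partial>lebesgue) = (\<integral>t. indicator {-h<..<h} t *\<^sub>R (indicator {x<..} t * (w t \<bullet> b)) \<partial>lebesgue)"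
        by (rule Bochner_Integration.integral_cong) (auto simp: indicator_def)
      also have "\<dots> = (\<integral>t. indicator {x<..} t * (w t \<bullet> b) \<partial>Mh h)"
        by (subst integral_restrict_space) auto
      also have "\<dots> = (\<integral>t. (indicator {x<..} t *\<^sub>R w t) \<bullet> b \<partial>Mh h)" by simp
      also have "\<dots> = (\<integral>t. indicator {x<..} t *\<^sub>R w t \<partial>Mh h) \<bullet> b"
        by (rule integral_inner_left) (simp add: integrable_indicator_Mh int)
      finally show "(\<integral>t. indicator {x<..} t * ?w t \<partial>lebesgue) = 0" using z by simp
    qed
    then show ?thesis
      by (subst AE_restrict_space_iff) (auto elim: eventually_mono simp: indicator_def)
  qed
  have "AE t in Mh h. \<forall>b\<in>Basis. w t \<bullet> b = 0"
    by (rule AE_finite_allI) (use comp in auto)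
  then show ?thesis by eventually_elim (auto intro: euclidean_eqI)
qed

text \<open>\<open>f\<close> is absolutely continuous on the closed interval with derivative \<open>g\<close>.\<close>
definition primitive :: "real \<Rightarrow> (real \<Rightarrow> 'a::{banach,second_countable_topology}) \<Rightarrow> (real \<Rightarrow> 'a) \<Rightarrow> bool" where
  "primitive h f g \<longleftrightarrow> integrable (Mh h) g \<and>
     (\<forall>x\<in>{-h..h}. f x - f (-h) = (\<integral>t. indicator {..x} t *\<^sub>R g t \<partial>Mh h))"

lemma primitive_at:
  "primitive h f g \<Longrightarrow> x \<in> {-h..h} \<Longrightarrow> f x = f (-h) + (\<integral>t. indicator {..x} t *\<^sub>R g t \<partial>Mh h)"
  unfolding primitive_def by (metis add.commute diff_add_cancel)

lemma primitive_integrable: "primitive h f g \<Longrightarrow> integrable (Mh h) g"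
  by (simp add: primitive_def)

lemma primitive_increment:
  assumes "primitive h f g" "-h \<le> x" "x \<le> y" "y \<le> h"
  shows "f y - f x = (\<integral>t. indicator {x<..y} t *\<^sub>R g t \<partial>Mh h)"
proof -
  have g: "integrable (Mh h) g" using assms by (auto simp: primitive_def)
  have "f y - f x = (\<integral>t. indicator {..y} t *\<^sub>R g t \<partial>Mh h) - (\<integral>t. indicator {..x} t *\<^sub>R g t \<partial>Mh h)"
    using primitive_at[OF assms(1), of x] primitive_at[OF assms(1), of y] assms(2-) by simp
  also have "\<dots> = (\<integral>t. indicator {..y} t *\<^sub>R g t - indicator {..x} t *\<^sub>R g t \<partial>Mh h)"
    using g by (intro Bochner_Integration.integral_diff[symmetric] integrable_indicator_Mh) auto
  also have "\<dots> = (\<integral>t. indicator {x<..y} t *\<^sub>R g t \<partial>Mh h)"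
    by (rule Bochner_Integration.integral_cong) (use assms in \<open>auto simp: indicator_def\<close>)
  finally show ?thesis .
qed

lemma primitive_total:
  assumes "primitive h f g" "0 < h"
  shows "f h - f (-h) = (\<integral>t. g t \<partial>Mh h)"
proof -
  have "f h - f (-h) = (\<integral>t. indicator {-h<..h} t *\<^sub>R g t \<partial>Mh h)"
    using primitive_increment[OF assms(1), of "-h" h] assms(2) by simp
  also have "\<dots> = (\<integral>t. g t \<partial>Mh h)"
    by (rule Bochner_Integration.integral_cong) (auto simp: indicator_def)
  finally show ?thesis .
qed

lemma primitive_indefinite:
  assumes "integrable (Mh h) g"
  shows "primitive h (\<lambda>x. c + (\<integral>t. indicator {..x} t *\<^sub>R g t \<partial>Mh h)) g"
proof -
  have "(\<integral>t. indicator {..-h} t *\<^sub>R g t \<partial>Mh h) = (\<integral>t. 0 \<partial>Mh h)"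
    by (rule Bochner_Integration.integral_cong) (auto simp: indicator_def)
  then show ?thesis using assms by (auto simp: primitive_def)
qed

text \<open>Dominated convergence along a sequence: the indicators of \<open>{..X n}\<close>
  converge at every t except possibly at t = x, which is a null set.\<close>

lemma continuous_indefinite_integral:
  fixes g :: "real \<Rightarrow> 'a::{banach,second_countable_topology}"
  assumes g: "integrable (Mh h) g"
  shows "continuous_on A (\<lambda>x. (\<integral>t. indicator {..x} t *\<^sub>R g t \<partial>Mh h))"
proof -
  have "isCont (\<lambda>x. (\<integral>t. indicator {..x} t *\<^sub>R g t \<partial>Mh h)) x" for x
  proof (subst continuous_at_sequentially, intro allI impI)
    fix X :: "nat \<Rightarrow> real" assume X: "X \<longlonglongrightarrow> x"
    have "AE t in lborel. t \<noteq> x" by (rule AE_lborel_singleton)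
    then have ne: "AE t in Mh h. t \<noteq> x"
      by (intro AE_restrict_space_iff[THEN iffD2] AE_completion) auto
    have "(\<lambda>n. (\<integral>t. indicator {..X n} t *\<^sub>R g t \<partial>Mh h)) \<longlonglongrightarrow> (\<integral>t. indicator {..x} t *\<^sub>R g t \<partial>Mh h)"
    proof (rule integral_dominated_convergence[where w = "\<lambda>t. norm (g t)"])
      show "AE t in Mh h. (\<lambda>n. indicator {..X n} t *\<^sub>R g t) \<longlonglongrightarrow> indicator {..x} t *\<^sub>R g t"
        using ne
      proof eventually_elim
        case (elim t)
        have "eventually (\<lambda>n. indicator {..X n} t = (indicator {..x} t :: real)) sequentially"
        proof (cases "t < x")
          case True
          then show ?thesis using order_tendstoD(1)[OF X True] by (auto elim!: eventually_mono simp: indicator_def)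
        next
          case False
          then have "x < t" using elim by auto
          then show ?thesis using order_tendstoD(2)[OF X \<open>x < t\<close>] by (auto elim!: eventually_mono simp: indicator_def)
        qed
        then have "eventually (\<lambda>n. indicator {..X n} t *\<^sub>R g t = indicator {..x} t *\<^sub>R g t) sequentially"
          by (auto elim: eventually_mono)
        then show ?case by (rule tendsto_eventually)
      qed
    qed (use g in \<open>auto intro!: borel_measurable_scaleR indicator_measurable_Mh simp: indicator_le_1 mult_left_le_one_le\<close>)
    then show "((\<lambda>x. (\<integral>t. indicator {..x} t *\<^sub>R g t \<partial>Mh h)) \<circ> X) \<longlonglongrightarrow> (\<integral>t. indicator {..x} t *\<^sub>R g t \<partial>Mh h)"
      by (simp add: o_def)
  qed
  then show ?thesis by (simp add: continuous_at_imp_continuous_on)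
qed

lemma primitive_continuous:
  assumes "primitive h f g"
  shows "continuous_on {-h..h} f"
proof -
  have "continuous_on {-h..h} (\<lambda>x. f (-h) + (\<integral>t. indicator {..x} t *\<^sub>R g t \<partial>Mh h))"
    using assms by (intro continuous_intros continuous_indefinite_integral) (auto simp: primitive_def)
  then show ?thesis
    by (rule continuous_on_cong[THEN iffD1, OF refl, rotated]) (rule primitive_at[OF assms, symmetric])
qed

lemma primitive_bounded_linear:
  assumes "primitive h f g" "bounded_linear T"
  shows "primitive h (\<lambda>x. T (f x)) (\<lambda>x. T (g x))"
proof -
  interpret T: bounded_linear T by fact
  have g: "integrable (Mh h) g" using assms by (simp add: primitive_def)
  have "T (\<integral>t. indicator {..x} t *\<^sub>R g t \<partial>Mh h) = (\<integral>t. indicator {..x} t *\<^sub>R T (g t) \<partial>Mh h)" for x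
  proof -
    have "integrable (Mh h) (\<lambda>t. indicator {..x} t *\<^sub>R g t)" using g by (simp add: integrable_indicator_Mh)
    from integral_bounded_linear[OF assms(2) this]
    show ?thesis by (simp add: T.scaleR)
  qed
  then show ?thesis
    using assms g by (auto simp: primitive_def T.diff[symmetric] intro: integrable_bounded_linear[OF assms(2)])
qed

lemma primitive_add:
  assumes "primitive h f g" "primitive h p q"
  shows "primitive h (\<lambda>x. f x + p x) (\<lambda>x. g x + q x)"
proof -
  have g: "integrable (Mh h) g" "integrable (Mh h) q" using assms by (auto simp: primitive_def)
  have "(\<integral>t. indicator {..x} t *\<^sub>R (g t + q t) \<partial>Mh h)
     = (\<integral>t. indicator {..x} t *\<^sub>R g t \<partial>Mh h) + (\<integral>t. indicator {..x} t *\<^sub>R q t \<partial>Mh h)" for x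
    unfolding scaleR_add_right using g by (intro Bochner_Integration.integral_add integrable_indicator_Mh) auto
  then show ?thesis using assms by (simp add: primitive_def add_diff_add)
qed

lemma primitive_const: "primitive h (\<lambda>x. c) (\<lambda>x. 0)"
  by (auto simp: primitive_def)

lemma primitive_cmult: 
  fixes f :: "real \<Rightarrow> 'a::{real_normed_algebra,banach,second_countable_topology}"
  shows "primitive h f g \<Longrightarrow> primitive h (\<lambda>x. c * f x) (\<lambda>x. c * g x)"
  by (erule primitive_bounded_linear) (rule bounded_linear_mult_right)

lemma primitive_scaleR: "primitive h f g \<Longrightarrow> primitive h (\<lambda>x. c *\<^sub>R f x) (\<lambda>x. c *\<^sub>R g x)"
  by (erule primitive_bounded_linear) (rule bounded_linear_scaleR_right)

lemma primitive_uminus: "primitive h f g \<Longrightarrow> primitive h (\<lambda>x. - f x) (\<lambda>x. - g x)"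
  using primitive_scaleR[of h f g "-1"] by simp

lemma primitive_diff: "primitive h f g \<Longrightarrow> primitive h p q \<Longrightarrow> primitive h (\<lambda>x. f x - p x) (\<lambda>x. g x - q x)"
  using primitive_add[OF _ primitive_uminus] by fastforce

lemma primitive_sum:
  "(\<And>i. i \<in> I \<Longrightarrow> primitive h (f i) (g i)) \<Longrightarrow> primitive h (\<lambda>x. \<Sum>i\<in>I. f i x) (\<lambda>x. \<Sum>i\<in>I. g i x)"
  by (induction I rule: infinite_finite_induct) (auto intro: primitive_const primitive_add)

text \<open>The operator equation holds only almost everywhere; this is how it enters as the
  derivative of an absolutely continuous function.\<close>

lemma primitive_cong_AE:
  assumes "primitive h f g" and ae: "AE x in Mh h. g x = g' x" and m: "g' \<in> borel_measurable (Mh h)"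
  shows "primitive h f g'"
proof -
  have g: "integrable (Mh h) g" using assms by (simp add: primitive_def)
  have g': "integrable (Mh h) g'" using integrable_cong_AE_imp[OF g m] ae by (auto elim: eventually_mono)
  have "(\<integral>t. indicator {..x} t *\<^sub>R g t \<partial>Mh h) = (\<integral>t. indicator {..x} t *\<^sub>R g' t \<partial>Mh h)" for x
    by (rule integral_cong_AE)
       (use g g' ae in \<open>auto intro!: borel_measurable_scaleR indicator_measurable_Mh elim: eventually_mono\<close>)
  then show ?thesis using assms g' by (simp add: primitive_def)
qed

lemma primitive_cong:
  assumes "primitive h f g" "0 < h" "\<And>x. x \<in> {-h..h} \<Longrightarrow> f x = f' x"
  shows "primitive h f' g"
  using assms by (auto simp: primitive_def)

text \<open>The engine of the product rule, which thereby avoids differentiation almost everywhere.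
  Measuring increments by a continuous monotone \<open>G\<close> instead of by length admits
  integrands that are merely integrable: their indefinite integrals have no increments controlled by
  the length of the interval.\<close>

lemma constant_of_quadratic_increments:
  fixes K :: "real \<Rightarrow> 'a::real_normed_vector" and G :: "real \<Rightarrow> real"
  assumes ab: "a \<le> b" and cont: "continuous_on {a..b} G"
    and mono: "\<And>x y. a \<le> x \<Longrightarrow> x \<le> y \<Longrightarrow> y \<le> b \<Longrightarrow> G x \<le> G y"
    and bd: "\<And>x y. a \<le> x \<Longrightarrow> x \<le> y \<Longrightarrow> y \<le> b \<Longrightarrow> norm (K y - K x) \<le> C * (G y - G x)\<^sup>2"
  shows "K b = K a"
proof -
  have bd': "norm (K y - K x) \<le> C * (G y - G x)\<^sup>2" if "x \<in> {a..b}" "y \<in> {a..b}" for x y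
    using bd[of x y] bd[of y x] that
    by (cases "x \<le> y") (auto simp: norm_minus_commute power2_commute)
  \<comment> \<open>\<open>K\<close> factors through \<open>G\<close> as a function with vanishing derivative.\<close>
  define pt where "pt s = (SOME x. x \<in> {a..b} \<and> G x = s)" for s
  have pt: "pt s \<in> {a..b} \<and> G (pt s) = s" if "s \<in> {G a..G b}" for s
    unfolding pt_def by (rule someI_ex) (use IVT'[of G a s b] that cont ab in auto)
  define q where "q s = K (pt s)" for s
  have qb: "norm (q s - q t) \<le> C * (s - t)\<^sup>2" if "s \<in> {G a..G b}" "t \<in> {G a..G b}" for s t
    using bd'[of "pt t" "pt s"] pt[OF that(1)] pt[OF that(2)] by (auto simp: q_def)
  have "(q has_derivative (\<lambda>_. 0)) (at t within {G a..G b})" if t: "t \<in> {G a..G b}" for t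
  proof (rule has_derivativeI_sandwich[where e = 1 and H = "\<lambda>s. C * norm (s - t)"])
    fix s assume s: "s \<in> {G a..G b}" "s \<noteq> t" "dist s t < 1"
    have "norm (q s - q t) \<le> C * norm (s - t) * norm (s - t)"
      using qb[OF s(1) t] by (simp add: power2_eq_square algebra_simps)
    then show "norm (q s - q t - 0) / norm (s - t) \<le> C * norm (s - t)"
      using s by (simp add: divide_le_eq)
  next
    have "((\<lambda>s. C * norm (s - t)) \<longlongrightarrow> C * norm (t - t)) (at t within {G a..G b})"
      by (intro tendsto_intros)
    then show "((\<lambda>s. C * norm (s - t)) \<longlongrightarrow> 0) (at t within {G a..G b})" by simp
  qed auto
  then obtain c where c: "\<And>s. s \<in> {G a..G b} \<Longrightarrow> q s = c"
    using has_derivative_zero_constant[of "{G a..G b}" q] by auto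
  have "K x = c" if x: "x \<in> {a..b}" for x
  proof -
    have Gx: "G x \<in> {G a..G b}" using mono[of a x] mono[of x b] x by auto
    \<comment> \<open>Points with equal \<open>G\<close> have equal \<open>K\<close>, so it does not
      matter which preimage \<open>pt\<close> picks.\<close>
    have "norm (K x - K (pt (G x))) \<le> 0" using bd'[of "pt (G x)" x] pt[OF Gx] x by simp
    then show ?thesis using c[OF Gx] by (simp add: q_def)
  qed
  then show ?thesis using ab by simp
qed

lemma integrable_bilinear_continuous:
  fixes pr :: "'a::{banach,second_countable_topology} \<Rightarrow> 'b::{banach,second_countable_topology} \<Rightarrow> 'c::{banach,second_countable_topology}"
  assumes pr: "bounded_bilinear pr" and g: "integrable (Mh h) g" and p: "continuous_on {-h..h} p"
  shows "integrable (Mh h) (\<lambda>x. pr (g x) (p x))"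
proof -
  interpret pr: bounded_bilinear pr by fact
  obtain B where B: "\<And>x y. norm (pr x y) \<le> norm x * norm y * B" "0 < B" using pr.pos_bounded by blast
  obtain D where D: "\<And>x. x \<in> {-h..h} \<Longrightarrow> norm (p x) \<le> D" 
    using compact_imp_bounded[OF compact_continuous_image[OF p compact_Icc]] unfolding bounded_iff by blast
  show ?thesis
  proof (rule Bochner_Integration.integrable_bound)
    show "integrable (Mh h) (\<lambda>x. \<bar>D\<bar> * B * norm (g x))" using g by auto
    have pm: "p \<in> borel_measurable (Mh h)" by (rule borel_measurable_Mh_continuous[OF p])
    show "(\<lambda>x. pr (g x) (p x)) \<in> borel_measurable (Mh h)"
      by (rule borel_measurable_continuous_Pair) (use g pm in \<open>auto intro!: pr.continuous_on continuous_intros\<close>)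
    have "norm (pr (g x) (p x)) \<le> norm (\<bar>D\<bar> * B * norm (g x))" if "x \<in> {-h<..<h}" for x
    proof -
      have "norm (p x) \<le> \<bar>D\<bar>" using D[of x] that by auto
      then have "norm (g x) * norm (p x) * B \<le> norm (g x) * \<bar>D\<bar> * B" 
        using B(2) by (intro mult_right_mono mult_left_mono) auto
      then have "norm (pr (g x) (p x)) \<le> norm (g x) * \<bar>D\<bar> * B" using B(1) by (rule order_trans[rotated])
      also have "\<dots> = norm (\<bar>D\<bar> * B * norm (g x))" using B(2) by (simp add: abs_mult)
      finally show ?thesis .
    qed
    then show "AE x in Mh h. norm (pr (g x) (p x)) \<le> norm (\<bar>D\<bar> * B * norm (g x))"
      by (intro AE_I2) auto
  qed
qed

lemma primitive_increment_norm_le: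
  assumes "primitive h v w" "primitive h G n" "\<And>t. norm (w t) \<le> n t" "-h \<le> x" "x \<le> y" "y \<le> h"
  shows "norm (v y - v x) \<le> G y - G x"
proof -
  have w: "integrable (Mh h) w" "integrable (Mh h) n" using assms by (auto simp: primitive_def)
  have "norm (v y - v x) = norm (\<integral>t. indicator {x<..y} t *\<^sub>R w t \<partial>Mh h)"
    using primitive_increment[OF assms(1,4-6)] by simp
  also have "\<dots> \<le> (\<integral>t. indicator {x<..y} t *\<^sub>R n t \<partial>Mh h)"
    by (rule Bochner_Integration.integral_norm_bound_integral) 
      (simp_all add: integrable_indicator_Mh[OF w(1)] integrable_indicator_Mh[OF w(2)] mult_left_mono assms(3) del: real_scaleR_def,
       simp add: mult_left_mono assms(3))
  also have "\<dots> = G y - G x" using primitive_increment[OF assms(2,4-6)] by simp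
  finally show ?thesis .
qed

text \<open>Product rule. Subtract from the product the indefinite integral \<open>I\<close> of its
  expected derivative. Over [x, y] the difference \<open>K\<close> changes by the integral of pr (g
  t) (p x - p t) + pr (f y - f t) (q t). Both inner differences are bounded by the increment of the
  indefinite integral \<open>G\<close> of |g| + |q|, so \<open>K\<close> has increments quadratic in
  those of \<open>G\<close> and is constant.\<close>

lemma primitive_bilinear:
  fixes pr :: "'a::{banach,second_countable_topology} \<Rightarrow> 'b::{banach,second_countable_topology} \<Rightarrow> 'c::{banach,second_countable_topology}"
  assumes pr: "bounded_bilinear pr" and fg: "primitive h f g" and pq: "primitive h p q"
  shows "primitive h (\<lambda>x. pr (f x) (p x)) (\<lambda>x. pr (g x) (p x) + pr (f x) (q x))"
proof -
  interpret pr: bounded_bilinear pr by fact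
  obtain B where B: "\<And>x y. norm (pr x y) \<le> norm x * norm y * B" "0 < B" using pr.pos_bounded by blast
  have g: "integrable (Mh h) g" and q: "integrable (Mh h) q" using fg pq by (auto simp: primitive_def)
  have fc: "continuous_on {-h..h} f" and pc: "continuous_on {-h..h} p"
    using fg pq primitive_continuous by blast+
  have i1: "integrable (Mh h) (\<lambda>x. pr (g x) (p x))" by (rule integrable_bilinear_continuous[OF pr g pc])
  have i2: "integrable (Mh h) (\<lambda>x. pr (f x) (q x))"
    by (rule integrable_bilinear_continuous[OF pr.flip q fc])
  let ?d = "\<lambda>x. pr (g x) (p x) + pr (f x) (q x)"
  have i: "integrable (Mh h) ?d" using i1 i2 by simp
  let ?n = "\<lambda>t. norm (g t) + norm (q t)"
  have ni: "integrable (Mh h) ?n" using g q by auto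
  define G where "G x = 0 + (\<integral>t. indicator {..x} t *\<^sub>R ?n t \<partial>Mh h)" for x
  define I where "I x = 0 + (\<integral>t. indicator {..x} t *\<^sub>R ?d t \<partial>Mh h)" for x
  have PG: "primitive h G ?n" unfolding G_def by (rule primitive_indefinite[OF ni])
  have PI: "primitive h I ?d" unfolding I_def by (rule primitive_indefinite[OF i])
  define K where "K x = pr (f x) (p x) - I x" for x
  have Gm: "G u \<le> G v" if "-h \<le> u" "u \<le> v" "v \<le> h" for u v
    using primitive_increment_norm_le[OF PG PG _ that] by (metis (mono_tags, lifting) abs_le_iff abs_of_nonneg add_nonneg_nonneg diff_ge_0_iff_ge norm_ge_zero order_refl real_norm_def abs_ge_zero order_trans)
  note incf = primitive_increment_norm_le[OF fg PG] and incp = primitive_increment_norm_le[OF pq PG]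
  have bd: "norm (K y - K x) \<le> B * (G y - G x)\<^sup>2" if xy: "-h \<le> x" "x \<le> y" "y \<le> h" for x y
  proof -
    let ?i = "\<lambda>t. indicator {x<..y} t :: real"
    have j1: "integrable (Mh h) (\<lambda>t. ?i t *\<^sub>R g t)" "integrable (Mh h) (\<lambda>t. ?i t *\<^sub>R q t)" "integrable (Mh h) (\<lambda>t. ?i t *\<^sub>R ?d t)"
       "integrable (Mh h) (\<lambda>t. ?i t *\<^sub>R ?n t)"
      by (rule integrable_indicator_Mh[OF g] integrable_indicator_Mh[OF q] integrable_indicator_Mh[OF i] integrable_indicator_Mh[OF ni], simp)+
    have a1: "pr (f y - f x) (p x) = (\<integral>t. pr (?i t *\<^sub>R g t) (p x) \<partial>Mh h)"
      using primitive_increment[OF fg xy] integral_bounded_linear[OF pr.bounded_linear_left j1(1)] by simp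
    have a2: "pr (f y) (p y - p x) = (\<integral>t. pr (f y) (?i t *\<^sub>R q t) \<partial>Mh h)"
      using primitive_increment[OF pq xy] integral_bounded_linear[OF pr.bounded_linear_right j1(2)] by simp
    have a3: "I y - I x = (\<integral>t. ?i t *\<^sub>R ?d t \<partial>Mh h)" using primitive_increment[OF PI xy] .
    have k1: "integrable (Mh h) (\<lambda>t. pr (?i t *\<^sub>R g t) (p x))" "integrable (Mh h) (\<lambda>t. pr (f y) (?i t *\<^sub>R q t))"
      using integrable_bounded_linear[OF pr.bounded_linear_left j1(1)] integrable_bounded_linear[OF pr.bounded_linear_right j1(2)] by auto
    \<comment> \<open>The splitting is asymmetric, with \<open>p\<close> frozen at x and
      \<open>f\<close> at y, so that no product of two increments is left over.\<close>
    have "K y - K x = pr (f y - f x) (p x) + pr (f y) (p y - p x) - (I y - I x)"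
      by (simp add: K_def pr.diff_left pr.diff_right)
    also have "\<dots> = (\<integral>t. pr (?i t *\<^sub>R g t) (p x) + pr (f y) (?i t *\<^sub>R q t) - ?i t *\<^sub>R ?d t \<partial>Mh h)"
      using k1 j1 by (simp add: a1 a2 a3)
    also have "\<dots> = (\<integral>t. ?i t *\<^sub>R (pr (g t) (p x - p t) + pr (f y - f t) (q t)) \<partial>Mh h)"
      by (rule Bochner_Integration.integral_cong) (auto simp: indicator_def pr.diff_left pr.diff_right pr.zero_left pr.zero_right)
    finally have eq: "K y - K x = (\<integral>t. ?i t *\<^sub>R (pr (g t) (p x - p t) + pr (f y - f t) (q t)) \<partial>Mh h)" .
    have m: "norm (?i t *\<^sub>R (pr (g t) (p x - p t) + pr (f y - f t) (q t))) \<le> ?i t *\<^sub>R ?n t * (B * (G y - G x))" 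
      if "t \<in> {-h<..<h}" for t
    proof (cases "t \<in> {x<..y}")
      case True
      have n1: "norm (p x - p t) \<le> G y - G x"
        using incp[of x t] Gm[of t y] True xy by (simp add: norm_minus_commute)
      have n2: "norm (f y - f t) \<le> G y - G x"
        using incf[of t y] Gm[of x t] True xy by simp
      have "norm (pr (g t) (p x - p t)) \<le> norm (g t) * (G y - G x) * B"
        using B(1)[of "g t" "p x - p t"] n1 B(2) by (smt (verit) mult_left_mono mult_right_mono norm_ge_zero)
      moreover have "norm (pr (f y - f t) (q t)) \<le> (G y - G x) * norm (q t) * B"
        using B(1)[of "f y - f t" "q t"] n2 B(2) by (smt (verit) mult_left_mono mult_right_mono norm_ge_zero)
      ultimately show ?thesis
        using True norm_triangle_ineq[of "pr (g t) (p x - p t)" "pr (f y - f t) (q t)"] by (simp add: algebra_simps)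
    qed auto
    have kk: "integrable (Mh h) (\<lambda>t. ?i t *\<^sub>R (pr (g t) (p x - p t) + pr (f y - f t) (q t)))"
    proof -
      have "integrable (Mh h) (\<lambda>t. pr (?i t *\<^sub>R g t) (p x) + pr (f y) (?i t *\<^sub>R q t) - ?i t *\<^sub>R ?d t)"
        using k1 j1 by auto
      then show ?thesis
        by (rule Bochner_Integration.integrable_cong[THEN iffD1, OF refl, rotated]) 
          (auto simp: indicator_def pr.diff_left pr.diff_right pr.zero_left pr.zero_right)
    qed
    have "norm (K y - K x) \<le> (\<integral>t. ?i t *\<^sub>R ?n t * (B * (G y - G x)) \<partial>Mh h)"
      unfolding eq by (rule Bochner_Integration.integral_norm_bound_integral) (use m kk j1(4) in auto)
    also have "\<dots> = (\<integral>t. ?i t *\<^sub>R ?n t \<partial>Mh h) * (B * (G y - G x))" using j1(4) by simp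
    also have "\<dots> = B * (G y - G x)\<^sup>2" using primitive_increment[OF PG xy] by (simp add: power2_eq_square)
    finally show ?thesis .
  qed
  have "pr (f x) (p x) - pr (f (-h)) (p (-h)) = (\<integral>t. indicator {..x} t *\<^sub>R ?d t \<partial>Mh h)" if x: "x \<in> {-h..h}" for x
  proof -
    have "K x = K (-h)"
    proof (rule constant_of_quadratic_increments)
      show "continuous_on {-h..x} G" using primitive_continuous[OF PG] by (rule continuous_on_subset) (use x in auto)
      fix u v assume "-h \<le> u" "u \<le> v" "v \<le> x"
      then show "G u \<le> G v" using Gm[of u v] x by auto
      show "norm (K v - K u) \<le> B * (G v - G u)\<^sup>2" using bd[of u v] \<open>-h \<le> u\<close> \<open>u \<le> v\<close> \<open>v \<le> x\<close> x by auto
    qed (use x in auto)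
    moreover have "I x - I (-h) = (\<integral>t. indicator {..x} t *\<^sub>R ?d t \<partial>Mh h)" using PI x unfolding primitive_def by blast
    moreover have "pr (f x) (p x) - pr (f (-h)) (p (-h)) = K x - K (-h) + (I x - I (-h))" by (simp add: K_def)
    ultimately show ?thesis by simp
  qed
  then show ?thesis using i by (simp add: primitive_def)
qed

section \<open>Weak derivatives\<close>

lemma AE_Mh_iff: "(AE x in Mh h. P x) \<longleftrightarrow> (AE x in lebesgue. x \<in> {-h<..<h} \<longrightarrow> P x)"
  by (rule AE_restrict_space_iff) auto

text \<open>Lebesgue measure is complete, so a change on a null set keeps measurability; the
  congruence rules below can therefore ask for equality almost everywhere alone.\<close>

lemma borel_measurable_Mh_cong_AE:
  fixes f :: "real \<Rightarrow> 'b::euclidean_space"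
  assumes f: "f \<in> borel_measurable (Mh h)" and ae: "AE x in Mh h. f x = g x"
  shows "g \<in> borel_measurable (Mh h)"
proof -
  let ?S = "{-h<..<h}"
  have 1: "(\<lambda>x. if x \<in> ?S then f x else 0) \<in> borel_measurable lebesgue"
    using f by (subst borel_measurable_if) auto
  have "(\<lambda>x. if x \<in> ?S then g x else 0) \<in> borel_measurable lebesgue"
    by (rule borel_measurable_AE[OF 1]) (use ae[unfolded AE_Mh_iff] in \<open>auto elim: eventually_mono\<close>)
  then show ?thesis by (subst (asm) borel_measurable_if) auto
qed

lemma integrable_Mh_cong_AE:
  fixes f :: "real \<Rightarrow> 'b::euclidean_space"
  assumes "integrable (Mh h) f" "AE x in Mh h. f x = g x"
  shows "integrable (Mh h) g"
  by (rule integrable_cong_AE_imp[OF assms(1) borel_measurable_Mh_cong_AE[OF _ assms(2)] assms(2)])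
    (use assms(1) in auto)

text \<open>If \<open>f\<close> is not measurable, neither is \<open>g\<close>, and both integrals
  have the default value 0.\<close>

lemma integral_Mh_cong_AE:
  fixes f :: "real \<Rightarrow> 'b::euclidean_space"
  assumes "AE x in Mh h. f x = g x"
  shows "(\<integral>x. f x \<partial>Mh h) = (\<integral>x. g x \<partial>Mh h)"
proof (cases "f \<in> borel_measurable (Mh h)")
  case True
  then show ?thesis using borel_measurable_Mh_cong_AE[OF True assms] assms by (intro integral_cong_AE) auto
next
  case False
  have "AE x in Mh h. g x = f x" using assms by (auto elim: eventually_mono)
  then have "\<not> integrable (Mh h) f" "\<not> integrable (Mh h) g"
    using False borel_measurable_Mh_cong_AE[of g h f] by (auto dest: borel_measurable_integrable)
  then show ?thesis by (simp add: not_integrable_integral_eq)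
qed

lemma integrable_Mh_continuous:
  fixes f :: "real \<Rightarrow> 'b::euclidean_space"
  assumes "continuous_on {-h..h} f"
  shows "integrable (Mh h) f"
proof -
  have "integrable (Mh h) (\<lambda>x. (1::real))"
    using finite_measure.integrable_const[OF finite_measure_Mh] .
  from integrable_bilinear_continuous[OF bounded_bilinear_scaleR this assms]
  show ?thesis by simp
qed

text \<open>The fundamental theorem for the gauge integral on [-h, x], carried over to the Lebesgue
  integral on the open interval; the two differ by the null set of endpoints.\<close>

lemma primitive_of_derivative:
  fixes f :: "real \<Rightarrow> 'b::euclidean_space"
  assumes d: "\<And>x. x \<in> {-h..h} \<Longrightarrow> (f has_vector_derivative f' x) (at x within {-h..h})"
    and c: "continuous_on {-h..h} f'"
  shows "primitive h f f'"
  unfolding primitive_def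
proof (intro conjI ballI)
  show "integrable (Mh h) f'" by (rule integrable_Mh_continuous[OF c])
  fix x assume x: "x \<in> {-h..h}"
  have ci: "integrable (lebesgue_on {-h..x}) f'"
    by (rule continuous_imp_integrable_real) (use c x in \<open>auto intro: continuous_on_subset\<close>)
  have "(f' has_integral (f x - f (-h))) {-h..x}"
    by (rule fundamental_theorem_of_calculus)
      (use x in \<open>auto intro!: has_vector_derivative_within_subset[OF d]\<close>)
  then have "f x - f (-h) = integral {-h..x} f'"
    by (rule integral_unique[symmetric])
  also have "\<dots> = integral\<^sup>L (lebesgue_on {-h..x}) f'"
    by (rule lebesgue_integral_eq_integral[OF ci, symmetric]) auto
  also have "\<dots> = (\<integral>t. indicator {-h..x} t *\<^sub>R f' t \<partial>lebesgue)"
    by (rule integral_restrict_space) auto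
  also have "\<dots> = (\<integral>t. indicator {-h<..<h} t *\<^sub>R (indicator {..x} t *\<^sub>R f' t) \<partial>lebesgue)"
  proof (rule integral_cong_AE)
    show "(\<lambda>t. indicator {-h..x} t *\<^sub>R f' t) \<in> borel_measurable lebesgue"
      using ci by (subst (asm) integrable_restrict_space) auto
    have "integrable (Mh h) (\<lambda>t. indicator {..x} t *\<^sub>R f' t)"
      by (rule integrable_indicator_Mh) (auto intro: integrable_Mh_continuous[OF c])
    then show "(\<lambda>t. indicator {-h<..<h} t *\<^sub>R (indicator {..x} t *\<^sub>R f' t)) \<in> borel_measurable lebesgue"
      by (subst (asm) integrable_restrict_space) auto
    have "AE t in lebesgue. t \<noteq> -h" "AE t in lebesgue. t \<noteq> h"
      by (auto intro: AE_completion AE_lborel_singleton)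
    then show "AE t in lebesgue. indicator {-h..x} t *\<^sub>R f' t = indicator {-h<..<h} t *\<^sub>R (indicator {..x} t *\<^sub>R f' t)"
      by eventually_elim (use x in \<open>auto simp: indicator_def\<close>)
  qed
  also have "\<dots> = (\<integral>t. indicator {..x} t *\<^sub>R f' t \<partial>Mh h)"
    by (rule integral_restrict_space[symmetric]) auto
  finally show "f x - f (-h) = (\<integral>t. indicator {..x} t *\<^sub>R f' t \<partial>Mh h)" .
qed

section \<open>Test functions and the fundamental lemma of the calculus of variations\<close>

lemma test_fun_derivative:
  assumes "test_fun h \<phi>"
  shows "(\<phi> has_vector_derivative vector_derivative \<phi> (at x)) (at x)"
    and "continuous_on S (\<lambda>x. vector_derivative \<phi> (at x))"
    and "continuous_on S \<phi>"
proof -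
  have c: "\<phi> C1_differentiable_on UNIV" using assms by (simp add: test_fun_def)
  then show 1: "(\<phi> has_vector_derivative vector_derivative \<phi> (at x)) (at x)" for x
    by (auto simp: C1_differentiable_on_eq vector_derivative_works)
  show "continuous_on S (\<lambda>x. vector_derivative \<phi> (at x))"
    using c by (auto simp: C1_differentiable_on_eq intro: continuous_on_subset)
  show "continuous_on S \<phi>" using 1 
    by (meson has_vector_derivative_continuous continuous_at_imp_continuous_on)
qed

lemma integrable_Mh_subinterval_iff:
  fixes g :: "real \<Rightarrow> 'b::euclidean_space"
  assumes "-h < a" "b < h"
  shows "integrable (Mh h) (\<lambda>x. indicator {a..b} x *\<^sub>R g x) \<longleftrightarrow> integrable (lebesgue_on {a..b}) g"
proof -
  have eq: "(\<lambda>x. indicator {-h<..<h} x *\<^sub>R (indicator {a..b} x *\<^sub>R g x)) = (\<lambda>x. indicator {a..b} x *\<^sub>R g x)"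
    using assms by (auto simp: indicator_def)
  have "integrable (Mh h) (\<lambda>x. indicator {a..b} x *\<^sub>R g x) \<longleftrightarrow> integrable lebesgue (\<lambda>x. indicator {-h<..<h} x *\<^sub>R (indicator {a..b} x *\<^sub>R g x))"
    by (rule integrable_restrict_space) auto
  also have "\<dots> \<longleftrightarrow> integrable (lebesgue_on {a..b}) g"
    unfolding eq by (rule integrable_restrict_space[symmetric]) auto
  finally show ?thesis .
qed

lemma integrable_compact_support:
  fixes g :: "real \<Rightarrow> 'b::euclidean_space" and \<phi> :: "real \<Rightarrow> real"
  assumes ab: "-h < a" "b < h" and z: "\<And>x. x \<notin> {a..b} \<Longrightarrow> \<phi> x = 0" and c: "continuous_on {-h..h} \<phi>"
    and g: "integrable (lebesgue_on {a..b}) g"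
  shows "integrable (Mh h) (\<lambda>x. \<phi> x *\<^sub>R g x)"
proof -
  have "integrable (Mh h) (\<lambda>x. indicator {a..b} x *\<^sub>R g x)"
    using g by (simp only: integrable_Mh_subinterval_iff[OF ab])
  from integrable_bilinear_continuous[OF bounded_bilinear.flip[OF bounded_bilinear_scaleR] this c]
  show ?thesis
    by (rule Bochner_Integration.integrable_cong[THEN iffD1, OF refl, rotated]) (use z in \<open>auto simp: indicator_def\<close>)
qed

lemma test_fun_integrable:
  fixes g :: "real \<Rightarrow> 'b::euclidean_space"
  assumes t: "test_fun h \<phi>" and g: "\<And>a b. -h < a \<Longrightarrow> b < h \<Longrightarrow> integrable (lebesgue_on {a..b}) g"
  shows "integrable (Mh h) (\<lambda>x. \<phi> x *\<^sub>R g x)"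
    and "integrable (Mh h) (\<lambda>x. vector_derivative \<phi> (at x) *\<^sub>R g x)"
proof -
  obtain a b where ab: "-h < a" "b < h" "\<And>x. x \<notin> {a..b} \<Longrightarrow> \<phi> x = 0"
    using t by (auto simp: test_fun_def)
  show "integrable (Mh h) (\<lambda>x. \<phi> x *\<^sub>R g x)"
    by (rule integrable_compact_support[OF ab test_fun_derivative(3)[OF t] g[OF ab(1,2)]])
  have d0: "vector_derivative \<phi> (at x) = 0" if "x \<notin> {a..b}" for x
  proof -
    have "(\<phi> has_vector_derivative 0) (at x)"
      by (rule has_vector_derivative_transform_within_open[of "\<lambda>_. 0" _ _ "-{a..b}"]) (use that ab in auto)
    then show ?thesis by (rule vector_derivative_at)
  qed
  show "integrable (Mh h) (\<lambda>x. vector_derivative \<phi> (at x) *\<^sub>R g x)"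
    by (rule integrable_compact_support[OF ab(1,2) d0 test_fun_derivative(2)[OF t] g[OF ab(1,2)]])
qed

text \<open>Test functions are of class C^1, and the square of the positive part has that
  regularity. In all four sign cases the error of the linearization is at most (s - t)^2.\<close>

lemma has_derivative_positive_part_square:
  "((\<lambda>t::real. (max 0 t)\<^sup>2) has_field_derivative 2 * max 0 t) (at t)"
proof -
  have bd: "\<bar>(max 0 s)\<^sup>2 - (max 0 t)\<^sup>2 - 2 * max 0 t * (s - t)\<bar> \<le> (s - t)\<^sup>2" for s :: real
  proof -
    consider "s \<ge> 0" "t \<ge> 0" | "s < 0" "t \<ge> 0" | "s \<ge> 0" "t < 0" | "s < 0" "t < 0" by linarith
    then show ?thesis
    proof cases
      case 1
      have "s\<^sup>2 - t\<^sup>2 - 2 * t * (s - t) = (s - t)\<^sup>2" by (simp add: power2_eq_square algebra_simps)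
      with 1 show ?thesis by simp
    next
      case 2
      have "s * t \<le> 0" using 2 by (simp add: mult_nonpos_nonneg)
      moreover have "0 \<le> s * s" "0 \<le> t * t" by simp_all
      ultimately have "\<bar>t * t - s * (t * 2)\<bar> \<le> s * s + t * t - s * (t * 2)" by linarith
      with 2 show ?thesis by (simp add: power2_eq_square algebra_simps)
    next
      case 3
      have "s * t \<le> 0" using 3 by (simp add: mult_nonneg_nonpos)
      with 3 show ?thesis by (simp add: power2_eq_square algebra_simps)
    qed simp
  qed
  show ?thesis unfolding has_field_derivative_def
  proof (rule has_derivativeI_sandwich[where e = 1 and H = "\<lambda>s. norm (s - t)"])
    show "bounded_linear ((*) (2 * max 0 t))" by (rule bounded_linear_mult_right)
    have "((\<lambda>s. norm (s - t)) \<longlongrightarrow> norm (t - t)) (at t)" by (intro tendsto_intros)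
    then show "((\<lambda>s. norm (s - t)) \<longlongrightarrow> 0) (at t)" by simp
    fix s assume "s \<noteq> t" 
    then show "norm ((max 0 s)\<^sup>2 - (max 0 t)\<^sup>2 - 2 * max 0 t * (s - t)) / norm (s - t) \<le> norm (s - t)"
      using bd[of s] by (simp add: divide_le_eq power2_eq_square abs_mult_self_eq flip: abs_mult)
  qed auto
qed

text \<open>The map p -> n p / (1 + n p) fixes 0 and takes each positive p to values tending to 1.
  Applied to the squared positive part of (x - a) (b - x), it gives C^1 functions between 0 and 1,
  vanishing outside (a, b), that converge to the indicator of (a, b).\<close>

definition interval_bump :: "real \<Rightarrow> real \<Rightarrow> nat \<Rightarrow> real \<Rightarrow> real" where
  "interval_bump a b n x = (let p = (max 0 ((x - a) * (b - x)))\<^sup>2 in n * p / (1 + n * p))"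

lemma test_fun_interval_bump:
  assumes "-h < a" "b < h" "a \<le> b"
  shows "test_fun h (interval_bump a b n)"
  unfolding test_fun_def
proof (intro conjI exI allI impI)
  show "interval_bump a b n C1_differentiable_on UNIV"
    unfolding C1_differentiable_on_def
  proof (intro exI conjI ballI)
    let ?p = "\<lambda>x. (max 0 ((x - a) * (b - x)))\<^sup>2"
    let ?dp = "\<lambda>x. 2 * max 0 ((x - a) * (b - x)) * ((b - x) - (x - a))"
    let ?d = "\<lambda>x. n * ?dp x / (1 + n * ?p x)\<^sup>2"
    have pos: "1 + n * ?p x > 0" for x by (auto intro!: add_pos_nonneg)
    show "(interval_bump a b n has_vector_derivative ?d x) (at x)" for x
    proof -
      have "((\<lambda>x. (x - a) * (b - x)) has_field_derivative ((b - x) - (x - a))) (at x)"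
        by (auto intro!: derivative_eq_intros simp: algebra_simps)
      from DERIV_chain2[OF has_derivative_positive_part_square this]
      have dp: "(?p has_field_derivative ?dp x) (at x)" .
      have "((\<lambda>x. n * ?p x / (1 + n * ?p x)) has_field_derivative
         (n * ?dp x * (1 + n * ?p x) - n * ?p x * (n * ?dp x)) / ((1 + n * ?p x) * (1 + n * ?p x))) (at x)"
        by (rule DERIV_divide)
          (use pos[of x] DERIV_cmult[OF dp, of n] DERIV_add[OF DERIV_const[of 1] DERIV_cmult[OF dp, of n]] in \<open>simp_all add: less_le\<close>)
      moreover have "(n * ?dp x * (1 + n * ?p x) - n * ?p x * (n * ?dp x)) / ((1 + n * ?p x) * (1 + n * ?p x)) = ?d x"
        by (simp add: power2_eq_square algebra_simps)
      ultimately have "((\<lambda>x. n * ?p x / (1 + n * ?p x)) has_field_derivative ?d x) (at x)" by (simp only:)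
      then show ?thesis 
        unfolding interval_bump_def Let_def has_real_derivative_iff_has_vector_derivative .
    qed
    show "continuous_on UNIV ?d"
    proof (intro continuous_intros ballI)
      show "(1 + n * ?p x)\<^sup>2 \<noteq> 0" for x using pos[of x] by (simp only: power_eq_0_iff) linarith
    qed
  qed
  show "-h < a" "b < h" by fact+
  fix x assume "x \<notin> {a..b}"
  then have "(x - a) * (b - x) \<le> 0" using \<open>a \<le> b\<close> by (auto simp: mult_le_0_iff)
  then show "interval_bump a b n x = 0" by (simp add: interval_bump_def Let_def)
qed

lemma interval_bump_bounds: "0 \<le> interval_bump a b n x" "interval_bump a b n x \<le> 1"
proof -
  have "0 \<le> n * (max 0 ((x - a) * (b - x)))\<^sup>2" by simp
  then show "0 \<le> interval_bump a b n x" "interval_bump a b n x \<le> 1"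
    unfolding interval_bump_def Let_def
    by (simp add: add_nonneg_nonneg, smt (verit) divide_le_eq_1)
qed

lemma interval_bump_tendsto:
  assumes "a \<le> b"
  shows "(\<lambda>n. interval_bump a b n x) \<longlonglongrightarrow> indicator {a<..<b} x"
proof (cases "(x - a) * (b - x) > 0")
  case True
  define p where "p = (max 0 ((x - a) * (b - x)))\<^sup>2"
  have p: "p > 0" using True unfolding p_def by (metis less_irrefl max.absorb_iff2 max_def order_less_imp_le zero_less_power)
  have "(\<lambda>n. 1 - 1 / (1 + p * real n)) \<longlonglongrightarrow> 1 - 0"
    by (intro tendsto_intros real_tendsto_divide_at_top[OF tendsto_const] 
        filterlim_tendsto_add_at_top[OF tendsto_const] filterlim_tendsto_pos_mult_at_top[OF tendsto_const p] filterlim_real_sequentially)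
  moreover have "1 - 1 / (1 + p * real n) = interval_bump a b n x" for n
  proof -
    have "1 + p * real n > 0" using p by (auto intro!: add_pos_nonneg)
    then have "1 - 1 / (1 + p * real n) = n * p / (1 + n * p)" by (simp add: field_simps)
    then show ?thesis by (simp add: interval_bump_def p_def Let_def)
  qed
  ultimately show ?thesis using True assms by (auto simp: zero_less_mult_iff)
next
  case False
  then have "interval_bump a b n x = 0" for n by (simp add: interval_bump_def Let_def)
  then show ?thesis using False by (auto simp: zero_less_mult_iff indicator_def)
qed

text \<open>Bumps converge boundedly to indicators, so the integral of \<open>w\<close> vanishes
  over every interval compactly contained in (-h, h). Since \<open>w\<close> is only locally
  integrable, the half-line criterion is applied on (-k, k) for k < h, and these intervals exhaust
  (-h, h).\<close>

lemma AE_zero_of_test_integrals: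
  fixes w :: "real \<Rightarrow> 'b::euclidean_space"
  assumes loc: "\<And>a b. -h < a \<Longrightarrow> b < h \<Longrightarrow> integrable (lebesgue_on {a..b}) w"
    and z: "\<And>\<phi>. test_fun h \<phi> \<Longrightarrow> (\<integral>x. \<phi> x *\<^sub>R w x \<partial>Mh h) = 0"
  shows "AE x in Mh h. w x = 0"
proof -
  have i0: "(\<integral>x. indicator {a<..<b} x *\<^sub>R w x \<partial>Mh h) = 0" if ab: "-h < a" "b < h" "a \<le> b" for a b
  proof -
    have wi: "integrable (Mh h) (\<lambda>x. indicator {a..b} x *\<^sub>R w x)"
      using loc[OF ab(1,2)] by (simp only: integrable_Mh_subinterval_iff[OF ab(1,2)])
    have lim: "(\<lambda>n. (\<integral>x. interval_bump a b n x *\<^sub>R w x \<partial>Mh h)) \<longlonglongrightarrow> (\<integral>x. indicator {a<..<b} x *\<^sub>R w x \<partial>Mh h)"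
    proof (rule integral_dominated_convergence[where w = "\<lambda>x. norm (indicator {a..b} x *\<^sub>R w x)"])
      show "integrable (Mh h) (\<lambda>x. norm (indicator {a..b} x *\<^sub>R w x))" using wi by (rule integrable_norm)
      show "(\<lambda>x. interval_bump a b n x *\<^sub>R w x) \<in> borel_measurable (Mh h)" for n
        using test_fun_integrable(1)[OF test_fun_interval_bump[OF ab] loc] by auto
      have "(\<lambda>x. indicator {a<..<b} x *\<^sub>R (indicator {a..b} x *\<^sub>R w x)) \<in> borel_measurable (Mh h)"
        by (rule borel_measurable_scaleR[OF indicator_measurable_Mh borel_measurable_integrable[OF wi]]) simp
      moreover have "(\<lambda>x. indicator {a<..<b} x *\<^sub>R (indicator {a..b} x *\<^sub>R w x)) = (\<lambda>x. indicator {a<..<b} x *\<^sub>R w x)"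
        by (auto simp: indicator_def)
      ultimately show "(\<lambda>x. indicator {a<..<b} x *\<^sub>R w x) \<in> borel_measurable (Mh h)" by (simp only:)
      have "(\<lambda>n. interval_bump a b n x *\<^sub>R w x) \<longlonglongrightarrow> indicator {a<..<b} x *\<^sub>R w x" for x
        using tendsto_scaleR[OF interval_bump_tendsto[OF ab(3), of x] tendsto_const[of "w x"]] .
      then show "AE x in Mh h. (\<lambda>n. interval_bump a b n x *\<^sub>R w x) \<longlonglongrightarrow> indicator {a<..<b} x *\<^sub>R w x" by simp
      have "norm (interval_bump a b n x *\<^sub>R w x) \<le> norm (indicator {a..b} x *\<^sub>R w x)" for n x
      proof (cases "x \<in> {a..b}")
        case True
        then show ?thesis using interval_bump_bounds[of a b n x] by (auto intro!: mult_left_le_one_le)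
      next
        case False
        then have "(x - a) * (b - x) \<le> 0" using ab by (auto simp: mult_le_0_iff)
        then show ?thesis by (simp add: interval_bump_def Let_def)
      qed
      then show "AE x in Mh h. norm (interval_bump a b n x *\<^sub>R w x) \<le> norm (indicator {a..b} x *\<^sub>R w x)" for n by simp
    qed
    then show ?thesis using z[OF test_fun_interval_bump[OF ab]] by (simp add: LIMSEQ_const_iff)
  qed
  have sub: "AE x in lebesgue. x \<in> {-k<..<k} \<longrightarrow> w x = 0" if k: "k < h" for k
  proof (cases "k > 0")
    case True
    have "AE x in Mh k. w x = 0"
    proof (rule AE_zero_of_halfline_integrals)
      have "integrable (lebesgue_on {-k..k}) w" using loc[of "-k" k] k by auto
      then have "integrable lebesgue (\<lambda>x. indicator {-k..k} x *\<^sub>R w x)"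
        by (subst (asm) integrable_restrict_space) auto
      then have "integrable lebesgue (\<lambda>x. indicator {-k<..<k} x *\<^sub>R (indicator {-k..k} x *\<^sub>R w x))"
        by (rule integrable_mult_indicator[rotated]) auto
      moreover have "(\<lambda>x. indicator {-k<..<k} x *\<^sub>R (indicator {-k..k} x *\<^sub>R w x)) = (\<lambda>x. indicator {-k<..<k} x *\<^sub>R w x)"
        by (auto simp: indicator_def)
      ultimately show "integrable (Mh k) w" by (subst integrable_restrict_space) auto
      fix x
      have "(\<integral>t. indicator {x<..} t *\<^sub>R w t \<partial>Mh k) = (\<integral>t. indicator {-k<..<k} t *\<^sub>R (indicator {x<..} t *\<^sub>R w t) \<partial>lebesgue)"
        by (rule integral_restrict_space) auto
      \<comment> \<open>Clamping x to [-k, k] also covers the half-lines that contain (-k, k) or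
        miss it.\<close>
      also have "\<dots> = (\<integral>t. indicator {-h<..<h} t *\<^sub>R (indicator {min k (max x (-k))<..<k} t *\<^sub>R w t) \<partial>lebesgue)"
        by (rule Bochner_Integration.integral_cong) (use k True in \<open>auto simp: indicator_def\<close>)
      also have "\<dots> = (\<integral>t. indicator {min k (max x (-k))<..<k} t *\<^sub>R w t \<partial>Mh h)"
        by (rule integral_restrict_space[symmetric]) auto
      also have "\<dots> = 0" by (rule i0) (use k True in auto)
      finally show "(\<integral>t. indicator {x<..} t *\<^sub>R w t \<partial>Mh k) = 0" .
    qed
    then show ?thesis by (simp add: AE_Mh_iff)
  qed auto
  have "AE x in lebesgue. \<forall>n::nat. x \<in> {-(h - 1 / Suc n)<..<h - 1 / Suc n} \<longrightarrow> w x = 0"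
    by (subst AE_all_countable) (intro allI sub, simp)
  then show ?thesis unfolding AE_Mh_iff
  proof eventually_elim
    case (elim x)
    show ?case
    proof
      assume x: "x \<in> {-h<..<h}"
      then have "0 < h - \<bar>x\<bar>" by auto
      then obtain n where "1 / Suc n < h - \<bar>x\<bar>" using nat_approx_posE by blast
      then have "x \<in> {-(h - 1 / Suc n)<..<h - 1 / Suc n}" by auto
      then show "w x = 0" using elim by blast
    qed
  qed
qed

lemma weak_deriv_locally_integrable:
  assumes "weak_deriv h f g" "-h < a" "b < h"
  shows "integrable (lebesgue_on {a..b}) f" "integrable (lebesgue_on {a..b}) g"
  using assms by (auto simp: weak_deriv_def)

lemma weak_deriv_test:
  assumes "weak_deriv h f g" "test_fun h \<phi>"
  shows "(\<integral>x. vector_derivative \<phi> (at x) *\<^sub>R f x \<partial>Mh h) = - (\<integral>x. \<phi> x *\<^sub>R g x \<partial>Mh h)"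
  using assms unfolding weak_deriv_def by blast

lemma weak_deriv_unique:
  assumes 1: "weak_deriv h f g1" and 2: "weak_deriv h f g2"
  shows "AE x in Mh h. g1 x = g2 x"
proof -
  have "AE x in Mh h. g1 x - g2 x = 0"
  proof (rule AE_zero_of_test_integrals)
    show "integrable (lebesgue_on {a..b}) (\<lambda>x. g1 x - g2 x)" if "-h < a" "b < h" for a b
      using weak_deriv_locally_integrable[OF 1 that] weak_deriv_locally_integrable[OF 2 that] by auto
    fix \<phi> assume t: "test_fun h \<phi>"
    have "(\<integral>x. \<phi> x *\<^sub>R g1 x \<partial>Mh h) = (\<integral>x. \<phi> x *\<^sub>R g2 x \<partial>Mh h)"
      using weak_deriv_test[OF 1 t] weak_deriv_test[OF 2 t] by simp
    moreover have "(\<integral>x. \<phi> x *\<^sub>R (g1 x - g2 x) \<partial>Mh h) = (\<integral>x. \<phi> x *\<^sub>R g1 x \<partial>Mh h) - (\<integral>x. \<phi> x *\<^sub>R g2 x \<partial>Mh h)"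
      unfolding scaleR_diff_right
      by (rule Bochner_Integration.integral_diff[OF test_fun_integrable(1)[OF t weak_deriv_locally_integrable(2)[OF 1]]
            test_fun_integrable(1)[OF t weak_deriv_locally_integrable(2)[OF 2]]])
    ultimately show "(\<integral>x. \<phi> x *\<^sub>R (g1 x - g2 x) \<partial>Mh h) = 0" by simp
  qed
  then show ?thesis by eventually_elim simp
qed

lemma integrable_Mh_subinterval:
  fixes g :: "real \<Rightarrow> 'b::euclidean_space"
  assumes "integrable (Mh h) g" "-h < a" "b < h"
  shows "integrable (lebesgue_on {a..b}) g"
  using integrable_indicator_Mh[OF assms(1), of "{a..b}"] integrable_Mh_subinterval_iff[OF assms(2,3), of g] by simp

text \<open>Product rule with a test function; the boundary term disappears because the support of
  the test function stays away from both ends.\<close>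

lemma weak_deriv_of_primitive:
  assumes p: "primitive h f g" and h: "0 < h"
  shows "weak_deriv h f g"
  unfolding weak_deriv_def
proof (intro conjI allI impI)
  have fc: "continuous_on {-h..h} f" by (rule primitive_continuous[OF p])
  have fi: "integrable (Mh h) f" by (rule integrable_Mh_continuous[OF fc])
  have gi: "integrable (Mh h) g" by (rule primitive_integrable[OF p])
  show "integrable (lebesgue_on {a..b}) f" "integrable (lebesgue_on {a..b}) g" if "-h < a" "b < h" for a b
    using integrable_Mh_subinterval[OF fi that] integrable_Mh_subinterval[OF gi that] by auto
  note loc = this
  fix \<phi> assume t: "test_fun h \<phi>"
  have P: "primitive h \<phi> (\<lambda>x. vector_derivative \<phi> (at x))"
    by (rule primitive_of_derivative)
      (auto intro: test_fun_derivative[OF t] has_vector_derivative_at_within)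
  have "\<phi> h = 0" "\<phi> (-h) = 0" using t h by (auto simp: test_fun_def)
  then have "(\<integral>x. vector_derivative \<phi> (at x) *\<^sub>R f x + \<phi> x *\<^sub>R g x \<partial>Mh h) = 0"
    using primitive_total[OF primitive_bilinear[OF bounded_bilinear_scaleR P p] h] by simp
  moreover have "(\<integral>x. vector_derivative \<phi> (at x) *\<^sub>R f x + \<phi> x *\<^sub>R g x \<partial>Mh h)
    = (\<integral>x. vector_derivative \<phi> (at x) *\<^sub>R f x \<partial>Mh h) + (\<integral>x. \<phi> x *\<^sub>R g x \<partial>Mh h)"
    by (rule Bochner_Integration.integral_add[OF test_fun_integrable(2)[OF t loc(1)] test_fun_integrable(1)[OF t loc(2)]])
  ultimately show "(\<integral>x. vector_derivative \<phi> (at x) *\<^sub>R f x \<partial>Mh h) = - (\<integral>x. \<phi> x *\<^sub>R g x \<partial>Mh h)"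
    by (simp add: eq_neg_iff_add_eq_0)
qed

lemma integrable_subinterval_cong_AE:
  fixes f :: "real \<Rightarrow> 'b::euclidean_space"
  assumes ae: "AE x in Mh h. f x = f' x" and ab: "-h < a" "b < h" and f: "integrable (lebesgue_on {a..b}) f"
  shows "integrable (lebesgue_on {a..b}) f'"
proof -
  have i: "integrable lebesgue (\<lambda>x. if x \<in> {a..b} then f x else 0)"
    using f by (subst Lebesgue_Measure.integrable_restrict_UNIV) auto
  have ae': "AE x in lebesgue. (if x \<in> {a..b} then f x else 0) = (if x \<in> {a..b} then f' x else 0)"
    using ae unfolding AE_Mh_iff by eventually_elim (use ab in auto)
  have "(\<lambda>x. if x \<in> {a..b} then f' x else 0) \<in> borel_measurable lebesgue"
    by (rule borel_measurable_AE[OF _ ae']) (use i in auto)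
  from integrable_cong_AE_imp[OF i this ae']
  have "integrable lebesgue (\<lambda>x. if x \<in> {a..b} then f' x else 0)" .
  then show ?thesis by (subst (asm) Lebesgue_Measure.integrable_restrict_UNIV) auto
qed

lemma weak_deriv_cong_AE:
  assumes w: "weak_deriv h f g" and f: "AE x in Mh h. f x = f' x" and g: "AE x in Mh h. g x = g' x"
  shows "weak_deriv h f' g'"
  unfolding weak_deriv_def
proof (intro conjI allI impI)
  fix \<phi> assume t: "test_fun h \<phi>"
  have "(\<integral>x. vector_derivative \<phi> (at x) *\<^sub>R f x \<partial>Mh h) = (\<integral>x. vector_derivative \<phi> (at x) *\<^sub>R f' x \<partial>Mh h)"
    "(\<integral>x. \<phi> x *\<^sub>R g x \<partial>Mh h) = (\<integral>x. \<phi> x *\<^sub>R g' x \<partial>Mh h)"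
    by (rule integral_Mh_cong_AE, use f in \<open>eventually_elim, simp\<close>, rule integral_Mh_cong_AE, use g in \<open>eventually_elim, simp\<close>)
  then show "(\<integral>x. vector_derivative \<phi> (at x) *\<^sub>R f' x \<partial>Mh h) = - (\<integral>x. \<phi> x *\<^sub>R g' x \<partial>Mh h)"
    using weak_deriv_test[OF w t] by simp
next
  fix a b assume ab: "-h < a" "b < h"
  show "integrable (lebesgue_on {a..b}) f'" "integrable (lebesgue_on {a..b}) g'"
    using integrable_subinterval_cong_AE[OF f ab weak_deriv_locally_integrable(1)[OF w ab]]
      integrable_subinterval_cong_AE[OF g ab weak_deriv_locally_integrable(2)[OF w ab]] by auto
qed

text \<open>Integration starts at \<open>a - 1\<close>, to the left of the support, so the integral
  vanishes for x < a and is differentiable on the whole line.\<close>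

lemma antiderivative_exists:
  fixes \<psi> :: "real \<Rightarrow> real"
  assumes c: "continuous_on UNIV \<psi>" and z: "\<And>x. x < a \<Longrightarrow> \<psi> x = 0"
  shows "\<exists>\<Psi>. \<forall>x. (\<Psi> has_vector_derivative \<psi> x) (at x)"
proof (intro exI allI)
  let ?F = "\<lambda>x. integral {a - 1..x} \<psi>"
  fix x
  show "(?F has_vector_derivative \<psi> x) (at x)"
  proof (cases "x < a")
    case True
    show ?thesis
    proof (rule has_vector_derivative_transform_within_open[of "\<lambda>_. 0" _ _ "{..<a}"])
      fix y assume "y \<in> {..<a}"
      then have "integral {a - 1..y} \<psi> = integral {a - 1..y} (\<lambda>_. 0)"
        by (intro integral_cong z) auto
      then show "0 = integral {a - 1..y} \<psi>" by simp
    qed (use True z in auto)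
  next
    case False
    have "(?F has_vector_derivative \<psi> x) (at x within {a - 1..x + 1})"
      by (rule integral_has_vector_derivative) (use False c in \<open>auto intro: continuous_on_subset\<close>)
    moreover have "at x within {a - 1..x + 1} = at x"
      by (rule at_within_interior) (use False in auto)
    ultimately show ?thesis by simp
  qed
qed

text \<open>The lemma of du Bois-Reymond. Subtracting the indefinite integral of \<open>g\<close>
  leaves a function \<open>d\<close> with zero weak derivative, which must be shown constant. A test
  function is the derivative of a test function exactly when its integral is 0, so an arbitrary
  \<psi> is first corrected by a multiple of one fixed bump \<psi>0.\<close>

lemma weak_deriv_imp_primitive:
  assumes w: "weak_deriv h f g" and gi: "integrable (Mh h) g" and h: "0 < h"
  shows "\<exists>F. primitive h F g \<and> (AE x in Mh h. f x = F x)"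
proof -
  define G where "G x = 0 + (\<integral>t. indicator {..x} t *\<^sub>R g t \<partial>Mh h)" for x
  have PG: "primitive h G g" unfolding G_def by (rule primitive_indefinite[OF gi])
  have wG: "weak_deriv h G g" by (rule weak_deriv_of_primitive[OF PG h])
  define d where "d x = f x - G x" for x
  have dloc: "integrable (lebesgue_on {a..b}) d" if "-h < a" "b < h" for a b
    unfolding d_def using weak_deriv_locally_integrable[OF w that] weak_deriv_locally_integrable[OF wG that] by auto
  have d0: "(\<integral>x. vector_derivative \<phi> (at x) *\<^sub>R d x \<partial>Mh h) = 0" if t: "test_fun h \<phi>" for \<phi>
  proof -
    have "(\<integral>x. vector_derivative \<phi> (at x) *\<^sub>R d x \<partial>Mh h) = 
      (\<integral>x. vector_derivative \<phi> (at x) *\<^sub>R f x \<partial>Mh h) - (\<integral>x. vector_derivative \<phi> (at x) *\<^sub>R G x \<partial>Mh h)"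
      unfolding d_def scaleR_diff_right
      by (rule Bochner_Integration.integral_diff[OF test_fun_integrable(2)[OF t weak_deriv_locally_integrable(1)[OF w]]
            test_fun_integrable(2)[OF t weak_deriv_locally_integrable(1)[OF wG]]])
    then show ?thesis using weak_deriv_test[OF w t] weak_deriv_test[OF wG t] by simp
  qed
  define \<psi>0 where "\<psi>0 = interval_bump (-h/2) (h/2) 1"
  have t0: "test_fun h \<psi>0" unfolding \<psi>0_def by (rule test_fun_interval_bump) (use h in auto)
  have test_prim: "\<exists>\<Psi>. \<forall>x. (\<Psi> has_vector_derivative \<psi> x) (at x)" if "test_fun h \<psi>" for \<psi>
    by (rule antiderivative_exists[of _ "-h"])
      (use that test_fun_derivative(3)[OF that] in \<open>auto simp: test_fun_def\<close>)
  obtain \<Psi>0 where P0: "\<And>x. (\<Psi>0 has_vector_derivative \<psi>0 x) (at x)" using test_prim[OF t0] by auto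
  have P0': "(\<Psi>0 has_field_derivative \<psi>0 x) (at x)" for x
    using P0 by (simp add: has_real_derivative_iff_has_vector_derivative)
  have "\<Psi>0 (-h) \<le> \<Psi>0 (-h/4)" "\<Psi>0 (h/4) \<le> \<Psi>0 h"
    by (rule DERIV_nonneg_imp_nondecreasing, use h in simp, use P0' interval_bump_bounds(1) in \<open>unfold \<psi>0_def, blast\<close>)+
  moreover have "\<Psi>0 (-h/4) < \<Psi>0 (h/4)"
  proof -
    have pos: "\<psi>0 x > 0" if x: "-h/4 \<le> x" "x \<le> h/4" for x
    proof -
      have "(x + h/2) * (h/2 - x) > 0" using x h by (intro mult_pos_pos) auto
      then show ?thesis by (auto simp: \<psi>0_def interval_bump_def Let_def intro!: divide_pos_pos add_pos_nonneg)
    qed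
    show ?thesis by (rule DERIV_pos_imp_increasing[where f = \<Psi>0]) (use h in simp, use pos P0' in blast)
  qed
  ultimately have I0: "\<Psi>0 h - \<Psi>0 (-h) > 0" by simp
  define q where "q = \<Psi>0 h - \<Psi>0 (-h)"
  have q: "q > 0" using I0 by (simp add: q_def)
  \<comment> \<open>The only possible constant: the mean of \<open>d\<close> with weight \<psi>0,
    where \<open>q\<close> is the integral of \<psi>0.\<close>
  define c where "c = (1/q) *\<^sub>R (\<integral>x. \<psi>0 x *\<^sub>R d x \<partial>Mh h)"
  have "AE x in Mh h. d x - c = 0"
  proof (rule AE_zero_of_test_integrals)
    show "integrable (lebesgue_on {a..b}) (\<lambda>x. d x - c)" if "-h < a" "b < h" for a b
      using dloc[OF that] by (auto intro!: integrable_const_ivl)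
    fix \<psi> assume t: "test_fun h \<psi>"
    obtain \<Psi> where P: "\<And>x. (\<Psi> has_vector_derivative \<psi> x) (at x)" using test_prim[OF t] by auto
    \<comment> \<open>With this \<open>J\<close> the function \<psi> - J \<psi>0 has integral 0. Its
      antiderivative \<phi> then vanishes at both ends and is constant beyond the supports, hence is
      itself a test function.\<close>
    define J where "J = (\<Psi> h - \<Psi> (-h)) / q"
    define \<phi> where "\<phi> x = (\<Psi> x - \<Psi> (-h)) - J * (\<Psi>0 x - \<Psi>0 (-h))" for x
    have \<phi>d: "(\<phi> has_vector_derivative (\<psi> x - J * \<psi>0 x)) (at x)" for x
      unfolding \<phi>_def using P P0 by (auto intro!: derivative_eq_intros)
    obtain a b where ab: "-h < a" "b < h" "\<And>x. x \<notin> {a..b} \<Longrightarrow> \<psi> x = 0"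
      using t by (auto simp: test_fun_def)
    obtain a' b' where ab': "-h < a'" "b' < h" "\<And>x. x \<notin> {a'..b'} \<Longrightarrow> \<psi>0 x = 0"
      using t0 by (auto simp: test_fun_def)
    let ?a = "min a a'" and ?b = "max b b'"
    have z: "\<psi> x - J * \<psi>0 x = 0" if "x < ?a \<or> x > ?b" for x
      using ab(3)[of x] ab'(3)[of x] that by auto
    have cl: "\<phi> x = \<phi> (-h)" if "x < ?a" for x
    proof -
      have "(\<phi> has_vector_derivative 0) (at y within {..<?a})" if "y \<in> {..<?a}" for y
        using has_vector_derivative_at_within[OF \<phi>d[of y]] z[of y] that by auto
      then obtain c where "\<And>x. x \<in> {..<?a} \<Longrightarrow> \<phi> x = c"
        by (rule has_vector_derivative_zero_constant[rotated]) auto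
      moreover have "x \<in> {..<?a}" "-h \<in> {..<?a}" using that ab(1) ab'(1) by auto
      ultimately show ?thesis by metis
    qed
    have cr: "\<phi> x = \<phi> h" if "x > ?b" for x
    proof -
      have "(\<phi> has_vector_derivative 0) (at y within {?b<..})" if "y \<in> {?b<..}" for y
        using has_vector_derivative_at_within[OF \<phi>d[of y]] z[of y] that by auto
      then obtain c where "\<And>x. x \<in> {?b<..} \<Longrightarrow> \<phi> x = c"
        by (rule has_vector_derivative_zero_constant[rotated]) auto
      moreover have "x \<in> {?b<..}" "h \<in> {?b<..}" using that ab(2) ab'(2) by auto
      ultimately show ?thesis by metis
    qed
    have ends: "\<phi> (-h) = 0" "\<phi> h = 0" using q by (auto simp: \<phi>_def J_def q_def)
    have tphi: "test_fun h \<phi>" unfolding test_fun_def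
    proof (intro conjI exI allI impI)
      show "\<phi> C1_differentiable_on UNIV" unfolding C1_differentiable_on_def
      proof (intro exI conjI ballI)
        show "(\<phi> has_vector_derivative (\<psi> x - J * \<psi>0 x)) (at x)" for x by (rule \<phi>d)
        show "continuous_on UNIV (\<lambda>x. \<psi> x - J * \<psi>0 x)"
          by (intro continuous_intros test_fun_derivative(3)[OF t] test_fun_derivative(3)[OF t0])
      qed
      show "-h < ?a" "?b < h" using ab ab' by auto
      fix x assume "x \<notin> {?a..?b}"
      then have "x < ?a \<or> x > ?b" by auto
      then show "\<phi> x = 0" using cl[of x] cr[of x] ends by metis
    qed
    have "vector_derivative \<phi> (at x) = \<psi> x - J * \<psi>0 x" for x by (rule vector_derivative_at[OF \<phi>d])
    then have "(\<integral>x. (\<psi> x - J * \<psi>0 x) *\<^sub>R d x \<partial>Mh h) = 0" using d0[OF tphi] by simp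
    moreover have i1: "integrable (Mh h) (\<lambda>x. \<psi> x *\<^sub>R d x)" and i2: "integrable (Mh h) (\<lambda>x. \<psi>0 x *\<^sub>R d x)"
      by (auto intro!: test_fun_integrable(1) t t0 dloc)
    moreover have "(\<integral>x. (\<psi> x - J * \<psi>0 x) *\<^sub>R d x \<partial>Mh h) = (\<integral>x. \<psi> x *\<^sub>R d x \<partial>Mh h) - J *\<^sub>R (\<integral>x. \<psi>0 x *\<^sub>R d x \<partial>Mh h)"
    proof -
      have "(\<integral>x. (\<psi> x - J * \<psi>0 x) *\<^sub>R d x \<partial>Mh h) = (\<integral>x. \<psi> x *\<^sub>R d x - J *\<^sub>R (\<psi>0 x *\<^sub>R d x) \<partial>Mh h)"
        by (simp add: scaleR_diff_left)
      also have "\<dots> = (\<integral>x. \<psi> x *\<^sub>R d x \<partial>Mh h) - (\<integral>x. J *\<^sub>R (\<psi>0 x *\<^sub>R d x) \<partial>Mh h)"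
        by (rule Bochner_Integration.integral_diff[OF i1 integrable_scaleR_right[OF i2]])
      also have "(\<integral>x. J *\<^sub>R (\<psi>0 x *\<^sub>R d x) \<partial>Mh h) = J *\<^sub>R (\<integral>x. \<psi>0 x *\<^sub>R d x \<partial>Mh h)"
        by (rule integral_scaleR_right)
      finally show ?thesis .
    qed
    ultimately have e1: "(\<integral>x. \<psi> x *\<^sub>R d x \<partial>Mh h) = (J * q) *\<^sub>R c" using q by (simp add: c_def)
    have "primitive h \<Psi> \<psi>"
      by (rule primitive_of_derivative) (auto intro: P has_vector_derivative_at_within test_fun_derivative(3)[OF t])
    from primitive_total[OF this h] have e2: "(\<integral>x. \<psi> x \<partial>Mh h) = J * q" using q by (simp add: J_def)
    have i3: "integrable (Mh h) \<psi>" by (rule integrable_Mh_continuous[OF test_fun_derivative(3)[OF t]])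
    have "(\<integral>x. \<psi> x *\<^sub>R (d x - c) \<partial>Mh h) = (\<integral>x. \<psi> x *\<^sub>R d x \<partial>Mh h) - (\<integral>x. \<psi> x *\<^sub>R c \<partial>Mh h)"
      unfolding scaleR_diff_right using i1 i3 by (intro Bochner_Integration.integral_diff) auto
    also have "(\<integral>x. \<psi> x *\<^sub>R c \<partial>Mh h) = (J * q) *\<^sub>R c" using e2 i3 by simp
    finally show "(\<integral>x. \<psi> x *\<^sub>R (d x - c) \<partial>Mh h) = 0" using e1 by simp
  qed
  then have "AE x in Mh h. f x = G x + c" by eventually_elim (auto simp: d_def algebra_simps)
  moreover have "primitive h (\<lambda>x. G x + c) g" using primitive_add[OF PG primitive_const[of h c]] by simp
  ultimately show ?thesis by blast
qed

text \<open>The part of the open interval where two continuous functions differ is open and null,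
  hence empty; the endpoints follow by closure. Traces are well defined for this reason.\<close>

lemma continuous_AE_eq_imp_eq:
  fixes f g :: "real \<Rightarrow> 'b::real_normed_vector"
  assumes f: "continuous_on {-h..h} f" and g: "continuous_on {-h..h} g"
    and ae: "AE x in Mh h. f x = g x" and h: "0 < h" and x: "x \<in> {-h..h}"
  shows "f x = g x"
proof -
  have i: "f y = g y" if y: "y \<in> {-h<..<h}" for y
  proof (rule ccontr)
    assume ne: "f y \<noteq> g y"
    have "continuous_on {-h<..<h} (\<lambda>x. norm (f x - g x))"
      by (intro continuous_intros continuous_on_subset[OF f] continuous_on_subset[OF g]) auto
    then have "open ((\<lambda>x. norm (f x - g x)) -` {0<..} \<inter> {-h<..<h})"
      using continuous_on_open_vimage[of "{-h<..<h}" "\<lambda>x. norm (f x - g x)"] by simp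
    moreover have "(\<lambda>x. norm (f x - g x)) -` {0<..} \<inter> {-h<..<h} = {x\<in>{-h<..<h}. norm (f x - g x) > 0}" by auto
    ultimately have op: "open {x\<in>{-h<..<h}. norm (f x - g x) > 0}" by metis
    have "y \<in> - {x\<in>{-h<..<h}. norm (f x - g x) > 0}"
      by (rule mem_closed_if_AE_lebesgue) (use op ae[unfolded AE_Mh_iff] in \<open>auto elim: eventually_mono\<close>)
    then show False using y ne by simp
  qed
  have "(\<lambda>x. f x - g x) ` closure {-h<..<h} \<subseteq> {0}"
    by (rule image_closure_subset) (use i h f g in \<open>auto intro!: continuous_intros\<close>)
  moreover have "x \<in> closure {-h<..<h}" using x h by simp
  ultimately show ?thesis by fastforce
qed

section \<open>Linear systems and the energy estimate\<close>

text \<open>Picard iteration as a series of corrections: \<open>y 0\<close> is the forced term and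
  each further term integrates \<open>N\<close> applied to the previous one. For an interval of any
  length the terms are measured against the weight exp (2 K (x + h)), for which every integration
  halves the bound.\<close>

lemma linear_ivp_exists:
  fixes N :: "'a::euclidean_space \<Rightarrow> 'a"
  assumes N: "bounded_linear N" and f: "integrable (Mh h) f" and h: "0 < h"
  shows "\<exists>y. y (-h) = c \<and> primitive h y (\<lambda>x. N (y x) + f x)"
proof -
  interpret N: bounded_linear N by fact
  obtain K where K: "0 < K" "\<And>x. norm (N x) \<le> K * norm x"
    using N.pos_bounded by (auto simp: mult.commute)
  define I where "I g x = (\<integral>t. indicator {..x} t *\<^sub>R g t \<partial>Mh h)" for g :: "real \<Rightarrow> 'a" and x
  define \<Phi> where "\<Phi> x = c + I f x" for x
  define y where "y = rec_nat \<Phi> (\<lambda>n z. I (\<lambda>t. N (z t)))"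
  have y0: "y 0 = \<Phi>" and yS: "y (Suc n) = I (\<lambda>t. N (y n t))" for n by (auto simp: y_def)
  have yc: "continuous_on {-h..h} (y n)" for n
  proof (induction n)
    case 0
    show ?case unfolding y0 \<Phi>_def I_def by (intro continuous_intros continuous_indefinite_integral f)
  next
    case (Suc n)
    have "integrable (Mh h) (\<lambda>t. N (y n t))"
      by (rule integrable_Mh_continuous, rule continuous_on_compose2[OF _ Suc, of UNIV])
        (auto intro: N.continuous_on continuous_intros)
    then show ?case unfolding yS I_def by (rule continuous_indefinite_integral)
  qed
  have Nc: "continuous_on {-h..h} (\<lambda>t. N (y n t))" for n
    by (intro N.continuous_on yc)
  obtain B where B: "\<And>x. x \<in> {-h..h} \<Longrightarrow> norm (y 0 x) \<le> B"
    using compact_imp_bounded[OF compact_continuous_image[OF yc compact_Icc]] unfolding bounded_iff by blast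
  have B0: "0 \<le> B" using order_trans[OF norm_ge_zero B[of h]] h by auto
  define ex where "ex x = exp (2 * K * (x + h))" for x
  have exP: "primitive h (\<lambda>x. ex x / (2 * K)) ex"
    by (rule primitive_of_derivative)
      (use K in \<open>auto simp: ex_def has_real_derivative_iff_has_vector_derivative[symmetric] intro!: derivative_eq_intros continuous_intros\<close>)
  have bd: "\<forall>x\<in>{-h..h}. norm (y n x) \<le> B * ex x * (1/2)^n" for n
  proof (induction n)
    case 0
    show ?case
    proof
      fix x assume x: "x \<in> {-h..h}"
      have "1 \<le> ex x" using x K by (simp add: ex_def)
      then have "B \<le> B * ex x" using B0 by (metis mult_left_mono mult.right_neutral)
      then show "norm (y 0 x) \<le> B * ex x * (1/2)^0" using B[OF x] by simp
    qed
  next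
    case (Suc n)
    show ?case
    proof
      fix x assume x: "x \<in> {-h..h}"
      have i1: "integrable (Mh h) (\<lambda>t. indicator {..x} t *\<^sub>R N (y n t))"
        by (rule integrable_indicator_Mh[OF integrable_Mh_continuous[OF Nc]]) simp
      have i2: "integrable (Mh h) (\<lambda>t. indicator {..x} t *\<^sub>R ex t)"
        by (rule integrable_indicator_Mh[OF primitive_integrable[OF exP]]) simp
      have "norm (y (Suc n) x) \<le> (\<integral>t. (K * B * (1/2)^n) * (indicator {..x} t *\<^sub>R ex t) \<partial>Mh h)"
        unfolding yS I_def
      proof (rule Bochner_Integration.integral_norm_bound_integral[OF i1])
        show "integrable (Mh h) (\<lambda>t. K * B * (1 / 2) ^ n * (indicator {..x} t *\<^sub>R ex t))" using i2 by (rule integrable_mult_right)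
        fix t assume t: "t \<in> space (Mh h)"
        then have "norm (y n t) \<le> B * ex t * (1/2)^n" using Suc by auto
        then have "norm (N (y n t)) \<le> K * (B * ex t * (1/2)^n)"
          by (rule order_trans[OF K(2) mult_left_mono]) (use K(1) in simp)
        then show "norm (indicator {..x} t *\<^sub>R N (y n t)) \<le> K * B * (1 / 2) ^ n * (indicator {..x} t *\<^sub>R ex t)"
          by (auto simp: indicator_def algebra_simps)
      qed
      also have "\<dots> = (K * B * (1/2)^n) * (\<integral>t. indicator {..x} t *\<^sub>R ex t \<partial>Mh h)"
        by (rule integral_mult_right_zero)
      also have "(\<integral>t. indicator {..x} t *\<^sub>R ex t \<partial>Mh h) = ex x / (2*K) - ex (-h) / (2*K)"
        using primitive_at[OF exP x] by simp
      also have "(K * B * (1/2)^n) * (ex x / (2*K) - ex (-h) / (2*K)) \<le> (K * B * (1/2)^n) * (ex x / (2*K))"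
        using K B0 by (intro mult_left_mono) (auto simp: ex_def)
      also have "\<dots> = B * ex x * (1/2)^Suc n" using K by (simp add: field_simps)
      finally show "norm (y (Suc n) x) \<le> B * ex x * (1/2)^Suc n" .
    qed
  qed
  define b where "b n = B * ex h * (1/2)^n" for n :: nat
  have bd2: "norm (y n x) \<le> b n" if x: "x \<in> {-h..h}" for n x
  proof -
    have "ex x \<le> ex h" using x K by (simp add: ex_def)
    then have "B * ex x * (1/2)^n \<le> b n" unfolding b_def using B0 by (intro mult_right_mono mult_left_mono) auto
    then show ?thesis using bd[of n] x by fastforce
  qed
  have bs: "summable b" unfolding b_def by (intro summable_mult summable_geometric) simp
  have sy: "summable (\<lambda>n. y n x)" if "x \<in> {-h..h}" for x
    by (rule summable_comparison_test'[OF bs]) (use bd2[OF that] in auto)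
  define Y where "Y x = (\<Sum>n. y n x)" for x
  define P where "P n x = (\<Sum>i<n. y i x)" for n x
  have PY: "(\<lambda>n. P n x) \<longlonglongrightarrow> Y x" if "x \<in> {-h..h}" for x
    unfolding P_def Y_def by (rule summable_LIMSEQ[OF sy[OF that]])
  have Pb: "norm (P n x) \<le> suminf b" if x: "x \<in> {-h..h}" for n x
  proof -
    have "norm (P n x) \<le> (\<Sum>i<n. b i)" unfolding P_def by (rule sum_norm_le) (use bd2[OF x] in auto)
    also have "\<dots> \<le> suminf b" by (rule sum_le_suminf[OF bs]) (use B0 in \<open>auto simp: b_def ex_def\<close>)
    finally show ?thesis .
  qed
  have Pc: "continuous_on {-h..h} (P n)" for n unfolding P_def by (intro continuous_intros yc)
  have PS: "P (Suc n) x = \<Phi> x + I (\<lambda>t. N (P n t)) x" for n x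
  proof -
    have "I (\<lambda>t. N (P n t)) x = (\<Sum>i<n. I (\<lambda>t. N (y i t)) x)"
      unfolding I_def P_def N.sum scaleR_sum_right
      by (rule Bochner_Integration.integral_sum, rule integrable_indicator_Mh[OF integrable_Mh_continuous[OF Nc]]) simp
    then show ?thesis unfolding P_def by (simp add: sum.lessThan_Suc_shift y0 yS del: sum.lessThan_Suc)
  qed
  have fin: "integrable (Mh h) (\<lambda>x. K * suminf b)"
    using finite_measure.integrable_const[OF finite_measure_Mh] .
  have NYm: "(\<lambda>t. N (Y t)) \<in> borel_measurable (Mh h)"
  proof (rule borel_measurable_LIMSEQ_metric[where f = "\<lambda>n t. N (P n t)"])
    show "(\<lambda>t. N (P n t)) \<in> borel_measurable (Mh h)" for n
      by (intro borel_measurable_Mh_continuous N.continuous_on Pc)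
    show "(\<lambda>n. N (P n x)) \<longlonglongrightarrow> N (Y x)" if "x \<in> space (Mh h)" for x
      by (rule N.tendsto, rule PY) (use that in auto)
  qed
  have Nb: "norm (N (P n t)) \<le> K * suminf b" if "t \<in> {-h..h}" for n t
    by (rule order_trans[OF K(2) mult_left_mono[OF Pb[OF that]]]) (use K(1) in simp)
  have NYb: "norm (N (Y t)) \<le> K * suminf b" if "t \<in> {-h..h}" for t
    by (rule LIMSEQ_le_const2[OF tendsto_norm[OF N.tendsto[OF PY[OF that]]]]) (use Nb[OF that] in auto)
  have NYi: "integrable (Mh h) (\<lambda>t. N (Y t))"
    by (rule Bochner_Integration.integrable_bound[OF fin NYm]) (auto intro!: AE_I2 order_trans[OF NYb])
  have lim: "(\<lambda>n. I (\<lambda>t. N (P n t)) x) \<longlonglongrightarrow> I (\<lambda>t. N (Y t)) x" for x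
    unfolding I_def
  proof (rule integral_dominated_convergence[where w = "\<lambda>_. K * suminf b"])
    show "AE t in Mh h. (\<lambda>i. indicator {..x} t *\<^sub>R N (P i t)) \<longlonglongrightarrow> indicator {..x} t *\<^sub>R N (Y t)"
      by (intro AE_I2 tendsto_intros N.tendsto PY) auto
    show "(\<lambda>t. indicator {..x} t *\<^sub>R N (Y t)) \<in> borel_measurable (Mh h)"
      using NYi by (intro borel_measurable_integrable integrable_indicator_Mh) auto
    show "(\<lambda>t. indicator {..x} t *\<^sub>R N (P n t)) \<in> borel_measurable (Mh h)" for n
      by (intro borel_measurable_integrable integrable_indicator_Mh integrable_Mh_continuous N.continuous_on Pc) auto
    show "AE t in Mh h. norm (indicator {..x} t *\<^sub>R N (P n t)) \<le> K * suminf b" for n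
    proof (rule AE_I2)
      fix t assume "t \<in> space (Mh h)"
      then have "norm (N (P n t)) \<le> K * suminf b" using Nb[of t n] by auto
      then show "norm (indicator {..x} t *\<^sub>R N (P n t)) \<le> K * suminf b"
        using order_trans[OF norm_ge_zero[of "N (P n t)"]] by (simp add: indicator_def)
    qed
  qed (rule fin)
  \<comment> \<open>The recursion for partial sums passes to the limit by dominated convergence, a
    constant bound being provided by the summable majorant \<open>b\<close>.\<close>
  have Yeq: "Y x = \<Phi> x + I (\<lambda>t. N (Y t)) x" if "x \<in> {-h..h}" for x
  proof (rule LIMSEQ_unique)
    show "(\<lambda>n. P (Suc n) x) \<longlonglongrightarrow> Y x" using PY[OF that] by (rule LIMSEQ_Suc)
    show "(\<lambda>n. P (Suc n) x) \<longlonglongrightarrow> \<Phi> x + I (\<lambda>t. N (Y t)) x" unfolding PS by (intro tendsto_intros lim)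
  qed
  have "primitive h (\<lambda>x. (c + I f x) + (0 + I (\<lambda>t. N (Y t)) x)) (\<lambda>x. f x + N (Y x))"
    unfolding I_def by (intro primitive_add primitive_indefinite f NYi)
  then have "primitive h Y (\<lambda>x. f x + N (Y x))"
    by (rule primitive_cong[OF _ h]) (use Yeq in \<open>auto simp: \<Phi>_def\<close>)
  then have "primitive h Y (\<lambda>x. N (Y x) + f x)" by (simp add: add.commute)
  moreover have "Y (-h) = c"
  proof -
    have z: "I g (-h) = 0" for g
    proof -
      have "I g (-h) = (\<integral>t. 0 \<partial>Mh h)" unfolding I_def
        by (rule Bochner_Integration.integral_cong) (auto simp: indicator_def)
      then show ?thesis by simp
    qed
    show ?thesis using Yeq[of "-h"] h by (simp add: \<Phi>_def z)
  qed
  ultimately show ?thesis by blast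
qed

text \<open>The membership condition of \<open>L2\<close> for an arbitrary codomain, so that it
  serves scalar coordinates and vector-valued functions alike.\<close>

definition sq_integrable :: "real \<Rightarrow> (real \<Rightarrow> 'a::{banach,second_countable_topology}) \<Rightarrow> bool" where
  "sq_integrable h f \<longleftrightarrow> f \<in> borel_measurable (Mh h) \<and> integrable (Mh h) (\<lambda>x. (norm (f x))\<^sup>2)"

lemma L2_iff_sq_integrable: "f \<in> L2 h \<longleftrightarrow> sq_integrable h f"
  by (simp add: L2_def sq_integrable_def)

lemma sq_integrable_bound:
  assumes "integrable (Mh h) g" "f \<in> borel_measurable (Mh h)" "\<And>x. (norm (f x))\<^sup>2 \<le> g x"
  shows "sq_integrable h f"
  unfolding sq_integrable_def
  by (intro conjI assms(2) Bochner_Integration.integrable_bound[OF assms(1)])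
    (use assms in \<open>auto intro!: AE_I2 order_trans[OF assms(3)]\<close>)

lemma norm_add_square_le: "(norm (a + b))\<^sup>2 \<le> 2 * (norm a)\<^sup>2 + 2 * (norm b)\<^sup>2"
proof -
  have "(norm (a + b))\<^sup>2 \<le> (norm a + norm b)\<^sup>2" by (simp add: norm_triangle_ineq power_mono)
  also have "\<dots> \<le> 2 * (norm a)\<^sup>2 + 2 * (norm b)\<^sup>2"
    using sum_squares_bound[of "norm a" "norm b"] by (simp add: power2_eq_square algebra_simps)
  finally show ?thesis .
qed

lemma sq_integrable_add: "sq_integrable h f \<Longrightarrow> sq_integrable h g \<Longrightarrow> sq_integrable h (\<lambda>x. f x + g x)"
  by (rule sq_integrable_bound[of h "\<lambda>x. 2 * (norm (f x))\<^sup>2 + 2 * (norm (g x))\<^sup>2"])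
    (auto simp: sq_integrable_def norm_add_square_le)

lemma sq_integrable_bounded_linear:
  assumes "sq_integrable h f" "bounded_linear T"
  shows "sq_integrable h (\<lambda>x. T (f x))"
proof -
  interpret T: bounded_linear T by fact
  obtain K where K: "\<And>x. norm (T x) \<le> norm x * K" using T.bounded by blast
  have "(norm (T x))\<^sup>2 \<le> K\<^sup>2 * (norm x)\<^sup>2" for x
    using power_mono[OF K[of x] norm_ge_zero, of 2] by (simp add: power_mult_distrib mult.commute)
  moreover have "(\<lambda>x. T (f x)) \<in> borel_measurable (Mh h)"
    by (rule measurable_compose[of f _ borel])
      (use assms in \<open>auto simp: sq_integrable_def intro!: borel_measurable_continuous_onI T.continuous_on continuous_on_id\<close>)
  ultimately show ?thesis
    by (intro sq_integrable_bound[of h "\<lambda>x. K\<^sup>2 * (norm (f x))\<^sup>2"])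
      (use assms in \<open>auto simp: sq_integrable_def\<close>)
qed

lemma sq_integrable_cmult: 
  fixes f :: "real \<Rightarrow> complex"
  shows "sq_integrable h f \<Longrightarrow> sq_integrable h (\<lambda>x. c * f x)"
  by (erule sq_integrable_bounded_linear) (rule bounded_linear_mult_right)

lemma sq_integrable_uminus: "sq_integrable h f \<Longrightarrow> sq_integrable h (\<lambda>x. - f x)"
  by (simp add: sq_integrable_def)

lemma sq_integrable_diff: "sq_integrable h f \<Longrightarrow> sq_integrable h g \<Longrightarrow> sq_integrable h (\<lambda>x. f x - g x)"
  using sq_integrable_add[OF _ sq_integrable_uminus] by fastforce

lemma sq_integrable_continuous:
  assumes "continuous_on {-h..h} f"
  shows "sq_integrable h f"
  unfolding sq_integrable_def
  by (intro conjI borel_measurable_Mh_continuous assms integrable_Mh_continuous continuous_intros)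

lemma sq_integrable_zero: "sq_integrable h (\<lambda>x. 0)"
  by (rule sq_integrable_continuous) simp

lemma sq_integrable_sum:
  "(\<And>i. i \<in> I \<Longrightarrow> sq_integrable h (f i)) \<Longrightarrow> sq_integrable h (\<lambda>x. \<Sum>i\<in>I. f i x)"
  by (induction I rule: infinite_finite_induct) (auto intro: sq_integrable_zero sq_integrable_add)

lemma sq_integrable_imp_integrable:
  assumes "sq_integrable h f"
  shows "integrable (Mh h) f"
proof (rule Bochner_Integration.integrable_bound)
  show "integrable (Mh h) (\<lambda>x. 1 + (norm (f x))\<^sup>2)"
    using assms finite_measure.integrable_const[OF finite_measure_Mh, of h "1::real"] by (auto simp: sq_integrable_def)
  show "AE x in Mh h. norm (f x) \<le> norm (1 + (norm (f x))\<^sup>2)"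
  proof (rule AE_I2)
    fix x
    have "2 * norm (f x) \<le> 1 + (norm (f x))\<^sup>2" using sum_squares_bound[of 1 "norm (f x)"] by (simp add: power2_eq_square)
    then show "norm (f x) \<le> norm (1 + (norm (f x))\<^sup>2)" using norm_ge_zero[of "f x"] by (simp del: norm_ge_zero)
  qed
qed (use assms in \<open>simp add: sq_integrable_def\<close>)

lemma sq_integrable_mult_cnj:
  fixes f g :: "real \<Rightarrow> complex"
  assumes "sq_integrable h f" "sq_integrable h g"
  shows "integrable (Mh h) (\<lambda>x. f x * cnj (g x))"
proof (rule Bochner_Integration.integrable_bound)
  show "integrable (Mh h) (\<lambda>x. (norm (f x))\<^sup>2 + (norm (g x))\<^sup>2)"
    using assms by (auto simp: sq_integrable_def)
  have f: "f \<in> borel_measurable (Mh h)" and g: "g \<in> borel_measurable (Mh h)" using assms by (auto simp: sq_integrable_def)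
  have "(\<lambda>x. cnj (g x)) \<in> borel_measurable (Mh h)"
    by (rule measurable_compose[OF g]) (intro borel_measurable_continuous_onI continuous_intros)
  then show "(\<lambda>x. f x * cnj (g x)) \<in> borel_measurable (Mh h)" by (rule borel_measurable_times[OF f])
  show "AE x in Mh h. norm (f x * cnj (g x)) \<le> norm ((norm (f x))\<^sup>2 + (norm (g x))\<^sup>2)"
  proof (rule AE_I2)
    fix x
    have "2 * norm (f x) * norm (g x) \<le> (norm (f x))\<^sup>2 + (norm (g x))\<^sup>2" by (rule sum_squares_bound)
    moreover have "0 \<le> norm (f x) * norm (g x)" by simp
    ultimately show "norm (f x * cnj (g x)) \<le> norm ((norm (f x))\<^sup>2 + (norm (g x))\<^sup>2)"
      unfolding norm_mult complex_mod_cnj real_norm_def by linarith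
  qed
qed

lemma primitive_inner_self:
  fixes f :: "real \<Rightarrow> 'a::euclidean_space"
  assumes "primitive h f g"
  shows "primitive h (\<lambda>x. (norm (f x))\<^sup>2) (\<lambda>x. 2 * (f x \<bullet> g x))"
  using primitive_bilinear[OF bounded_bilinear_inner assms assms]
  by (simp add: inner_commute power2_norm_eq_inner)

text \<open>One-dimensional Sobolev inequality. The derivative 2 f.g of |f|^2 is at most |f|^2 +
  |g|^2 in absolute value, so |f x|^2 exceeds |f t|^2 by at most the sum of the two integrals.
  Averaging over t in an interval of length 2 h adds the coefficient 1 / (2 h).\<close>

lemma primitive_sup_bound:
  fixes f :: "real \<Rightarrow> 'a::euclidean_space"
  assumes p: "primitive h f g" and g: "sq_integrable h g" and h: "0 < h" and x: "x \<in> {-h..h}"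
  shows "(norm (f x))\<^sup>2 \<le> (1 + 1 / (2*h)) * (\<integral>t. (norm (f t))\<^sup>2 \<partial>Mh h) + (\<integral>t. (norm (g t))\<^sup>2 \<partial>Mh h)"
proof -
  let ?J = "(\<integral>t. (norm (f t))\<^sup>2 \<partial>Mh h) + (\<integral>t. (norm (g t))\<^sup>2 \<partial>Mh h)"
  have fi: "integrable (Mh h) (\<lambda>t. (norm (f t))\<^sup>2)"
    by (intro integrable_Mh_continuous continuous_intros primitive_continuous[OF p])
  have gi: "integrable (Mh h) (\<lambda>t. (norm (g t))\<^sup>2)" using g by (simp add: sq_integrable_def)
  note P = primitive_inner_self[OF p]
  have d: "integrable (Mh h) (\<lambda>t. 2 * (f t \<bullet> g t))" by (rule primitive_integrable[OF P])
  have le: "\<bar>2 * (f t \<bullet> g t)\<bar> \<le> (norm (f t))\<^sup>2 + (norm (g t))\<^sup>2" for t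
    using Cauchy_Schwarz_ineq2[of "f t" "g t"] sum_squares_bound[of "norm (f t)" "norm (g t)"]
    by (simp add: abs_mult)
  have inc: "\<bar>(norm (f v))\<^sup>2 - (norm (f u))\<^sup>2\<bar> \<le> ?J" if "-h \<le> u" "u \<le> v" "v \<le> h" for u v
  proof -
    have "norm ((norm (f v))\<^sup>2 - (norm (f u))\<^sup>2) = norm (\<integral>t. indicator {u<..v} t *\<^sub>R (2 * (f t \<bullet> g t)) \<partial>Mh h)"
      using primitive_increment[OF P that] by simp
    also have "\<dots> \<le> (\<integral>t. (norm (f t))\<^sup>2 + (norm (g t))\<^sup>2 \<partial>Mh h)"
    proof (rule Bochner_Integration.integral_norm_bound_integral)
      show "integrable (Mh h) (\<lambda>t. indicator {u<..v} t *\<^sub>R (2 * (f t \<bullet> g t)))"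
        by (rule integrable_indicator_Mh[OF d]) simp
      show "integrable (Mh h) (\<lambda>t. (norm (f t))\<^sup>2 + (norm (g t))\<^sup>2)" using fi gi by simp
      show "norm (indicator {u<..v} t *\<^sub>R (2 * (f t \<bullet> g t))) \<le> (norm (f t))\<^sup>2 + (norm (g t))\<^sup>2" for t
        using le[of t] by (auto simp: indicator_def)
    qed
    also have "\<dots> = ?J" using fi gi by simp
    finally show ?thesis by simp
  qed
  have inc': "(norm (f x))\<^sup>2 \<le> (norm (f t))\<^sup>2 + ?J" if "t \<in> {-h..h}" for t
    using inc[of x t] inc[of t x] x that by (cases "x \<le> t") auto
  have cm: "measure (Mh h) (space (Mh h)) = 2 * h"
    using h by (simp add: measure_restrict_space)
  have "(\<integral>t. (norm (f x))\<^sup>2 \<partial>Mh h) \<le> (\<integral>t. (norm (f t))\<^sup>2 + ?J \<partial>Mh h)"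
    by (rule integral_mono) (use inc' fi in \<open>auto intro!: Bochner_Integration.integrable_add finite_measure.integrable_const[OF finite_measure_Mh]\<close>)
  also have "\<dots> = (\<integral>t. (norm (f t))\<^sup>2 \<partial>Mh h) + (\<integral>t. ?J \<partial>Mh h)"
    by (rule Bochner_Integration.integral_add[OF fi finite_measure.integrable_const[OF finite_measure_Mh]])
  finally have "2 * h * (norm (f x))\<^sup>2 \<le> (\<integral>t. (norm (f t))\<^sup>2 \<partial>Mh h) + 2 * h * ?J"
    using cm h by simp
  then show ?thesis using h by (simp add: field_simps)
qed

text \<open>Derivative of the energy |z|^2 + \<delta> |e|^2 along a growing Jordan block with loads
  \<open>p\<close> and \<open>q\<close>. The diagonal contributes 2 Re k. The coupling L k z, which
  has the order of the diagonal, costs Re k / 2: this uses |k| \<le> Re k / c and the smallness of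
  \<delta>. Young's inequality for the loads costs Re k / 4. More than Re k remains.\<close>

lemma block_derivative_lower:
  fixes z e p q k :: complex and L c \<delta> :: real
  assumes k: "0 < Re k" and c: "0 < c" "c * cmod k \<le> Re k" and \<delta>: "0 < \<delta>" "4 * \<delta> * L\<^sup>2 \<le> c\<^sup>2"
  shows "Re k * ((cmod z)\<^sup>2 + \<delta> * (cmod e)\<^sup>2) - 4 / Re k * ((cmod p)\<^sup>2 + \<delta> * (cmod q)\<^sup>2)
    \<le> 2 * (z \<bullet> (k * z + p)) + \<delta> * (2 * (e \<bullet> (k * e + L * k * z + q)))"
proof -
  let ?\<kappa> = "Re k"
  have diag: "w \<bullet> (k * w) = ?\<kappa> * (cmod w)\<^sup>2" for w
    unfolding cmod_power2 by (simp add: inner_complex_def power2_eq_square algebra_simps)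
  have young: "2 * (w \<bullet> v) \<ge> - (?\<kappa> / 4) * (cmod w)\<^sup>2 - 4 / ?\<kappa> * (cmod v)\<^sup>2" for w v :: complex
  proof -
    have "0 \<le> (?\<kappa> * cmod w / 2 - 2 * cmod v)\<^sup>2" by simp
    also have "\<dots> = ?\<kappa>\<^sup>2 * (cmod w)\<^sup>2 / 4 - 2 * ?\<kappa> * (cmod w * cmod v) + 4 * (cmod v)\<^sup>2"
      by (simp add: power2_eq_square algebra_simps)
    finally have "2 * ?\<kappa> * (cmod w * cmod v) \<le> ?\<kappa>\<^sup>2 * (cmod w)\<^sup>2 / 4 + 4 * (cmod v)\<^sup>2" by simp
    then have "2 * (cmod w * cmod v) \<le> ?\<kappa> / 4 * (cmod w)\<^sup>2 + 4 / ?\<kappa> * (cmod v)\<^sup>2"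
      using k by (simp add: field_simps power2_eq_square)
    moreover have "- (w \<bullet> v) \<le> cmod w * cmod v" using Cauchy_Schwarz_ineq2[of w v] by linarith
    ultimately show ?thesis by (simp add: algebra_simps)
  qed
  have cross: "\<delta> * (2 * (e \<bullet> (L * k * z))) \<ge> - (?\<kappa>/2) * ((cmod z)\<^sup>2 + \<delta> * (cmod e)\<^sup>2)"
  proof -
    have "\<bar>e \<bullet> (L * k * z)\<bar> \<le> cmod e * (\<bar>L\<bar> * cmod k * cmod z)"
      using Cauchy_Schwarz_ineq2[of e "L * k * z"] by (simp add: norm_mult)
    also have "\<dots> \<le> cmod e * (\<bar>L\<bar> * (?\<kappa> / c) * cmod z)"
      using c by (intro mult_left_mono mult_right_mono) (auto simp: field_simps)
    finally have 1: "- (e \<bullet> (L * k * z)) \<le> ?\<kappa> * (cmod e * (\<bar>L\<bar> / c) * cmod z)" by (simp add: algebra_simps)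
    have "0 \<le> (cmod e / 2 - \<bar>L\<bar> / c * cmod z)\<^sup>2" by simp
    also have "\<dots> = (cmod e)\<^sup>2 / 4 - cmod e * (\<bar>L\<bar> / c) * cmod z + L\<^sup>2 / c\<^sup>2 * (cmod z)\<^sup>2"
      by (simp add: power2_eq_square algebra_simps)
    finally have "cmod e * (\<bar>L\<bar> / c) * cmod z \<le> (cmod e)\<^sup>2 / 4 + L\<^sup>2 / c\<^sup>2 * (cmod z)\<^sup>2" by simp
    then have "\<delta> * (cmod e * (\<bar>L\<bar> / c) * cmod z) \<le> \<delta> * ((cmod e)\<^sup>2 / 4 + L\<^sup>2 / c\<^sup>2 * (cmod z)\<^sup>2)"
      using \<delta> by (intro mult_left_mono) auto
    also have "\<dots> = \<delta> * (cmod e)\<^sup>2 / 4 + (\<delta> * L\<^sup>2 / c\<^sup>2) * (cmod z)\<^sup>2" by (simp add: algebra_simps)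
    also have "\<dots> \<le> \<delta> * (cmod e)\<^sup>2 / 4 + (1/4) * (cmod z)\<^sup>2"
      using \<delta> c by (intro add_left_mono mult_right_mono) (auto simp: field_simps)
    also have "\<dots> = ((cmod z)\<^sup>2 + \<delta> * (cmod e)\<^sup>2) / 4" by simp
    finally have 2: "\<delta> * (cmod e * (\<bar>L\<bar> / c) * cmod z) \<le> ((cmod z)\<^sup>2 + \<delta> * (cmod e)\<^sup>2) / 4" .
    have "- (\<delta> * (e \<bullet> (L * k * z))) \<le> \<delta> * (?\<kappa> * (cmod e * (\<bar>L\<bar> / c) * cmod z))"
      using mult_left_mono[OF 1, of \<delta>] \<delta> by simp
    also have "\<dots> \<le> ?\<kappa> * (((cmod z)\<^sup>2 + \<delta> * (cmod e)\<^sup>2) / 4)"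
      using mult_left_mono[OF 2, of ?\<kappa>] k by (simp add: algebra_simps)
    finally show ?thesis by (simp add: algebra_simps)
  qed
  have q: "\<delta> * (2 * (e \<bullet> q)) \<ge> \<delta> * (- (?\<kappa> / 4) * (cmod e)\<^sup>2 - 4 / ?\<kappa> * (cmod q)\<^sup>2)"
    using young[of e q] \<delta> by (intro mult_left_mono) auto
  have nn: "0 \<le> ?\<kappa> * (cmod z)\<^sup>2" "0 \<le> ?\<kappa> * (\<delta> * (cmod e)\<^sup>2)" using k \<delta> by auto
  have e: "2 * (z \<bullet> (k * z + p)) + \<delta> * (2 * (e \<bullet> (k * e + L * k * z + q)))
     = 2 * ?\<kappa> * (cmod z)\<^sup>2 + 2 * (z \<bullet> p) + \<delta> * (2 * ?\<kappa> * (cmod e)\<^sup>2) + \<delta> * (2 * (e \<bullet> (L * k * z))) + \<delta> * (2 * (e \<bullet> q))"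
    unfolding inner_add_right diag by (simp add: algebra_simps)
  show ?thesis unfolding e using young[of z p] cross q nn by (simp add: algebra_simps)
qed

text \<open>Of the two energies, \<open>P\<close> grows and \<open>N\<close> decays at rate at least
  Re k, up to the loads, so \<alpha> P - \<gamma> N has a derivative bounded below by P + N.
  Constant weights would need both \<alpha> Cb \<le> \<gamma> and \<gamma> Cb \<le> \<alpha> to use
  the two boundary inequalities, impossible for Cb > 1. The slope (Cb - 1) / (2 h) of the weights is
  at most Re k / 2, so it consumes no more than half of the gain.\<close>

lemma coupled_block_estimate:
  fixes zp ep zm em p1 p2 p3 p4 :: "real \<Rightarrow> complex" and k :: complex and L c \<delta> Cb :: real
  assumes h: "0 < h" and c: "0 < c" "c * cmod k \<le> Re k" and \<delta>: "0 < \<delta>" "4 * \<delta> * L\<^sup>2 \<le> c\<^sup>2"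
    and Cb: "1 \<le> Cb" and k: "0 < Re k" "Cb - 1 \<le> h * Re k"
    and zp: "primitive h zp (\<lambda>x. k * zp x + p1 x)"
    and ep: "primitive h ep (\<lambda>x. k * ep x + L * k * zp x + p2 x)"
    and zm: "primitive h zm (\<lambda>x. - (k * zm x) + p3 x)"
    and em: "primitive h em (\<lambda>x. - (k * em x) + L * k * zm x + p4 x)"
    and p: "sq_integrable h p1" "sq_integrable h p2" "sq_integrable h p3" "sq_integrable h p4"
    and right: "(cmod (zp h))\<^sup>2 + \<delta> * (cmod (ep h))\<^sup>2 \<le> Cb * ((cmod (zm h))\<^sup>2 + \<delta> * (cmod (em h))\<^sup>2)"
    and left: "(cmod (zm (-h)))\<^sup>2 + \<delta> * (cmod (em (-h)))\<^sup>2 \<le> Cb * ((cmod (zp (-h)))\<^sup>2 + \<delta> * (cmod (ep (-h)))\<^sup>2)"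
  shows "(\<integral>x. (cmod (zp x))\<^sup>2 + \<delta> * (cmod (ep x))\<^sup>2 + ((cmod (zm x))\<^sup>2 + \<delta> * (cmod (em x))\<^sup>2) \<partial>Mh h)
     \<le> 8 * Cb / (Re k)\<^sup>2 * (\<integral>x. (cmod (p1 x))\<^sup>2 + \<delta> * (cmod (p2 x))\<^sup>2 + ((cmod (p3 x))\<^sup>2 + \<delta> * (cmod (p4 x))\<^sup>2) \<partial>Mh h)"
proof -
  let ?\<kappa> = "Re k"
  define P where "P x = (cmod (zp x))\<^sup>2 + \<delta> * (cmod (ep x))\<^sup>2" for x
  define N where "N x = (cmod (zm x))\<^sup>2 + \<delta> * (cmod (em x))\<^sup>2" for x
  define dP where "dP x = 2 * (zp x \<bullet> (k * zp x + p1 x)) + \<delta> * (2 * (ep x \<bullet> (k * ep x + L * k * zp x + p2 x)))" for x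
  define dN where "dN x = 2 * (zm x \<bullet> (- (k * zm x) + p3 x)) + \<delta> * (2 * (em x \<bullet> (- (k * em x) + L * k * zm x + p4 x)))" for x
  define Qp where "Qp x = (cmod (p1 x))\<^sup>2 + \<delta> * (cmod (p2 x))\<^sup>2" for x
  define Qm where "Qm x = (cmod (p3 x))\<^sup>2 + \<delta> * (cmod (p4 x))\<^sup>2" for x
  have PP: "primitive h P dP" unfolding P_def dP_def
    by (intro primitive_add primitive_cmult primitive_inner_self zp ep)
  have PN: "primitive h N dN" unfolding N_def dN_def
    by (intro primitive_add primitive_cmult primitive_inner_self zm em)
  have P0: "0 \<le> P x" "0 \<le> N x" "0 \<le> Qp x" "0 \<le> Qm x" for x using \<delta> by (auto simp: P_def N_def Qp_def Qm_def)
  have dPl: "?\<kappa> * P x - 4 / ?\<kappa> * Qp x \<le> dP x" for x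
    unfolding P_def Qp_def dP_def by (rule block_derivative_lower[OF k(1) c \<delta>])
  \<comment> \<open>Reversing the sign turns the decaying block into a growing one with coupling -L
    and opposite loads; only the square of L enters the smallness condition.\<close>
  have dNl: "?\<kappa> * N x - 4 / ?\<kappa> * Qm x \<le> - dN x" for x
  proof -
    have "?\<kappa> * N x - 4 / ?\<kappa> * Qm x \<le> 2 * (zm x \<bullet> (k * zm x + - p3 x)) + \<delta> * (2 * (em x \<bullet> (k * em x + (-L) * k * zm x + - p4 x)))"
      unfolding N_def Qm_def using block_derivative_lower[OF k(1) c \<delta>(1), of "-L" "zm x" "em x" "- p3 x" "- p4 x"] \<delta>(2) by simp
    also have "\<dots> = - dN x" unfolding dN_def by (simp add: inner_add_right inner_diff_right algebra_simps)
    finally show ?thesis .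
  qed
  \<comment> \<open>The weights interpolate between \<open>Cb\<close> and 1, so the boundary terms of \<open>\<alpha> P - \<gamma> N\<close> have the right sign at both ends.\<close>
  define t where "t = (Cb - 1) / (2 * h)"
  have t: "0 \<le> t" "t \<le> ?\<kappa> / 2" using Cb h k by (auto simp: t_def field_simps)
  define \<alpha> where "\<alpha> x = Cb - t * (x + h)" for x
  define \<gamma> where "\<gamma> x = 1 + t * (x + h)" for x
  have bd: "1 \<le> \<alpha> x" "\<alpha> x \<le> Cb" "1 \<le> \<gamma> x" "\<gamma> x \<le> Cb" if x: "x \<in> {-h..h}" for x
  proof -
    have "t * (x + h) \<le> t * (2 * h)" using x t by (intro mult_left_mono) auto
    also have "\<dots> = Cb - 1" using h by (simp add: t_def)
    finally have 1: "t * (x + h) \<le> Cb - 1" .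
    have 2: "0 \<le> t * (x + h)" using x t by auto
    show "1 \<le> \<alpha> x" "\<alpha> x \<le> Cb" "1 \<le> \<gamma> x" "\<gamma> x \<le> Cb" using 1 2 by (auto simp: \<alpha>_def \<gamma>_def)
  qed
  have P\<alpha>: "primitive h \<alpha> (\<lambda>_. - t)" unfolding \<alpha>_def
    by (rule primitive_of_derivative)
      (auto simp: has_real_derivative_iff_has_vector_derivative[symmetric] intro!: derivative_eq_intros)
  have P\<gamma>: "primitive h \<gamma> (\<lambda>_. t)" unfolding \<gamma>_def
    by (rule primitive_of_derivative)
      (auto simp: has_real_derivative_iff_has_vector_derivative[symmetric] intro!: derivative_eq_intros)
  define d where "d x = (- t * P x + \<alpha> x * dP x) - (t * N x + \<gamma> x * dN x)" for x
  have PT: "primitive h (\<lambda>x. \<alpha> x * P x - \<gamma> x * N x) d"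
    unfolding d_def by (intro primitive_diff primitive_bilinear[OF bounded_bilinear_mult] P\<alpha> P\<gamma> PP PN)
  have e: "\<alpha> h = 1" "\<gamma> h = Cb" "\<alpha> (-h) = Cb" "\<gamma> (-h) = 1" using h by (auto simp: \<alpha>_def \<gamma>_def t_def)
  have neg: "(\<integral>x. d x \<partial>Mh h) \<le> 0"
    using primitive_total[OF PT h] right left by (simp add: e P_def[symmetric] N_def[symmetric])
  have low: "?\<kappa> / 2 * (P x + N x) - 4 * Cb / ?\<kappa> * (Qp x + Qm x) \<le> d x" if x: "x \<in> {-h..h}" for x
  proof -
    have 1: "\<alpha> x * (?\<kappa> * P x - 4 / ?\<kappa> * Qp x) \<le> \<alpha> x * dP x"
      using dPl[of x] bd[OF x] by (intro mult_left_mono) auto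
    have 2: "\<gamma> x * (?\<kappa> * N x - 4 / ?\<kappa> * Qm x) \<le> \<gamma> x * (- dN x)"
      using dNl[of x] bd[OF x] by (intro mult_left_mono) auto
    have 3: "?\<kappa> * P x \<le> \<alpha> x * (?\<kappa> * P x)" "?\<kappa> * N x \<le> \<gamma> x * (?\<kappa> * N x)"
      using mult_right_mono[OF bd(1)[OF x], of "?\<kappa> * P x"] mult_right_mono[OF bd(3)[OF x], of "?\<kappa> * N x"] k P0 by auto
    have 4: "\<alpha> x * (4 / ?\<kappa> * Qp x) \<le> Cb * (4 / ?\<kappa> * Qp x)" "\<gamma> x * (4 / ?\<kappa> * Qm x) \<le> Cb * (4 / ?\<kappa> * Qm x)"
      by (rule mult_right_mono; use k(1) P0 bd[OF x] in simp)+
    have 5: "t * P x \<le> ?\<kappa> / 2 * P x" "t * N x \<le> ?\<kappa> / 2 * N x"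
      by (rule mult_right_mono[OF t(2) P0(1)], rule mult_right_mono[OF t(2) P0(2)])
    define i where "i = 4 / ?\<kappa>"
    have i: "4 * Cb / ?\<kappa> = Cb * i" by (simp add: i_def)
    show ?thesis unfolding d_def i using 1 2 3 4 5 unfolding i_def[symmetric]
      by (simp add: algebra_simps add_divide_distrib)
  qed
  have Pi: "integrable (Mh h) P" "integrable (Mh h) N"
    by (auto intro!: integrable_Mh_continuous primitive_continuous[OF PP] primitive_continuous[OF PN])
  have Qi: "integrable (Mh h) Qp" "integrable (Mh h) Qm"
    using p unfolding Qp_def Qm_def sq_integrable_def by auto
  have "(\<integral>x. ?\<kappa> / 2 * (P x + N x) - 4 * Cb / ?\<kappa> * (Qp x + Qm x) \<partial>Mh h) \<le> (\<integral>x. d x \<partial>Mh h)"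
    by (rule integral_mono) (use Pi Qi low primitive_integrable[OF PT] in auto)
  also have "(\<integral>x. ?\<kappa> / 2 * (P x + N x) - 4 * Cb / ?\<kappa> * (Qp x + Qm x) \<partial>Mh h)
     = ?\<kappa> / 2 * (\<integral>x. P x + N x \<partial>Mh h) - 4 * Cb / ?\<kappa> * (\<integral>x. Qp x + Qm x \<partial>Mh h)"
  proof -
    have i: "integrable (Mh h) (\<lambda>x. P x + N x)" "integrable (Mh h) (\<lambda>x. Qp x + Qm x)" using Pi Qi by auto
    show ?thesis
      by (subst Bochner_Integration.integral_diff)
        (use i in \<open>auto simp only: integral_mult_right_zero intro!: integrable_mult_right\<close>)
  qed
  finally have "?\<kappa> / 2 * (\<integral>x. P x + N x \<partial>Mh h) \<le> 4 * Cb / ?\<kappa> * (\<integral>x. Qp x + Qm x \<partial>Mh h)" using neg by linarith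
  then have "(\<integral>x. P x + N x \<partial>Mh h) \<le> 8 * Cb / ?\<kappa>\<^sup>2 * (\<integral>x. Qp x + Qm x \<partial>Mh h)"
    using k by (simp add: field_simps power2_eq_square)
  then show ?thesis by (simp add: P_def N_def Qp_def Qm_def)
qed

section \<open>The first-order system\<close>

text \<open>The combination of the four right-hand sides that defines \<open>zeta\<close> reproduces
  \<open>t * k\<close> times itself plus loads. Reciprocals and the quotient r / k are variables
  here, so that the claim is polynomial modulo the listed relations and within reach of
  \<open>algebra\<close>.\<close>

lemma zeta_identity:
  fixes k s t l m a E ia im rk :: complex
  assumes "s * s = -1" "t * t = 1" "a = l + 2 * m" "a * ia = 1" "m * im = 1" "E = 4 * m * (l + m) * ia"
  shows "2 * m * (- (s * t * (k * (S1 - l * s * w2 - l * f2) * ia)) + k * (S2 * im - s * w1 - f1))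
      - s * (- (k * s * S2) - m * df2 - rk * w1 - m * g1)
      + t * (k * (- (s * (l * ia) * S1) + E * w2 - s * E * f2) - l * df1 - rk * w2 - a * g2)
    = t * (k * (2 * m * (- (s * t * w1) + w2) - s * S1 + t * S2))
      + (2 * m * s * t * l * k * ia * f2 - 2 * m * k * f1 + s * (m * df2 + rk * w1 + m * g1)
         - t * (k * s * E * f2 + l * df1 + rk * w2 + a * g2))"
  using assms by algebra

text \<open>The same computation for \<open>eta\<close>. The surplus (l + m) k times
  \<open>zeta\<close> is the nilpotent part of the Jordan block; its coefficient is the same for
  both signs of t.\<close>

lemma eta_identity:
  fixes k s t l m a E ia im rk :: complex
  assumes "s * s = -1" "t * t = 1" "a = l + 2 * m" "a * ia = 1" "m * im = 1" "E = 4 * m * (l + m) * ia"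
  shows "2 * m * s * (l + m) * (k * (S1 - l * s * w2 - l * f2) * ia)
      + s * t * a * (- (k * s * S2) - m * df2 - rk * w1 - m * g1)
      + m * (k * (- (s * (l * ia) * S1) + E * w2 - s * E * f2) - l * df1 - rk * w2 - a * g2)
    = t * (k * (2 * m * s * (l + m) * w1 + s * t * a * S1 + m * S2))
      + (l + m) * k * (2 * m * (- (s * t * w1) + w2) - s * S1 + t * S2)
      + (- (2 * m * s * (l + m) * k * l * ia * f2) - s * t * a * (m * df2 + rk * w1 + m * g1)
         - m * (k * s * E * f2 + l * df1 + rk * w2 + a * g2))"
  using assms by algebra


definition sq_energy :: "real \<Rightarrow> nat \<Rightarrow> (nat \<Rightarrow> real \<Rightarrow> complex) \<Rightarrow> real" where
  "sq_energy h n D = (\<integral>x. (\<Sum>j<n. (cmod (D j x))\<^sup>2) \<partial>Mh h)"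

lemma sq_energy_nonneg: "0 \<le> sq_energy h n D"
  unfolding sq_energy_def by (intro Bochner_Integration.integral_nonneg sum_nonneg) auto

lemma sum_lessThan_4: "(\<Sum>j<4. f j) = f 0 + f 1 + f 2 + f (3::nat)" for f :: "nat \<Rightarrow> 'a::comm_monoid_add"
  by (simp add: eval_nat_numeral ac_simps)

lemma sum_lessThan_6: "(\<Sum>j<6. f j) = f 0 + f 1 + f 2 + f 3 + f 4 + f (5::nat)" for f :: "nat \<Rightarrow> 'a::comm_monoid_add"
  by (simp add: eval_nat_numeral ac_simps)

lemma integrable_Pair_intro:
  fixes f :: "'c \<Rightarrow> 'a::{banach,second_countable_topology}" and g :: "'c \<Rightarrow> 'b::{banach,second_countable_topology}"
  assumes "integrable M f" "integrable M g"
  shows "integrable M (\<lambda>x. (f x, g x))"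
proof -
  have "integrable M (\<lambda>x. (f x, 0 :: 'b))" "integrable M (\<lambda>x. (0 :: 'a, g x))"
    by (rule integrable_bounded_linear[OF _ assms(1)] integrable_bounded_linear[OF _ assms(2)],
        intro bounded_linear_Pair bounded_linear_ident bounded_linear_zero)+
  from Bochner_Integration.integrable_add[OF this] show ?thesis by simp
qed

lemma sq_energy_zero_imp_zero:
  assumes c: "\<And>j. j < n \<Longrightarrow> continuous_on {-h..h} (Y j)" and z: "sq_energy h n Y = 0" and h: "0 < h"
    and j: "j < n" and x: "x \<in> {-h..h}"
  shows "Y j x = 0"
proof -
  have i: "integrable (Mh h) (\<lambda>x. (\<Sum>j<n. (cmod (Y j x))\<^sup>2))"
    using c by (intro integrable_Mh_continuous continuous_intros) auto
  have "AE x in Mh h. (\<Sum>j<n. (cmod (Y j x))\<^sup>2) = 0"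
    using z integral_nonneg_eq_0_iff_AE[OF i] unfolding sq_energy_def by (simp add: sum_nonneg)
  then have "AE x in Mh h. Y j x = 0"
  proof eventually_elim
    case (elim x)
    then have "\<forall>j\<in>{..<n}. (cmod (Y j x))\<^sup>2 = 0" by (subst (asm) sum_nonneg_eq_0_iff) auto
    then show ?case using j by auto
  qed
  then show ?thesis using continuous_AE_eq_imp_eq[OF c[OF j] continuous_on_const _ h x] by blast
qed

text \<open>The Lame constants are \<open>l\<close> and \<open>m\<close>, and \<open>r\<close> is
  the square of the frequency times the density. The bound 0 < l + m comes from 3 lam + 2 mu > 0 and
  mu > 0; it makes \<open>a\<close> and \<open>E\<close> positive and allows the displacement to be
  recovered from \<open>eta\<close>.\<close>

locale lame =
  fixes h l m r :: real
  assumes h: "0 < h" and m: "0 < m" and lm: "0 < l + m"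
begin

definition a :: real where "a = l + 2 * m"
text \<open>Equal to (a^2 - l^2) / a, the coefficient that arises when the first component of the
  derivative of U1 is eliminated in favour of the stress.\<close>

definition E :: real where "E = 4 * m * (l + m) / a"

lemma a: "0 < a" using m lm by (simp add: a_def)

lemma E: "0 < E" using m lm a by (simp add: E_def)

text \<open>
  The resolvent equation at \<open>z = s k\<close> with \<open>s\<^sup>2 = -1\<close>, as a first-order system for
  \<open>Y = (k U\<^sub>1, S)\<close>, where \<open>S = A \<partial>U\<^sub>1 + D U\<^sub>2\<close> is the boundary stress; the data are
  \<open>d = (F\<^sub>1, \<partial>F\<^sub>1, F\<^sub>2)\<close>, two components each.
\<close>
definition stress_system :: "complex \<Rightarrow> complex \<Rightarrow> (nat \<Rightarrow> real \<Rightarrow> complex) \<Rightarrow> (nat \<Rightarrow> real \<Rightarrow> complex) \<Rightarrow> bool" where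
  "stress_system k s d Y \<longleftrightarrow>
     primitive h (Y 0) (\<lambda>x. k * (Y 2 x - l * s * Y 1 x - l * d 1 x) / a) \<and>
     primitive h (Y 1) (\<lambda>x. k * (Y 3 x / m - s * Y 0 x - d 0 x)) \<and>
     primitive h (Y 2) (\<lambda>x. - (k * s * Y 3 x) - m * d 3 x - r / k * Y 0 x - m * d 4 x) \<and>
     primitive h (Y 3) (\<lambda>x. k * (- (s * (l / a) * Y 2 x) + E * Y 1 x - s * E * d 1 x) - l * d 2 x - r / k * Y 1 x - a * d 5 x)"
  for k s :: complex and d Y :: "nat \<Rightarrow> real \<Rightarrow> complex"

definition stress_free :: "(nat \<Rightarrow> real \<Rightarrow> complex) \<Rightarrow> bool" where
  "stress_free Y \<longleftrightarrow> (\<forall>x\<in>{-h,h}. Y 2 x = 0 \<and> Y 3 x = 0)"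
  for Y :: "nat \<Rightarrow> real \<Rightarrow> complex"

text \<open>For \<open>t = \<plusminus>1\<close>, \<open>zeta\<close> is a left eigenvector and \<open>eta\<close> a generalized left eigenvector of the
  principal part of the system, whose eigenvalues \<open>\<plusminus>k\<close> are both double.\<close>
definition zeta :: "complex \<Rightarrow> complex \<Rightarrow> (nat \<Rightarrow> real \<Rightarrow> complex) \<Rightarrow> real \<Rightarrow> complex" where
  "zeta s t Y x = 2 * m * (- (s * t * Y 0 x) + Y 1 x) - s * Y 2 x + t * Y 3 x"
  for s t :: complex and Y :: "nat \<Rightarrow> real \<Rightarrow> complex"

definition eta :: "complex \<Rightarrow> complex \<Rightarrow> (nat \<Rightarrow> real \<Rightarrow> complex) \<Rightarrow> real \<Rightarrow> complex" where
  "eta s t Y x = 2 * m * s * (l + m) * Y 0 x + s * t * a * Y 2 x + m * Y 3 x"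
  for s t :: complex and Y :: "nat \<Rightarrow> real \<Rightarrow> complex"

text \<open>Everything outside the principal part. The terms with r / k contain the unknown, but
  carry a negative power of k and are treated as part of the load until they are absorbed.\<close>

definition zeta_load :: "complex \<Rightarrow> complex \<Rightarrow> complex \<Rightarrow> (nat \<Rightarrow> real \<Rightarrow> complex) \<Rightarrow> (nat \<Rightarrow> real \<Rightarrow> complex) \<Rightarrow> real \<Rightarrow> complex" where
  "zeta_load k s t d Y x = 2 * m * s * t * l * k * (1 / a) * d 1 x - 2 * m * k * d 0 x
     + s * (m * d 3 x + r / k * Y 0 x + m * d 4 x)
     - t * (k * s * E * d 1 x + l * d 2 x + r / k * Y 1 x + a * d 5 x)"
  for k s t :: complex and d Y :: "nat \<Rightarrow> real \<Rightarrow> complex"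

definition eta_load :: "complex \<Rightarrow> complex \<Rightarrow> complex \<Rightarrow> (nat \<Rightarrow> real \<Rightarrow> complex) \<Rightarrow> (nat \<Rightarrow> real \<Rightarrow> complex) \<Rightarrow> real \<Rightarrow> complex" where
  "eta_load k s t d Y x = - (2 * m * s * (l + m) * k * l * (1 / a) * d 1 x)
     - s * t * a * (m * d 3 x + r / k * Y 0 x + m * d 4 x)
     - m * (k * s * E * d 1 x + l * d 2 x + r / k * Y 1 x + a * d 5 x)"
  for k s t :: complex and d Y :: "nat \<Rightarrow> real \<Rightarrow> complex"

lemma complex_constants:
  "complex_of_real a = complex_of_real l + 2 * complex_of_real m"
  "complex_of_real a * (1 / complex_of_real a) = 1" "complex_of_real m * (1 / complex_of_real m) = 1"
  "complex_of_real E = 4 * complex_of_real m * (complex_of_real l + complex_of_real m) * (1 / complex_of_real a)"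
proof -
  show "complex_of_real a = complex_of_real l + 2 * complex_of_real m" by (simp add: a_def)
  have "complex_of_real a \<noteq> 0" "complex_of_real m \<noteq> 0" using a m by auto
  then show "complex_of_real a * (1 / complex_of_real a) = 1" "complex_of_real m * (1 / complex_of_real m) = 1" by auto
qed (simp add: E_def)

lemma zeta_primitive:
  fixes k s t :: complex and d Y :: "nat \<Rightarrow> real \<Rightarrow> complex"
  assumes s: "s * s = -1" and t: "t * t = 1" and sys: "stress_system k s d Y"
  shows "primitive h (zeta s t Y) (\<lambda>x. t * (k * zeta s t Y x) + zeta_load k s t d Y x)"
proof -
  let ?d0 = "\<lambda>x. k * (Y 2 x - l * s * Y 1 x - l * d 1 x) / a"
  let ?d1 = "\<lambda>x. k * (Y 3 x / m - s * Y 0 x - d 0 x)"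
  let ?d2 = "\<lambda>x. - (k * s * Y 3 x) - m * d 3 x - r / k * Y 0 x - m * d 4 x"
  let ?d3 = "\<lambda>x. k * (- (s * (l / a) * Y 2 x) + E * Y 1 x - s * E * d 1 x) - l * d 2 x - r / k * Y 1 x - a * d 5 x"
  have "primitive h (zeta s t Y) (\<lambda>x. 2 * m * (- (s * t * ?d0 x) + ?d1 x) - s * ?d2 x + t * ?d3 x)"
    unfolding zeta_def[abs_def]
    by (intro primitive_add primitive_diff primitive_cmult primitive_uminus) 
      (use sys in \<open>simp_all only: stress_system_def\<close>)
  moreover have "2 * m * (- (s * t * ?d0 x) + ?d1 x) - s * ?d2 x + t * ?d3 x = t * (k * zeta s t Y x) + zeta_load k s t d Y x" for x
    using zeta_identity[OF s t complex_constants, of k "Y 2 x" "Y 1 x" "d 1 x" "Y 3 x" "Y 0 x" "d 0 x" "d 3 x" "r / k" "d 4 x" "d 2 x" "d 5 x"]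
    unfolding zeta_def zeta_load_def by simp
  ultimately show ?thesis by (simp only:)
qed

lemma eta_primitive:
  fixes k s t :: complex and d Y :: "nat \<Rightarrow> real \<Rightarrow> complex"
  assumes s: "s * s = -1" and t: "t * t = 1" and sys: "stress_system k s d Y"
  shows "primitive h (eta s t Y) (\<lambda>x. t * (k * eta s t Y x) + complex_of_real (l + m) * k * zeta s t Y x + eta_load k s t d Y x)"
proof -
  let ?d0 = "\<lambda>x. k * (Y 2 x - l * s * Y 1 x - l * d 1 x) / a"
  let ?d2 = "\<lambda>x. - (k * s * Y 3 x) - m * d 3 x - r / k * Y 0 x - m * d 4 x"
  let ?d3 = "\<lambda>x. k * (- (s * (l / a) * Y 2 x) + E * Y 1 x - s * E * d 1 x) - l * d 2 x - r / k * Y 1 x - a * d 5 x"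
  have "primitive h (eta s t Y) (\<lambda>x. 2 * m * s * (l + m) * ?d0 x + s * t * a * ?d2 x + m * ?d3 x)"
    unfolding eta_def[abs_def]
    by (intro primitive_add primitive_diff primitive_cmult primitive_uminus) 
      (use sys in \<open>simp_all only: stress_system_def\<close>)
  moreover have "2 * m * s * (l + m) * ?d0 x + s * t * a * ?d2 x + m * ?d3 x
      = t * (k * eta s t Y x) + complex_of_real (l + m) * k * zeta s t Y x + eta_load k s t d Y x" for x
    using eta_identity[OF s t complex_constants, of k "Y 2 x" "Y 1 x" "d 1 x" "Y 3 x" "d 3 x" "r / k" "Y 0 x" "d 4 x" "d 2 x" "d 5 x"]
    unfolding zeta_def eta_def eta_load_def by simp
  ultimately show ?thesis by (simp only:)
qed

text \<open>The change to eigen-coordinates does not involve k, and |s| = 1, so its inverse is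
  bounded by constants depending only on the material.\<close>

lemma recover_bound:
  "\<exists>C>0. \<forall>(s::complex) (Y :: nat \<Rightarrow> real \<Rightarrow> complex) x. s * s = -1 \<longrightarrow>
     (\<Sum>j<4. (cmod (Y j x))\<^sup>2) \<le> C * ((cmod (zeta s 1 Y x))\<^sup>2 + (cmod (eta s 1 Y x))\<^sup>2
        + ((cmod (zeta s (-1) Y x))\<^sup>2 + (cmod (eta s (-1) Y x))\<^sup>2))"
proof -
  define C2 where "C2 = 1 / (2 * a)"
  define C3 where "C3 = (1 + (l + m)) / (2 * a)"
  define C0 where "C0 = (2 * C3 + 1) / (4 * m)"
  define C1 where "C1 = (2 * C2 + 1) / (4 * m)"
  have pos: "0 < C2" "0 < C3" "0 < C0" "0 < C1" using a m lm by (simp_all add: C2_def C3_def C0_def C1_def add_pos_pos divide_pos_pos)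
  have "(\<Sum>j<4. (cmod (Y j x))\<^sup>2) \<le> (C0\<^sup>2 + C1\<^sup>2 + C2\<^sup>2 + C3\<^sup>2) * 4 * ((cmod (zeta s 1 Y x))\<^sup>2 + (cmod (eta s 1 Y x))\<^sup>2
        + ((cmod (zeta s (-1) Y x))\<^sup>2 + (cmod (eta s (-1) Y x))\<^sup>2))" if s: "s * s = -1" for s :: complex and x and Y :: "nat \<Rightarrow> real \<Rightarrow> complex"
  proof -
    let ?zp = "zeta s 1 Y x" and ?zm = "zeta s (-1) Y x" and ?ep = "eta s 1 Y x" and ?em = "eta s (-1) Y x"
    have "cmod s * cmod s = 1" using arg_cong[OF s, of cmod] by (simp add: norm_mult)
    then have ns: "cmod s = 1" by (metis abs_norm_cancel real_sqrt_abs2 real_sqrt_one)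
    define R where "R = cmod ?zp + cmod ?ep + cmod ?zm + cmod ?em"
    \<comment> \<open>The inverse is explicit: the difference of the two \<open>eta\<close> gives
      \<open>Y 2\<close>, and their sum combined with the difference of the two \<open>zeta\<close>
      gives \<open>Y 3\<close> because m + (l + m) = a. The displacements then follow from the
      \<open>zeta\<close>.\<close>
    have e2: "2 * s * a * Y 2 x = ?ep - ?em" by (simp add: eta_def algebra_simps)
    have e3: "2 * a * Y 3 x = ?ep + ?em + (l + m) * (?zp - ?zm)"
      by (simp add: zeta_def eta_def a_def algebra_simps)
    have e0: "4 * m * s * Y 0 x = 2 * Y 3 x - (?zp - ?zm)" by (simp add: zeta_def algebra_simps)
    have e1: "4 * m * Y 1 x = ?zp + ?zm + 2 * s * Y 2 x" by (simp add: zeta_def algebra_simps)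
    have "2 * a * cmod (Y 2 x) = cmod (?ep - ?em)" using arg_cong[OF e2, of cmod] a ns by (simp add: norm_mult)
    also have "\<dots> \<le> R" using norm_triangle_ineq4[of ?ep ?em] by (simp add: R_def) (smt (verit) norm_ge_zero)
    finally have b2: "cmod (Y 2 x) \<le> C2 * R" using a by (simp add: C2_def field_simps)
    have "2 * a * cmod (Y 3 x) = cmod (?ep + ?em + (l + m) * (?zp - ?zm))" using arg_cong[OF e3, of cmod] a by (simp add: norm_mult)
    also have "\<dots> \<le> cmod (?ep + ?em) + (l + m) * cmod (?zp - ?zm)"
      using norm_triangle_ineq[of "?ep + ?em" "(l + m) * (?zp - ?zm)"] lm
      by (simp add: norm_mult flip: of_real_add)
    also have "\<dots> \<le> R + (l + m) * R"
      using norm_triangle_ineq[of ?ep ?em] norm_triangle_ineq4[of ?zp ?zm] lm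
      by (intro add_mono mult_left_mono) (auto simp: R_def intro: order_trans)
    finally have b3: "cmod (Y 3 x) \<le> C3 * R" using a by (simp add: C3_def field_simps)
    have "4 * m * cmod (Y 0 x) = cmod (2 * Y 3 x - (?zp - ?zm))" using arg_cong[OF e0, of cmod] m ns by (simp add: norm_mult)
    also have "\<dots> \<le> 2 * cmod (Y 3 x) + cmod (?zp - ?zm)" using norm_triangle_ineq4[of "2 * Y 3 x" "?zp - ?zm"] by (simp add: norm_mult)
    also have "\<dots> \<le> 2 * (C3 * R) + R" using b3 norm_triangle_ineq4[of ?zp ?zm] by (simp add: R_def) (smt (verit) norm_ge_zero)
    finally have b0: "cmod (Y 0 x) \<le> C0 * R" using m by (simp add: C0_def field_simps)
    have "4 * m * cmod (Y 1 x) = cmod (?zp + ?zm + 2 * s * Y 2 x)" using arg_cong[OF e1, of cmod] m by (simp add: norm_mult)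
    also have "\<dots> \<le> cmod (?zp + ?zm) + 2 * cmod (Y 2 x)" using norm_triangle_ineq[of "?zp + ?zm" "2 * s * Y 2 x"] ns by (simp add: norm_mult)
    also have "\<dots> \<le> R + 2 * (C2 * R)" using b2 norm_triangle_ineq[of ?zp ?zm] by (simp add: R_def) (smt (verit) norm_ge_zero)
    finally have b1: "cmod (Y 1 x) \<le> C1 * R" using m by (simp add: C1_def field_simps)
    have sq: "(cmod (Y j x))\<^sup>2 \<le> c\<^sup>2 * R\<^sup>2" if "cmod (Y j x) \<le> c * R" for j c
      using power_mono[OF that norm_ge_zero, of 2] by (simp add: power_mult_distrib)
    have "(\<Sum>j<4. (cmod (Y j x))\<^sup>2) \<le> (C0\<^sup>2 + C1\<^sup>2 + C2\<^sup>2 + C3\<^sup>2) * R\<^sup>2"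
      using sq[OF b0] sq[OF b1] sq[OF b2] sq[OF b3] by (simp add: sum_lessThan_4 algebra_simps)
    also have "\<dots> \<le> (C0\<^sup>2 + C1\<^sup>2 + C2\<^sup>2 + C3\<^sup>2) * (4 * ((cmod ?zp)\<^sup>2 + (cmod ?ep)\<^sup>2 + ((cmod ?zm)\<^sup>2 + (cmod ?em)\<^sup>2)))"
    proof (rule mult_left_mono)
      have four: "(a + b + c + d)\<^sup>2 \<le> 4 * (a\<^sup>2 + b\<^sup>2 + (c\<^sup>2 + d\<^sup>2))" for a b c d :: real
        using sum_squares_bound[of a b] sum_squares_bound[of a c] sum_squares_bound[of a d] sum_squares_bound[of b c]
          sum_squares_bound[of b d] sum_squares_bound[of c d] by (simp add: power2_eq_square algebra_simps)
      show "R\<^sup>2 \<le> 4 * ((cmod ?zp)\<^sup>2 + (cmod ?ep)\<^sup>2 + ((cmod ?zm)\<^sup>2 + (cmod ?em)\<^sup>2))"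
        unfolding R_def by (rule four)
    qed auto
    finally show ?thesis by (simp only: mult.assoc)
  qed
  moreover have "(C0\<^sup>2 + C1\<^sup>2 + C2\<^sup>2 + C3\<^sup>2) * 4 > 0" using pos by (auto intro!: add_pos_pos mult_pos_pos)
  ultimately show ?thesis by blast
qed

text \<open>The data may come with a factor k, while the solution enters only through r / k. The
  condition 1 \<le> |k| lets the data terms without that factor be charged to |k| as well.\<close>

lemma load_bound:
  "\<exists>C>0. \<forall>(k::complex) (s::complex) (t::complex) (d :: nat \<Rightarrow> real \<Rightarrow> complex) (Y :: nat \<Rightarrow> real \<Rightarrow> complex) x. s * s = -1 \<longrightarrow> t * t = 1 \<longrightarrow> 1 \<le> cmod k \<longrightarrow>
     (cmod (zeta_load k s t d Y x))\<^sup>2 \<le> C * ((cmod k)\<^sup>2 * (\<Sum>j<6. (cmod (d j x))\<^sup>2) + r\<^sup>2 / (cmod k)\<^sup>2 * (\<Sum>j<4. (cmod (Y j x))\<^sup>2)) \<and>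
     (cmod (eta_load k s t d Y x))\<^sup>2 \<le> C * ((cmod k)\<^sup>2 * (\<Sum>j<6. (cmod (d j x))\<^sup>2) + r\<^sup>2 / (cmod k)\<^sup>2 * (\<Sum>j<4. (cmod (Y j x))\<^sup>2))"
proof -
  define Cz where "Cz = 2 * m * \<bar>l\<bar> * (1 / a) + 2 * m + (2 * m + 1) + (E + \<bar>l\<bar> + 1 + a)"
  define Ce where "Ce = 2 * m * (l + m) * \<bar>l\<bar> * (1 / a) + a * (2 * m + 1) + m * (E + \<bar>l\<bar> + 1 + a)"
  have pos: "0 < Cz" "0 < Ce" using m a E lm by (auto simp: Cz_def Ce_def intro!: add_pos_pos add_nonneg_pos mult_pos_pos)
  have "(cmod (zeta_load k s t d Y x))\<^sup>2 \<le> Cz\<^sup>2 * (2 * ((cmod k)\<^sup>2 * (\<Sum>j<6. (cmod (d j x))\<^sup>2) + r\<^sup>2 / (cmod k)\<^sup>2 * (\<Sum>j<4. (cmod (Y j x))\<^sup>2)))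
     \<and> (cmod (eta_load k s t d Y x))\<^sup>2 \<le> Ce\<^sup>2 * (2 * ((cmod k)\<^sup>2 * (\<Sum>j<6. (cmod (d j x))\<^sup>2) + r\<^sup>2 / (cmod k)\<^sup>2 * (\<Sum>j<4. (cmod (Y j x))\<^sup>2)))"
    if s: "s * s = -1" and t: "t * t = 1" and k: "1 \<le> cmod k" for k s t :: complex and x and d Y :: "nat \<Rightarrow> real \<Rightarrow> complex"
  proof -
    have "cmod s * cmod s = 1" using arg_cong[OF s, of cmod] by (simp add: norm_mult)
    then have ns: "cmod s = 1" by (metis abs_norm_cancel real_sqrt_abs2 real_sqrt_one)
    have "cmod t * cmod t = 1" using arg_cong[OF t, of cmod] by (simp add: norm_mult)
    then have nt: "cmod t = 1" by (metis abs_norm_cancel real_sqrt_abs2 real_sqrt_one)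
    define \<Phi> where "\<Phi> = (\<Sum>j<6. (cmod (d j x))\<^sup>2)"
    define \<Upsilon> where "\<Upsilon> = (\<Sum>j<4. (cmod (Y j x))\<^sup>2)"
    define R where "R = cmod k * sqrt \<Phi> + \<bar>r\<bar> / cmod k * sqrt \<Upsilon>"
    have P0: "0 \<le> \<Phi>" "0 \<le> \<Upsilon>" by (auto simp: \<Phi>_def \<Upsilon>_def intro!: sum_nonneg)
    have dj: "cmod (d j x) \<le> sqrt \<Phi>" if "j < 6" for j
      unfolding \<Phi>_def by (rule real_le_rsqrt, rule member_le_sum[of j "{..<6}" "\<lambda>j. (cmod (d j x))\<^sup>2"]) (use that in auto)
    have Yj: "cmod (Y j x) \<le> sqrt \<Upsilon>" if "j < 4" for j
      unfolding \<Upsilon>_def by (rule real_le_rsqrt, rule member_le_sum[of j "{..<4}" "\<lambda>j. (cmod (Y j x))\<^sup>2"]) (use that in auto)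
    have q0: "0 \<le> \<bar>r\<bar> / cmod k * sqrt \<Upsilon>" "0 \<le> cmod k * sqrt \<Phi>" using P0 by auto
    have R0: "0 \<le> R" using q0 by (simp add: R_def)
    have kd: "cmod k * cmod (d j x) \<le> R" if "j < 6" for j
      using mult_left_mono[OF dj[OF that], of "cmod k"] q0 by (simp add: R_def)
    have dR: "cmod (d j x) \<le> R" if "j < 6" for j
      using kd[OF that] mult_right_mono[OF k norm_ge_zero[of "d j x"]] by simp
    have YR: "cmod (r / k * Y j x) \<le> R" if "j < 4" for j
      using mult_left_mono[OF Yj[OF that], of "\<bar>r\<bar> / cmod k"] q0 by (simp add: R_def norm_mult norm_divide)
    have c: "cmod (c * v) \<le> C * R" if "cmod v \<le> R" "cmod c = C" for c v :: complex and C
      using mult_left_mono[OF that(1), of C] that(2) by (metis norm_ge_zero norm_mult)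
    have kdj: "cmod (k * d j x) \<le> R" if "j < 6" for j using kd[OF that] by (simp add: norm_mult)
    have A: "cmod (m * d 3 x + r / k * Y 0 x + m * d 4 x) \<le> m * R + R + m * R"
      using m by (intro norm_triangle_mono c dR YR) auto
    have B: "cmod (E * (k * s * d 1 x) + l * d 2 x + r / k * Y 1 x + a * d 5 x) \<le> E * R + \<bar>l\<bar> * R + R + a * R"
      using kdj[of 1] ns a E by (intro norm_triangle_mono c dR YR) (auto simp: norm_mult)
    have X: "cmod ((2 * m * l * (1 / a) * s * t) * (k * d 1 x)) \<le> 2 * m * \<bar>l\<bar> * (1 / a) * R"
      using kdj[of 1] ns nt a m by (intro c) (auto simp: norm_mult norm_divide)
    have X2: "cmod ((- (2 * m)) * (k * d 0 x)) \<le> 2 * m * R"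
      using kdj[of 0] m by (intro c) (auto simp: norm_mult)
    have "zeta_load k s t d Y x = (2 * m * l * (1 / a) * s * t) * (k * d 1 x) + (- (2 * m)) * (k * d 0 x)
        + s * (m * d 3 x + r / k * Y 0 x + m * d 4 x) + (- t) * (E * (k * s * d 1 x) + l * d 2 x + r / k * Y 1 x + a * d 5 x)"
      unfolding zeta_load_def by (simp add: algebra_simps)
    also have "cmod \<dots> \<le> 2 * m * \<bar>l\<bar> * (1 / a) * R + 2 * m * R + (m * R + R + m * R) + (E * R + \<bar>l\<bar> * R + R + a * R)"
      by (intro norm_triangle_mono X X2) (use A B ns nt in \<open>simp_all add: norm_mult\<close>)
    also have "\<dots> = Cz * R" by (simp add: Cz_def algebra_simps)
    finally have Z: "cmod (zeta_load k s t d Y x) \<le> Cz * R" .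
    have X3: "cmod ((- (2 * m * (l + m) * l * (1 / a)) * s) * (k * d 1 x)) \<le> 2 * m * (l + m) * \<bar>l\<bar> * (1 / a) * R"
      using kdj[of 1] ns a m lm by (intro c) (auto simp: norm_mult norm_divide simp flip: of_real_add)
    have A': "cmod (- (s * t * a) * (m * d 3 x + r / k * Y 0 x + m * d 4 x)) \<le> a * (m * R + R + m * R)"
      using mult_left_mono[OF A, of a] a ns nt by (simp add: norm_mult)
    have B': "cmod (- complex_of_real m * (E * (k * s * d 1 x) + l * d 2 x + r / k * Y 1 x + a * d 5 x)) \<le> m * (E * R + \<bar>l\<bar> * R + R + a * R)"
      using mult_left_mono[OF B, of m] m by (simp add: norm_mult)
    have "eta_load k s t d Y x = (- (2 * m * (l + m) * l * (1 / a)) * s) * (k * d 1 x)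
        + (- (s * t * a)) * (m * d 3 x + r / k * Y 0 x + m * d 4 x) + (- complex_of_real m) * (E * (k * s * d 1 x) + l * d 2 x + r / k * Y 1 x + a * d 5 x)"
      unfolding eta_load_def by (simp add: algebra_simps)
    also have "cmod \<dots> \<le> 2 * m * (l + m) * \<bar>l\<bar> * (1 / a) * R + a * (m * R + R + m * R) + m * (E * R + \<bar>l\<bar> * R + R + a * R)"
      by (intro norm_triangle_mono X3 A' B')
    also have "\<dots> = Ce * R" by (simp add: Ce_def algebra_simps)
    finally have H: "cmod (eta_load k s t d Y x) \<le> Ce * R" .
    have "R\<^sup>2 \<le> 2 * (cmod k * sqrt \<Phi>)\<^sup>2 + 2 * (\<bar>r\<bar> / cmod k * sqrt \<Upsilon>)\<^sup>2"
      unfolding R_def using sum_squares_bound[of "cmod k * sqrt \<Phi>" "\<bar>r\<bar> / cmod k * sqrt \<Upsilon>"]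
      by (simp add: power2_sum)
    also have "\<dots> = 2 * ((cmod k)\<^sup>2 * \<Phi> + r\<^sup>2 / (cmod k)\<^sup>2 * \<Upsilon>)" using P0 by (simp add: power_mult_distrib power_divide)
    finally have RR: "R\<^sup>2 \<le> 2 * ((cmod k)\<^sup>2 * \<Phi> + r\<^sup>2 / (cmod k)\<^sup>2 * \<Upsilon>)" .
    have "(cmod v)\<^sup>2 \<le> C\<^sup>2 * (2 * ((cmod k)\<^sup>2 * \<Phi> + r\<^sup>2 / (cmod k)\<^sup>2 * \<Upsilon>))" if "cmod v \<le> C * R" for v :: complex and C
      using power_mono[OF that norm_ge_zero, of 2] mult_left_mono[OF RR, of "C\<^sup>2"] by (simp add: power_mult_distrib)
    from this[OF Z] this[OF H] show ?thesis by (simp add: \<Phi>_def \<Upsilon>_def)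
  qed
  note main = this
  show ?thesis
  proof (intro exI conjI allI impI)
    show "2 * (Cz\<^sup>2 + Ce\<^sup>2) > 0" using pos by (auto intro!: add_pos_pos)
    fix k s t :: complex and x and d Y :: "nat \<Rightarrow> real \<Rightarrow> complex"
    assume A: "s * s = -1" "t * t = 1" "1 \<le> cmod k"
    define q where "q = ((cmod k)\<^sup>2 * (\<Sum>j<6. (cmod (d j x))\<^sup>2) + r\<^sup>2 / (cmod k)\<^sup>2 * (\<Sum>j<4. (cmod (Y j x))\<^sup>2))"
    have q: "0 \<le> q" unfolding q_def by (intro add_nonneg_nonneg mult_nonneg_nonneg sum_nonneg) auto
    have "Cz\<^sup>2 * (2 * q) \<le> 2 * (Cz\<^sup>2 + Ce\<^sup>2) * q" "Ce\<^sup>2 * (2 * q) \<le> 2 * (Cz\<^sup>2 + Ce\<^sup>2) * q"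
      using q by (auto simp: algebra_simps)
    with main[OF A, of d Y x] show "(cmod (zeta_load k s t d Y x))\<^sup>2 \<le> 2 * (Cz\<^sup>2 + Ce\<^sup>2) * ((cmod k)\<^sup>2 * (\<Sum>j<6. (cmod (d j x))\<^sup>2) + r\<^sup>2 / (cmod k)\<^sup>2 * (\<Sum>j<4. (cmod (Y j x))\<^sup>2))"
      "(cmod (eta_load k s t d Y x))\<^sup>2 \<le> 2 * (Cz\<^sup>2 + Ce\<^sup>2) * ((cmod k)\<^sup>2 * (\<Sum>j<6. (cmod (d j x))\<^sup>2) + r\<^sup>2 / (cmod k)\<^sup>2 * (\<Sum>j<4. (cmod (Y j x))\<^sup>2))"
      unfolding q_def[symmetric] by (auto intro: order_trans)
  qed
qed


text \<open>Without stress, \<open>eta\<close> does not depend on the sign of t and determines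
  \<open>Y 0\<close>, while the two \<open>zeta\<close> differ by a multiple of \<open>Y 0\<close>.
  Hence zeta for t equals zeta for -t minus 2 t / (l + m) times eta. The constant is the square of
  this reflection law in the \<delta>-weighted norm.\<close>

lemma boundary_transfer:
  fixes s :: complex and Y :: "nat \<Rightarrow> real \<Rightarrow> complex" and \<delta> :: real
  assumes \<delta>: "0 < \<delta>" and z: "Y 2 x = 0" "Y 3 x = 0" and t: "t = 1 \<or> t = -1"
  shows "(cmod (zeta s t Y x))\<^sup>2 + \<delta> * (cmod (eta s t Y x))\<^sup>2
    \<le> (2 + 8 / ((l + m)\<^sup>2 * \<delta>)) * ((cmod (zeta s (-t) Y x))\<^sup>2 + \<delta> * (cmod (eta s (-t) Y x))\<^sup>2)"
proof -
  let ?L = "complex_of_real (l + m)"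
  have L0: "?L \<noteq> 0" using lm by (simp del: of_real_add)
  have e: "eta s t Y x = eta s (-t) Y x" using z by (simp add: eta_def)
  have "zeta s t Y x = zeta s (-t) Y x + (- t * 2 / ?L) * eta s (-t) Y x"
    using z L0 by (simp add: zeta_def eta_def field_simps)
  then have "(cmod (zeta s t Y x))\<^sup>2 \<le> 2 * (cmod (zeta s (-t) Y x))\<^sup>2 + 2 * (cmod ((- t * 2 / ?L) * eta s (-t) Y x))\<^sup>2"
    by (simp only: norm_add_square_le)
  also have "cmod ((- t * 2 / ?L) * eta s (-t) Y x) = 2 / (l + m) * cmod (eta s (-t) Y x)"
    using t lm by (auto simp: norm_mult norm_divide simp del: of_real_add)
  finally have "(cmod (zeta s t Y x))\<^sup>2 \<le> 2 * (cmod (zeta s (-t) Y x))\<^sup>2 + 8 / (l + m)\<^sup>2 * (cmod (eta s (-t) Y x))\<^sup>2"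
    by (simp add: power_mult_distrib power_divide)
  moreover have "8 / ((l + m)\<^sup>2 * \<delta>) * (\<delta> * (cmod (eta s (-t) Y x))\<^sup>2) = 8 / (l + m)\<^sup>2 * (cmod (eta s (-t) Y x))\<^sup>2"
    using \<delta> lm by simp
  moreover have "0 \<le> 8 / ((l + m)\<^sup>2 * \<delta>) * (cmod (zeta s (-t) Y x))\<^sup>2" "0 \<le> \<delta> * (cmod (eta s (-t) Y x))\<^sup>2" using \<delta> by auto
  ultimately show ?thesis unfolding e by (simp only: distrib_left distrib_right)
qed

lemma stress_system_continuous:
  assumes "stress_system k s d Y" "j < 4"
  shows "continuous_on {-h..h} (Y j)"
proof -
  have "j = 0 \<or> j = 1 \<or> j = 2 \<or> j = 3" using assms(2) by auto
  then show ?thesis using assms(1) unfolding stress_system_def by (elim disjE conjE) (simp_all add: primitive_continuous)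
qed

lemma load_sq_integrable:
  assumes d: "\<And>j. j < 6 \<Longrightarrow> sq_integrable h (d j)" and Y: "\<And>j. j < 4 \<Longrightarrow> sq_integrable h (Y j)"
  shows "sq_integrable h (zeta_load k s t d Y)" "sq_integrable h (eta_load k s t d Y)"
  unfolding zeta_load_def[abs_def] eta_load_def[abs_def]
  by (intro sq_integrable_add sq_integrable_diff sq_integrable_uminus sq_integrable_cmult d Y; simp)+

text \<open>Composition of three k-dependent facts: the loads are of size |k| times the data plus
  |r| / |k| times the solution, the block estimate divides squares by (Re k)^2, and Re k is
  comparable to |k|. What remains in front of the data is free of k.\<close>

lemma stress_system_estimate:
  assumes c: "0 < c"
  shows "\<exists>B0>0. \<exists>C>0. \<forall>k s d Y. B0 \<le> cmod k \<longrightarrow> c * cmod k \<le> Re k \<longrightarrow> s * s = -1 \<longrightarrow>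
    (\<forall>j<6. sq_integrable h (d j)) \<longrightarrow> stress_system k s d Y \<longrightarrow> stress_free Y \<longrightarrow>
    sq_energy h 4 Y \<le> C * sq_energy h 6 d"
proof -
  obtain C1 where C1: "0 < C1" "\<And>s Y x. s * s = -1 \<Longrightarrow>
     (\<Sum>j<4. (cmod (Y j x))\<^sup>2) \<le> C1 * ((cmod (zeta s 1 Y x))\<^sup>2 + (cmod (eta s 1 Y x))\<^sup>2
        + ((cmod (zeta s (-1) Y x))\<^sup>2 + (cmod (eta s (-1) Y x))\<^sup>2))" using recover_bound by blast
  obtain C2 where C2: "0 < C2" "\<And>k s t d Y x. s * s = -1 \<Longrightarrow> t * t = 1 \<Longrightarrow> 1 \<le> cmod k \<Longrightarrow>
     (cmod (zeta_load k s t d Y x))\<^sup>2 \<le> C2 * ((cmod k)\<^sup>2 * (\<Sum>j<6. (cmod (d j x))\<^sup>2) + r\<^sup>2 / (cmod k)\<^sup>2 * (\<Sum>j<4. (cmod (Y j x))\<^sup>2)) \<and>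
     (cmod (eta_load k s t d Y x))\<^sup>2 \<le> C2 * ((cmod k)\<^sup>2 * (\<Sum>j<6. (cmod (d j x))\<^sup>2) + r\<^sup>2 / (cmod k)\<^sup>2 * (\<Sum>j<4. (cmod (Y j x))\<^sup>2))"
    using load_bound by blast
  \<comment> \<open>The largest weight that the coupling with L = l + m allows.\<close>
  define \<delta> where "\<delta> = c\<^sup>2 / (4 * (l + m)\<^sup>2)"
  have \<delta>: "0 < \<delta>" "4 * \<delta> * (l + m)\<^sup>2 \<le> c\<^sup>2" using c lm by (auto simp: \<delta>_def)
  define Cb where "Cb = 2 + 8 / ((l + m)\<^sup>2 * \<delta>)"
  have Cb: "1 \<le> Cb" using \<delta> lm by (simp add: Cb_def add_increasing2)
  \<comment> \<open>The product of three constants: return from eigen-coordinates, block estimate,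
    and loads.\<close>
  define D where "D = C1 * (1 + 1 / \<delta>) * (8 * Cb / c\<^sup>2) * ((2 + 2 * \<delta>) * C2)"
  have D: "0 < D" unfolding D_def using C1 C2 \<delta> Cb c by (intro mult_pos_pos divide_pos_pos add_pos_pos) auto
  \<comment> \<open>The three summands secure, in turn, |k| \<ge> 1 for the load bound, the
    absorption of the zeroth-order term, and the slope condition on the weights.\<close>
  define B0 where "B0 = 1 + 2 * D * r\<^sup>2 + (Cb - 1) / (h * c)"
  have B0: "1 \<le> B0" "2 * D * r\<^sup>2 \<le> B0" "(Cb - 1) / (h * c) \<le> B0" using D h c Cb by (auto simp: B0_def add_nonneg_nonneg)
  show ?thesis
  proof (rule exI[of _ B0], intro conjI, use B0 in simp, rule exI[of _ "2 * D"], intro conjI allI impI, use D in simp)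
    fix k s :: complex and d Y :: "nat \<Rightarrow> real \<Rightarrow> complex"
    assume kB: "B0 \<le> cmod k" and kc: "c * cmod k \<le> Re k" and s: "s * s = -1"
      and d: "\<forall>j<6. sq_integrable h (d j)" and sys: "stress_system k s d Y" and bc: "stress_free Y"
    have k1: "1 \<le> cmod k" using kB B0 by simp
    have kpos: "0 < c * cmod k" using c k1 by (intro mult_pos_pos) auto
    then have Rk: "0 < Re k" using kc by simp
    have "Cb - 1 \<le> B0 * (h * c)" using B0(3) h c by (simp add: field_simps)
    also have "\<dots> \<le> cmod k * (h * c)" using kB h c by (intro mult_right_mono) auto
    also have "\<dots> \<le> h * Re k" using mult_left_mono[OF kc, of h] h by (simp add: ac_simps)
    finally have kh: "Cb - 1 \<le> h * Re k" .
    have Yc: "continuous_on {-h..h} (Y j)" if "j < 4" for j by (rule stress_system_continuous[OF sys that])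
    have Ys: "sq_integrable h (Y j)" if "j < 4" for j by (rule sq_integrable_continuous[OF Yc[OF that]])
    have ds: "sq_integrable h (d j)" if "j < 6" for j using d that by blast
    let ?zp = "zeta s 1 Y" and ?zm = "zeta s (-1) Y" and ?ep = "eta s 1 Y" and ?em = "eta s (-1) Y"
    let ?p1 = "zeta_load k s 1 d Y" and ?p2 = "eta_load k s 1 d Y" and ?p3 = "zeta_load k s (-1) d Y" and ?p4 = "eta_load k s (-1) d Y"
    note ls = load_sq_integrable[of d Y, OF ds Ys]
    have bcl: "Y 2 (-h) = 0" "Y 3 (-h) = 0" and bcr: "Y 2 h = 0" "Y 3 h = 0" using bc by (auto simp: stress_free_def)
    let ?PN = "\<lambda>x. (cmod (?zp x))\<^sup>2 + \<delta> * (cmod (?ep x))\<^sup>2 + ((cmod (?zm x))\<^sup>2 + \<delta> * (cmod (?em x))\<^sup>2)"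
    let ?Q = "\<lambda>x. (cmod (?p1 x))\<^sup>2 + \<delta> * (cmod (?p2 x))\<^sup>2 + ((cmod (?p3 x))\<^sup>2 + \<delta> * (cmod (?p4 x))\<^sup>2)"
    have zpP: "primitive h ?zp (\<lambda>x. k * ?zp x + ?p1 x)" using zeta_primitive[OF s _ sys, of 1] by simp
    have epP: "primitive h ?ep (\<lambda>x. k * ?ep x + complex_of_real (l + m) * k * ?zp x + ?p2 x)" using eta_primitive[OF s _ sys, of 1] by simp
    have zmP: "primitive h ?zm (\<lambda>x. - (k * ?zm x) + ?p3 x)" using zeta_primitive[OF s _ sys, of "-1"] by simp
    have emP: "primitive h ?em (\<lambda>x. - (k * ?em x) + complex_of_real (l + m) * k * ?zm x + ?p4 x)" using eta_primitive[OF s _ sys, of "-1"] by simp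
    have est: "(\<integral>x. ?PN x \<partial>Mh h) \<le> 8 * Cb / (Re k)\<^sup>2 * (\<integral>x. ?Q x \<partial>Mh h)"
      by (rule coupled_block_estimate[OF h c kc \<delta> Cb Rk kh zpP epP zmP emP ls ls])
        (use boundary_transfer[where \<delta> = \<delta> and t = 1 and s = s and Y = Y and x = h, OF \<delta>(1) bcr]
          boundary_transfer[where \<delta> = \<delta> and t = "-1" and s = s and Y = Y and x = "-h", OF \<delta>(1) bcl] in \<open>simp_all add: Cb_def\<close>)
    define e\<Phi> where "e\<Phi> = sq_energy h 6 d"
    define eY where "eY = sq_energy h 4 Y"
    have iY: "integrable (Mh h) (\<lambda>x. (\<Sum>j<4. (cmod (Y j x))\<^sup>2))"
      using Ys by (intro Bochner_Integration.integrable_sum) (auto simp: sq_integrable_def)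
    have id: "integrable (Mh h) (\<lambda>x. (\<Sum>j<6. (cmod (d j x))\<^sup>2))"
      using ds by (intro Bochner_Integration.integrable_sum) (auto simp: sq_integrable_def)
    have iPN: "integrable (Mh h) ?PN"
      by (intro integrable_Mh_continuous continuous_intros primitive_continuous[OF zpP] primitive_continuous[OF epP]
          primitive_continuous[OF zmP] primitive_continuous[OF emP])
    have iQ: "integrable (Mh h) ?Q" using ls[of k s 1] ls[of k s "-1"] unfolding sq_integrable_def by auto
    have "eY \<le> (\<integral>x. (C1 * (1 + 1 / \<delta>)) * ?PN x \<partial>Mh h)"
      unfolding eY_def sq_energy_def
    proof (rule integral_mono[OF iY])
      show "integrable (Mh h) (\<lambda>x. (C1 * (1 + 1 / \<delta>)) * ?PN x)" using iPN by (rule integrable_mult_right)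
      fix x
      have "(cmod u)\<^sup>2 + (cmod v)\<^sup>2 \<le> (1 + 1 / \<delta>) * ((cmod u)\<^sup>2 + \<delta> * (cmod v)\<^sup>2)" for u v :: complex
        using \<delta> by (simp add: algebra_simps add_divide_distrib)
      from add_mono[OF this this]
      have "(cmod (?zp x))\<^sup>2 + (cmod (?ep x))\<^sup>2 + ((cmod (?zm x))\<^sup>2 + (cmod (?em x))\<^sup>2) \<le> (1 + 1 / \<delta>) * ?PN x"
        by (simp only: distrib_left[symmetric])
      from mult_left_mono[OF this, of C1] C1(2)[OF s, of Y x] C1(1)
      show "(\<Sum>j<4. (cmod (Y j x))\<^sup>2) \<le> (C1 * (1 + 1 / \<delta>)) * ?PN x" by (simp only: mult.assoc) linarith
    qed
    also have "\<dots> = (C1 * (1 + 1 / \<delta>)) * (\<integral>x. ?PN x \<partial>Mh h)" by (rule integral_mult_right_zero)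
    also have "\<dots> \<le> (C1 * (1 + 1 / \<delta>)) * (8 * Cb / (Re k)\<^sup>2 * (\<integral>x. ?Q x \<partial>Mh h))"
      using est C1(1) \<delta>(1) by (intro mult_left_mono) auto
    finally have s1: "eY \<le> (C1 * (1 + 1 / \<delta>)) * (8 * Cb / (Re k)\<^sup>2 * (\<integral>x. ?Q x \<partial>Mh h))" .
    let ?q = "\<lambda>x. (cmod k)\<^sup>2 * (\<Sum>j<6. (cmod (d j x))\<^sup>2) + r\<^sup>2 / (cmod k)\<^sup>2 * (\<Sum>j<4. (cmod (Y j x))\<^sup>2)"
    have "(\<integral>x. ?Q x \<partial>Mh h) \<le> (\<integral>x. ((2 + 2 * \<delta>) * C2) * ?q x \<partial>Mh h)"
    proof (rule integral_mono[OF iQ])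
      show "integrable (Mh h) (\<lambda>x. ((2 + 2 * \<delta>) * C2) * ?q x)" using iY id by (intro integrable_mult_right Bochner_Integration.integrable_add)
      fix x
      have 1: "(cmod (?p1 x))\<^sup>2 \<le> C2 * ?q x" "\<delta> * (cmod (?p2 x))\<^sup>2 \<le> \<delta> * (C2 * ?q x)"
        "(cmod (?p3 x))\<^sup>2 \<le> C2 * ?q x" "\<delta> * (cmod (?p4 x))\<^sup>2 \<le> \<delta> * (C2 * ?q x)"
        using C2(2)[OF s _ k1, of 1 d Y x] C2(2)[OF s _ k1, of "-1" d Y x] \<delta>(1) by (auto intro!: mult_left_mono)
      have "((2 + 2 * \<delta>) * C2) * ?q x = C2 * ?q x + \<delta> * (C2 * ?q x) + (C2 * ?q x + \<delta> * (C2 * ?q x))"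
        by (simp only: distrib_right mult.assoc) simp
      with 1 show "?Q x \<le> ((2 + 2 * \<delta>) * C2) * ?q x" by linarith
    qed
    also have "\<dots> = ((2 + 2 * \<delta>) * C2) * (\<integral>x. ?q x \<partial>Mh h)" by (rule integral_mult_right_zero)
    also have "(\<integral>x. ?q x \<partial>Mh h) = (cmod k)\<^sup>2 * e\<Phi> + r\<^sup>2 / (cmod k)\<^sup>2 * eY"
      unfolding e\<Phi>_def eY_def sq_energy_def
      by (subst Bochner_Integration.integral_add[OF integrable_mult_right[OF id] integrable_mult_right[OF iY]])
        (simp only: integral_mult_right_zero)
    finally have s2: "(\<integral>x. ?Q x \<partial>Mh h) \<le> ((2 + 2 * \<delta>) * C2) * ((cmod k)\<^sup>2 * e\<Phi> + r\<^sup>2 / (cmod k)\<^sup>2 * eY)" .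
    have e0: "0 \<le> e\<Phi>" "0 \<le> eY" by (auto simp: e\<Phi>_def eY_def sq_energy_nonneg)
    let ?G = "(cmod k)\<^sup>2 * e\<Phi> + r\<^sup>2 / (cmod k)\<^sup>2 * eY"
    have G0: "0 \<le> ?G" using e0 by auto
    have "8 * Cb / (Re k)\<^sup>2 \<le> 8 * Cb / (c * cmod k)\<^sup>2"
      using Cb kpos kc by (intro divide_left_mono power_mono mult_pos_pos) auto
    also have "\<dots> = 8 * Cb / c\<^sup>2 / (cmod k)\<^sup>2" by (simp add: power_mult_distrib)
    finally have s3: "8 * Cb / (Re k)\<^sup>2 \<le> 8 * Cb / c\<^sup>2 / (cmod k)\<^sup>2" .
    have "eY \<le> (C1 * (1 + 1 / \<delta>)) * ((8 * Cb / c\<^sup>2 / (cmod k)\<^sup>2) * (((2 + 2 * \<delta>) * C2) * ?G))"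
      using s1 by (rule order_trans)
        (use s2 s3 C1(1) C2(1) \<delta>(1) Cb G0 in \<open>intro mult_left_mono mult_mono; auto intro!: Bochner_Integration.integral_nonneg add_nonneg_nonneg\<close>)
    \<comment> \<open>The factor |k|^2 on the data cancels here, and the solution on the right is
      left with r^2 / |k|^4.\<close>
    also have "\<dots> = D * (?G / (cmod k)\<^sup>2)" by (simp add: D_def)
    also have "?G / (cmod k)\<^sup>2 = e\<Phi> + r\<^sup>2 / (cmod k)^4 * eY"
    proof -
      have "cmod k \<noteq> 0" using k1 by linarith
      then show ?thesis by (simp add: field_simps power2_eq_square power4_eq_xxxx)
    qed
    finally have s4: "eY \<le> D * e\<Phi> + (D * r\<^sup>2 / (cmod k)^4) * eY" by (simp add: algebra_simps)
    \<comment> \<open>At most half of the energy of \<open>Y\<close> returns on the right, which is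
      why the final constant is 2 D. As |k| \<ge> 1, the fourth power dominates |k| itself.\<close>
    have "D * r\<^sup>2 / (cmod k)^4 \<le> 1 / 2"
    proof -
      have "2 * D * r\<^sup>2 \<le> cmod k" using kB B0 by simp
      also have "\<dots> \<le> (cmod k)^4" using k1 self_le_power[of "cmod k" 4] by simp
      finally have "2 * D * r\<^sup>2 \<le> (cmod k)^4" .
      moreover have "0 < (cmod k)^4" using k1 by (intro zero_less_power) linarith
      ultimately show ?thesis by (simp add: divide_le_eq)
    qed
    then have "(D * r\<^sup>2 / (cmod k)^4) * eY \<le> 1 / 2 * eY" using e0 by (intro mult_right_mono)
    then show "sq_energy h 4 Y \<le> 2 * D * sq_energy h 6 d" using s4 unfolding e\<Phi>_def eY_def by linarith
  qed
qed

section \<open>Solvability of the first-order boundary value problem\<close>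

lemma stress_system_lincomb:
  assumes 1: "stress_system k s d Y" and 2: "stress_system k s d' Y'"
  shows "stress_system k s (\<lambda>j x. d j x + c * d' j x) (\<lambda>j x. Y j x + c * Y' j x)"
proof -
  have p: "primitive h f g \<Longrightarrow> primitive h f' g' \<Longrightarrow> (\<lambda>x. g x + c * g' x) = q \<Longrightarrow> primitive h (\<lambda>x. f x + c * f' x) q"
    for f f' g g' q
    using primitive_add[OF _ primitive_cmult, of h f g f' g' c] by simp
  note D = stress_system_def
  show ?thesis unfolding D
  proof (intro conjI)
    show "primitive h (\<lambda>x. Y 0 x + c * Y' 0 x) (\<lambda>x. k * (Y 2 x + c * Y' 2 x - l * s * (Y 1 x + c * Y' 1 x) - l * (d 1 x + c * d' 1 x)) / a)"
      by (rule p[OF conjunct1[OF 1[unfolded D]] conjunct1[OF 2[unfolded D]]])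
        (simp add: algebra_simps add_divide_distrib diff_divide_distrib)
    show "primitive h (\<lambda>x. Y 1 x + c * Y' 1 x) (\<lambda>x. k * ((Y 3 x + c * Y' 3 x) / m - s * (Y 0 x + c * Y' 0 x) - (d 0 x + c * d' 0 x)))"
      by (rule p[OF conjunct1[OF conjunct2[OF 1[unfolded D]]] conjunct1[OF conjunct2[OF 2[unfolded D]]]])
        (simp add: algebra_simps add_divide_distrib diff_divide_distrib)
    show "primitive h (\<lambda>x. Y 2 x + c * Y' 2 x) (\<lambda>x. - (k * s * (Y 3 x + c * Y' 3 x)) - m * (d 3 x + c * d' 3 x) - r / k * (Y 0 x + c * Y' 0 x) - m * (d 4 x + c * d' 4 x))"
      by (rule p[OF conjunct1[OF conjunct2[OF conjunct2[OF 1[unfolded D]]]] conjunct1[OF conjunct2[OF conjunct2[OF 2[unfolded D]]]]])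
        (simp add: algebra_simps add_divide_distrib diff_divide_distrib)
    show "primitive h (\<lambda>x. Y 3 x + c * Y' 3 x) (\<lambda>x. k * (- (s * (l / a) * (Y 2 x + c * Y' 2 x)) + E * (Y 1 x + c * Y' 1 x) - s * E * (d 1 x + c * d' 1 x))
         - l * (d 2 x + c * d' 2 x) - r / k * (Y 1 x + c * Y' 1 x) - a * (d 5 x + c * d' 5 x))"
      by (rule p[OF conjunct2[OF conjunct2[OF conjunct2[OF 1[unfolded D]]]] conjunct2[OF conjunct2[OF conjunct2[OF 2[unfolded D]]]]])
        (simp add: algebra_simps add_divide_distrib diff_divide_distrib)
  qed
qed

lemma stress_free_lincomb:
  "stress_free Y \<Longrightarrow> stress_free Y' \<Longrightarrow> stress_free (\<lambda>j x. Y j x + c * Y' j x)"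
  by (auto simp: stress_free_def)

lemma stress_system_zero: "stress_system k s (\<lambda>_ _. 0) (\<lambda>_ _. 0)"
  by (simp add: stress_system_def primitive_const)

lemma stress_system_ivp:
  fixes k s c0 c1 :: complex and d :: "nat \<Rightarrow> real \<Rightarrow> complex"
  assumes d: "\<And>j. j < 6 \<Longrightarrow> sq_integrable h (d j)"
  shows "\<exists>Y. stress_system k s d Y \<and> Y 0 (-h) = c0 \<and> Y 1 (-h) = c1 \<and> Y 2 (-h) = 0 \<and> Y 3 (-h) = 0"
proof -
  define N :: "complex \<times> complex \<times> complex \<times> complex \<Rightarrow> complex \<times> complex \<times> complex \<times> complex" where
    "N y = (k * (fst (snd (snd y)) - l * s * fst (snd y)) / a, k * (snd (snd (snd y)) / m - s * fst y),
       - (k * s * snd (snd (snd y))) - r / k * fst y, k * (- (s * (l / a) * fst (snd (snd y))) + E * fst (snd y)) - r / k * fst (snd y))" for y :: "complex \<times> complex \<times> complex \<times> complex"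
  define f where "f x = ((- (k * l / a)) * d 1 x, (- k) * d 0 x, (- complex_of_real m) * d 3 x + (- complex_of_real m) * d 4 x,
       (- (k * s * E)) * d 1 x + (- complex_of_real l) * d 2 x + (- complex_of_real a) * d 5 x)" for x
  have "linear N"
    by (rule linearI) (simp_all add: N_def algebra_simps add_divide_distrib diff_divide_distrib scaleR_conv_of_real)
  then have N: "bounded_linear N" by (simp add: linear_conv_bounded_linear)
  have di: "integrable (Mh h) (\<lambda>x. c * d j x)" if "j < 6" for j c
    using sq_integrable_imp_integrable[OF d[OF that]] by (rule integrable_mult_right)
  have f: "integrable (Mh h) f" unfolding f_def
    by (intro integrable_Pair_intro Bochner_Integration.integrable_add di) auto
  obtain y where y0: "y (-h) = (c0, c1, 0, 0)" and y: "primitive h y (\<lambda>x. N (y x) + f x)"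
    using linear_ivp_exists[OF N f h] by blast
  define Y where "Y j = (if j = 0 then (\<lambda>x. fst (y x)) else if j = 1 then (\<lambda>x. fst (snd (y x)))
     else if j = 2 then (\<lambda>x. fst (snd (snd (y x)))) else (\<lambda>x. snd (snd (snd (y x)))))" for j :: nat
  have "stress_system k s d Y" unfolding stress_system_def
  proof (intro conjI)
    show "primitive h (Y 0) (\<lambda>x. k * (Y 2 x - l * s * Y 1 x - l * d 1 x) / a)"
      using primitive_bounded_linear[OF y bounded_linear_fst]
      by (simp add: Y_def N_def f_def algebra_simps add_divide_distrib diff_divide_distrib)
    show "primitive h (Y 1) (\<lambda>x. k * (Y 3 x / m - s * Y 0 x - d 0 x))"
      using primitive_bounded_linear[OF primitive_bounded_linear[OF y bounded_linear_snd] bounded_linear_fst]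
      by (simp add: Y_def N_def f_def algebra_simps)
    show "primitive h (Y 2) (\<lambda>x. - (k * s * Y 3 x) - m * d 3 x - r / k * Y 0 x - m * d 4 x)"
    proof -
      have "(\<lambda>x. fst (snd (snd (N (y x) + f x)))) = (\<lambda>x. - (k * s * Y 3 x) - m * d 3 x - r / k * Y 0 x - m * d 4 x)"
        by (rule ext) (simp add: Y_def N_def f_def)
      with primitive_bounded_linear[OF primitive_bounded_linear[OF primitive_bounded_linear[OF y bounded_linear_snd] bounded_linear_snd] bounded_linear_fst]
      show ?thesis by (simp add: Y_def)
    qed
    show "primitive h (Y 3) (\<lambda>x. k * (- (s * (l / a) * Y 2 x) + E * Y 1 x - s * E * d 1 x) - l * d 2 x - r / k * Y 1 x - a * d 5 x)"
      using primitive_bounded_linear[OF primitive_bounded_linear[OF primitive_bounded_linear[OF y bounded_linear_snd] bounded_linear_snd] bounded_linear_snd]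
      by (simp add: Y_def N_def f_def algebra_simps)
  qed
  then show ?thesis using y0 by (intro exI[of _ Y]) (simp add: Y_def)
qed

text \<open>Shooting from the left end. A particular solution and two homogeneous ones start without
  stress there; the homogeneous ones start with the two unit displacements. Cancelling the stress at
  the right end is a 2 by 2 linear system, whose matrix is injective because the homogeneous problem
  has only the zero solution.\<close>

lemma stress_system_solvable:
  fixes k s :: complex and d :: "nat \<Rightarrow> real \<Rightarrow> complex"
  assumes uniq: "\<And>Y. stress_system k s (\<lambda>_ _. 0) Y \<Longrightarrow> stress_free Y \<Longrightarrow> sq_energy h 4 Y = 0"
    and d: "\<And>j. j < 6 \<Longrightarrow> sq_integrable h (d j)"
  shows "\<exists>Y. stress_system k s d Y \<and> stress_free Y"
proof -
  obtain Y0 where Y0: "stress_system k s d Y0" "Y0 2 (-h) = 0" "Y0 3 (-h) = 0" using stress_system_ivp[of d k s 0 0, OF d] by auto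
  obtain Ya where Ya: "stress_system k s (\<lambda>_ _. 0) Ya" "Ya 0 (-h) = 1" "Ya 1 (-h) = 0" "Ya 2 (-h) = 0" "Ya 3 (-h) = 0"
    using stress_system_ivp[of "\<lambda>_ _. 0" k s 1 0, OF sq_integrable_zero] by auto
  obtain Yb where Yb: "stress_system k s (\<lambda>_ _. 0) Yb" "Yb 0 (-h) = 0" "Yb 1 (-h) = 1" "Yb 2 (-h) = 0" "Yb 3 (-h) = 0"
    using stress_system_ivp[of "\<lambda>_ _. 0" k s 0 1, OF sq_integrable_zero] by auto
  have inj: "\<alpha> = 0 \<and> \<beta> = 0" if "\<alpha> * Ya 2 h + \<beta> * Yb 2 h = 0" "\<alpha> * Ya 3 h + \<beta> * Yb 3 h = 0" for \<alpha> \<beta>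
  proof -
    define Z where "Z = (\<lambda>j x. 0 + \<alpha> * Ya j x + \<beta> * Yb j x)"
    have Z: "stress_system k s (\<lambda>_ _. 0) Z"
      using stress_system_lincomb[OF stress_system_lincomb[OF stress_system_zero Ya(1), of \<alpha>] Yb(1), of \<beta>] by (simp add: Z_def)
    have "stress_free Z" using Ya Yb that by (auto simp: stress_free_def Z_def)
    note z = sq_energy_zero_imp_zero[OF stress_system_continuous[OF Z] uniq[OF Z this] h]
    from z[of 0 "-h"] z[of 1 "-h"] show ?thesis using h Ya Yb by (simp add: Z_def)
  qed
  define D where "D = Ya 2 h * Yb 3 h - Yb 2 h * Ya 3 h"
  have D: "D \<noteq> 0"
  proof
    assume D0: "D = 0"
    \<comment> \<open>If the determinant vanished, the cofactors of either row would give a kernel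
      vector, so all entries would be 0; then (1, 0) would lie in the kernel too.\<close>
    have 1: "Yb 2 h = 0 \<and> - Ya 2 h = 0" by (rule inj) (use D0 in \<open>auto simp: D_def algebra_simps\<close>)
    have 2: "Yb 3 h = 0 \<and> - Ya 3 h = 0" by (rule inj) (use D0 in \<open>auto simp: D_def algebra_simps\<close>)
    have "(1::complex) = 0 \<and> (0::complex) = 0" by (rule inj) (use 1 2 in auto)
    then show False by simp
  qed
  \<comment> \<open>Cramer's rule for the stress of \<open>Y0\<close> at the right end.\<close>
  define \<alpha> where "\<alpha> = (Y0 3 h * Yb 2 h - Y0 2 h * Yb 3 h) / D"
  define \<beta> where "\<beta> = (Y0 2 h * Ya 3 h - Y0 3 h * Ya 2 h) / D"
  define Z where "Z = (\<lambda>j x. Y0 j x + \<alpha> * Ya j x + \<beta> * Yb j x)"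
  have "stress_system k s d Z"
    using stress_system_lincomb[OF stress_system_lincomb[OF Y0(1) Ya(1), of \<alpha>] Yb(1), of \<beta>] by (simp add: Z_def)
  moreover have "Z 2 h = 0" "Z 3 h = 0"
  proof -
    have "D * Z 2 h = Y0 2 h * D + (\<alpha> * D) * Ya 2 h + (\<beta> * D) * Yb 2 h" by (simp add: Z_def algebra_simps)
    also have "\<dots> = 0" unfolding \<alpha>_def \<beta>_def using D by simp (simp add: D_def algebra_simps)
    finally show "Z 2 h = 0" using D by simp
    have "D * Z 3 h = Y0 3 h * D + (\<alpha> * D) * Ya 3 h + (\<beta> * D) * Yb 3 h" by (simp add: Z_def algebra_simps)
    also have "\<dots> = 0" unfolding \<alpha>_def \<beta>_def using D by simp (simp add: D_def algebra_simps)
    finally show "Z 3 h = 0" using D by simp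
  qed
  then have "stress_free Z" using Y0 Ya Yb by (auto simp: stress_free_def Z_def)
  ultimately show ?thesis by blast
qed

end

section \<open>The cosine basis\<close>

lemma primitive_zero_imp_AE_zero:
  fixes g :: "real \<Rightarrow> 'a::euclidean_space"
  assumes p: "primitive h f g" and z: "\<And>x. x \<in> {-h..h} \<Longrightarrow> f x = 0" and h: "0 < h"
  shows "AE x in Mh h. g x = 0"
proof (rule AE_zero_of_halfline_integrals)
  show "integrable (Mh h) g" by (rule primitive_integrable[OF p])
  fix x
  let ?y = "min h (max (-h) x)"
  have "(\<integral>t. indicator {x<..} t *\<^sub>R g t \<partial>Mh h) = (\<integral>t. indicator {?y<..h} t *\<^sub>R g t \<partial>Mh h)"
    by (rule Bochner_Integration.integral_cong) (use h in \<open>auto simp: indicator_def\<close>)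
  also have "\<dots> = f h - f ?y" using primitive_increment[OF p, of ?y h] h by simp
  also have "\<dots> = 0" using z h by simp
  finally show "(\<integral>t. indicator {x<..} t *\<^sub>R g t \<partial>Mh h) = 0" .
qed

text \<open>Affine map of [-h, h] onto [0, pi]. Cosines of its integer multiples have zero
  derivative at both ends, so no boundary terms arise when they are tested in H^1.\<close>

definition angle :: "real \<Rightarrow> real \<Rightarrow> real" where "angle h x = pi * (x + h) / (2 * h)"

lemma angle_bounds:
  assumes "0 < h" "x \<in> {-h..h}"
  shows "0 \<le> angle h x" "angle h x \<le> pi"
proof -
  have "pi * (x + h) \<le> pi * (2 * h)" using assms by (intro mult_left_mono) auto
  then show "0 \<le> angle h x" "angle h x \<le> pi" using assms by (auto simp: angle_def divide_le_eq)
qed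

lemma angle_ends: "0 < h \<Longrightarrow> angle h (-h) = 0" "0 < h \<Longrightarrow> angle h h = pi"
  by (auto simp: angle_def)

lemma continuous_angle [continuous_intros]: "continuous_on S (angle h)"
  unfolding angle_def divide_inverse by (intro continuous_intros)

lemma primitive_cos_angle:
  assumes "0 < h"
  shows "primitive h (\<lambda>x. cos (c * angle h x)) (\<lambda>x. - (c * pi / (2 * h)) * sin (c * angle h x))"
  by (rule primitive_of_derivative)
    (use assms in \<open>auto simp: angle_def has_real_derivative_iff_has_vector_derivative[symmetric] intro!: derivative_eq_intros continuous_intros\<close>)

lemma primitive_sin_angle:
  assumes "0 < h"
  shows "primitive h (\<lambda>x. sin (c * angle h x)) (\<lambda>x. (c * pi / (2 * h)) * cos (c * angle h x))"
  by (rule primitive_of_derivative)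
    (use assms in \<open>auto simp: angle_def has_real_derivative_iff_has_vector_derivative[symmetric] intro!: derivative_eq_intros continuous_intros\<close>)

lemma integral_cos_angle:
  assumes h: "0 < h"
  shows "(\<integral>x. cos (real_of_int n * angle h x) \<partial>Mh h) = (if n = 0 then 2 * h else 0)"
proof (cases "n = 0")
  case True
  then show ?thesis using h by (simp add: measure_restrict_space)
next
  case False
  have "sin (real_of_int n * pi) = 0" by (simp add: sin_zero_iff_int2)
  then have "(\<integral>x. (real_of_int n * pi / (2 * h)) * cos (real_of_int n * angle h x) \<partial>Mh h) = 0"
    using primitive_total[OF primitive_sin_angle[OF h] h, of "real_of_int n"] h by (simp add: angle_ends)
  then show ?thesis using False h by simp
qed

text \<open>Squared L^2 norm of the q-th cosine; the constant function is the exceptional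
  case.\<close>

definition cos_norm :: "real \<Rightarrow> nat \<Rightarrow> real" where "cos_norm h q = (if q = 0 then 2 * h else h)"

lemma integrable_trig: 
  "integrable (Mh h) (\<lambda>x. cos (c * angle h x))"
  by (intro integrable_Mh_continuous continuous_intros)

lemma integral_cos_cos:
  assumes h: "0 < h"
  shows "(\<integral>x. cos (real p * angle h x) * cos (real q * angle h x) \<partial>Mh h) = (if p = q then cos_norm h q else 0)"
    and "(\<integral>x. sin (real p * angle h x) * sin (real q * angle h x) \<partial>Mh h) = (if p = q \<and> q \<noteq> 0 then h else 0)"
proof -
  let ?A = "\<lambda>x. cos (real_of_int (int p - int q) * angle h x)" and ?B = "\<lambda>x. cos (real_of_int (int p + int q) * angle h x)"
  have i: "integrable (Mh h) ?A" "integrable (Mh h) ?B" by (rule integrable_trig)+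
  have "(\<integral>x. cos (real p * angle h x) * cos (real q * angle h x) \<partial>Mh h) = (\<integral>x. (1/2) * (?A x + ?B x) \<partial>Mh h)"
    by (rule Bochner_Integration.integral_cong) (auto simp: cos_add cos_diff algebra_simps)
  also have "\<dots> = (1/2) * ((\<integral>x. ?A x \<partial>Mh h) + (\<integral>x. ?B x \<partial>Mh h))"
    using i by (simp only: integral_mult_right_zero Bochner_Integration.integral_add)
  also have "\<dots> = (if p = q then cos_norm h q else 0)"
    unfolding integral_cos_angle[OF h] by (auto simp: cos_norm_def)
  finally show "(\<integral>x. cos (real p * angle h x) * cos (real q * angle h x) \<partial>Mh h) = (if p = q then cos_norm h q else 0)" .
  have "(\<integral>x. sin (real p * angle h x) * sin (real q * angle h x) \<partial>Mh h) = (\<integral>x. (1/2) * (?A x - ?B x) \<partial>Mh h)"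
    by (rule Bochner_Integration.integral_cong) (auto simp: cos_add cos_diff algebra_simps)
  also have "\<dots> = (1/2) * ((\<integral>x. ?A x \<partial>Mh h) - (\<integral>x. ?B x \<partial>Mh h))"
    using i by (simp only: integral_mult_right_zero Bochner_Integration.integral_diff)
  also have "\<dots> = (if p = q \<and> q \<noteq> 0 then h else 0)"
    unfolding integral_cos_angle[OF h] by auto
  finally show "(\<integral>x. sin (real p * angle h x) * sin (real q * angle h x) \<partial>Mh h) = (if p = q \<and> q \<noteq> 0 then h else 0)" .
qed

text \<open>The cosine of the angle separates the points of [-h, h], so its polynomials are
  uniformly dense by Stone-Weierstrass. The orthogonality relations show that \<open>G\<close> times
  the sine is orthogonal to all of them.\<close>

lemma sine_orthogonal_imp_zero:
  fixes G :: "real \<Rightarrow> real"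
  assumes h: "0 < h" and G: "continuous_on {-h..h} G"
    and orth: "\<And>q::nat. (\<integral>x. G x * sin (real q * angle h x) \<partial>Mh h) = 0" and x: "x \<in> {-h<..<h}"
  shows "G x = 0"
proof -
  let ?t = "angle h"
  \<comment> \<open>Induction on the power for all q at once: cos \<theta> sin q\<theta> is half the
    sum of sin (q + 1)\<theta> and sin (q - 1)\<theta>, and q = 0 is trivial.\<close>
  have pw: "(\<integral>x. G x * (cos (?t x) ^ j * sin (real q * ?t x)) \<partial>Mh h) = 0" for j q :: nat
  proof (induction j arbitrary: q)
    case 0
    then show ?case using orth by simp
  next
    case (Suc j)
    note IH = Suc.IH
    show ?case
    proof (cases q)
      case 0
      then show ?thesis by simp
    next
      case (Suc p)
      let ?A = "\<lambda>r x. G x * (cos (?t x) ^ j * sin (real r * ?t x))"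
      have i: "integrable (Mh h) (?A r)" for r by (intro integrable_Mh_continuous continuous_intros G)
      have pt: "G x * (cos (?t x) ^ Suc j * sin (real q * ?t x)) = (1/2) * (?A (Suc q) x + ?A p x)" for x
      proof -
        have "sin (real (Suc q) * ?t x) + sin (real p * ?t x) = 2 * (cos (?t x) * sin (real q * ?t x))"
        proof -
          have e: "real (Suc q) * ?t x = real q * ?t x + ?t x" "real p * ?t x = real q * ?t x - ?t x"
            using Suc by (auto simp: algebra_simps)
          show ?thesis unfolding e sin_add sin_diff by simp
        qed
        then have "(1/2) * (?A (Suc q) x + ?A p x) = (1/2) * (G x * cos (?t x) ^ j) * (2 * (cos (?t x) * sin (real q * ?t x)))"
          by (simp only: mult.assoc distrib_left[symmetric])
        then show ?thesis by (simp add: ac_simps)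
      qed
      have "(\<integral>x. G x * (cos (?t x) ^ Suc j * sin (real q * ?t x)) \<partial>Mh h) = (1/2) * ((\<integral>x. ?A (Suc q) x \<partial>Mh h) + (\<integral>x. ?A p x \<partial>Mh h))"
        unfolding pt using i by (simp only: integral_mult_right_zero Bochner_Integration.integral_add)
      then show ?thesis unfolding IH by simp
    qed
  qed
  \<comment> \<open>The case q = 1 gives orthogonality to pure powers of the cosine. The sine factor
    is removed at the end, being positive in the open interval.\<close>
  define F where "F x = G x * sin (?t x)" for x
  have Fc: "continuous_on {-h..h} F" unfolding F_def by (intro continuous_intros G)
  have Fpow: "(\<integral>x. F x * cos (?t x) ^ j \<partial>Mh h) = 0" for j
    using pw[of j 1] by (simp add: F_def ac_simps)
  let ?R = "{f. \<exists>p. real_polynomial_function p \<and> f = (\<lambda>x. p (cos (?t x)))}"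
  interpret R: function_ring_on ?R "{-h..h}"
  proof
    fix f assume "f \<in> ?R"
    then obtain p where p: "real_polynomial_function p" "f = (\<lambda>x. p (cos (?t x)))" by blast
    have "continuous_on UNIV p" using p(1) by (metis continuous_on_polymonial_function real_polynomial_function_eq)
    then show "continuous_on {-h..h} f" unfolding p(2)
      by (rule continuous_on_compose2) (auto intro!: continuous_intros)
  next
    fix f g assume "f \<in> ?R" "g \<in> ?R"
    then obtain p q where pq: "real_polynomial_function p" "f = (\<lambda>x. p (cos (?t x)))" "real_polynomial_function q" "g = (\<lambda>x. q (cos (?t x)))" by blast
    show "(\<lambda>x. f x + g x) \<in> ?R"
      using real_polynomial_function.intros(3)[OF pq(1,3)] pq by (intro CollectI exI[of _ "\<lambda>x. p x + q x"]) auto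
    show "(\<lambda>x. f x * g x) \<in> ?R"
      using real_polynomial_function.intros(4)[OF pq(1,3)] pq by (intro CollectI exI[of _ "\<lambda>x. p x * q x"]) auto
  next
    fix u v assume uv: "u \<in> {-h..h}" "v \<in> {-h..h}" "u \<noteq> v"
    have "?t u \<noteq> ?t v" using uv h by (simp add: angle_def)
    then have "cos (?t u) \<noteq> cos (?t v)" using angle_bounds[OF h uv(1)] angle_bounds[OF h uv(2)] cos_inj_pi by metis
    then show "\<exists>f\<in>?R. f u \<noteq> f v"
      by (intro bexI[of _ "\<lambda>x. cos (?t x)"] CollectI exI[of _ "\<lambda>x. x"] conjI
          real_polynomial_function.intros(1) bounded_linear_ident refl)
  next
    fix c :: real
    show "(\<lambda>_. c) \<in> ?R" by (intro CollectI exI[of _ "\<lambda>x. c"] conjI real_polynomial_function.intros(2) refl)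
  qed auto
  have orthR: "(\<integral>x. F x * g x \<partial>Mh h) = 0" if gR: "g \<in> ?R" for g
  proof -
    obtain p where p: "real_polynomial_function p" "g = (\<lambda>x. p (cos (?t x)))" using gR by blast
    obtain a n where a: "p = (\<lambda>x. \<Sum>i\<le>n. a i * x ^ i)" using p(1)[unfolded real_polynomial_function_iff_sum] by blast
    have "(\<integral>x. F x * g x \<partial>Mh h) = (\<integral>x. (\<Sum>i\<le>n::nat. a i * (F x * cos (?t x) ^ i)) \<partial>Mh h)"
      by (rule Bochner_Integration.integral_cong) (auto simp: p(2) a sum_distrib_left ac_simps)
    also have "\<dots> = (\<Sum>i\<le>n. \<integral>x. a i * (F x * cos (?t x) ^ i) \<partial>Mh h)"
      by (rule Bochner_Integration.integral_sum) (intro integrable_Mh_continuous continuous_intros Fc)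
    also have "\<dots> = 0" by (simp add: Fpow)
    finally show ?thesis .
  qed
  let ?S = "\<integral>x. F x * F x \<partial>Mh h" and ?N = "\<integral>x. \<bar>F x\<bar> \<partial>Mh h"
  have Fi: "integrable (Mh h) (\<lambda>x. F x * F x)" "integrable (Mh h) (\<lambda>x. \<bar>F x\<bar>)"
    by (intro integrable_Mh_continuous continuous_intros Fc)+
  have N0: "0 \<le> ?N" by (rule Bochner_Integration.integral_nonneg) simp
  \<comment> \<open>By orthogonality the integral of F^2 equals that of F (F - g) for every g in the
    ring; g is taken within e of F.\<close>
  have small: "?S \<le> e * ?N" if e: "0 < e" for e
  proof -
    obtain g where g: "g \<in> ?R" "\<And>x. x \<in> {-h..h} \<Longrightarrow> \<bar>F x - g x\<bar> < e" using R.Stone_Weierstrass_basic[OF Fc e] by blast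
    have gc: "continuous_on {-h..h} g" by (rule R.continuous[OF g(1)])
    have "?S = (\<integral>x. F x * F x \<partial>Mh h) - (\<integral>x. F x * g x \<partial>Mh h)" using orthR[OF g(1)] by simp
    also have "\<dots> = (\<integral>x. F x * F x - F x * g x \<partial>Mh h)"
      by (rule Bochner_Integration.integral_diff[symmetric]) (intro integrable_Mh_continuous continuous_intros Fc gc)+
    also have "\<dots> \<le> (\<integral>x. e * \<bar>F x\<bar> \<partial>Mh h)"
    proof (rule integral_mono)
      show "integrable (Mh h) (\<lambda>x. F x * F x - F x * g x)" "integrable (Mh h) (\<lambda>x. e * \<bar>F x\<bar>)"
        by (intro integrable_Mh_continuous continuous_intros Fc gc)+
      fix x assume "x \<in> space (Mh h)"
      then have "\<bar>F x - g x\<bar> \<le> e" using g(2)[of x] by auto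
      then have "\<bar>F x\<bar> * \<bar>F x - g x\<bar> \<le> \<bar>F x\<bar> * e" by (intro mult_left_mono) auto
      then show "F x * F x - F x * g x \<le> e * \<bar>F x\<bar>"
        using abs_ge_self[of "F x * (F x - g x)", unfolded abs_mult] unfolding right_diff_distrib by (simp only: mult.commute[of e])
    qed
    also have "\<dots> = e * ?N" by simp
    finally show ?thesis .
  qed
  have "?S \<le> 0 + e" if "0 < e" for e
  proof -
    have *: "0 < e / (N + 1)" "e / (N + 1) * N \<le> e" if "0 \<le> N" for N
      using that \<open>0 < e\<close> by (auto simp: field_simps)
    show ?thesis using small[OF *(1)[OF N0]] *(2)[OF N0] by linarith
  qed
  then have "?S \<le> 0" by (rule field_le_epsilon)
  moreover have "0 \<le> ?S" by (rule Bochner_Integration.integral_nonneg) simp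
  ultimately have "?S = 0" by simp
  then have "AE x in Mh h. F x * F x = 0" by (subst (asm) integral_nonneg_eq_0_iff_AE[OF Fi(1)]) auto
  then have "AE x in Mh h. F x = 0" by eventually_elim simp
  then have "F x = 0" using continuous_AE_eq_imp_eq[OF Fc continuous_on_const _ h, of 0 x] x by auto
  moreover have "sin (?t x) > 0"
  proof (rule sin_gt_zero)
    show "0 < ?t x" "?t x < pi" using x h by (auto simp: angle_def divide_less_eq)
  qed
  ultimately show ?thesis by (simp add: F_def)
qed

text \<open>Uniform approximation needs a continuous function, so \<open>g\<close> is replaced by
  its primitive \<open>G\<close>. Integration by parts turns orthogonality of \<open>g\<close> to
  cosines into orthogonality of \<open>G\<close> to sines.\<close>

lemma cosine_orthogonal_imp_AE_zero_real:
  fixes g :: "real \<Rightarrow> real"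
  assumes h: "0 < h" and g: "integrable (Mh h) g"
    and orth: "\<And>q::nat. (\<integral>x. g x * cos (real q * angle h x) \<partial>Mh h) = 0"
  shows "AE x in Mh h. g x = 0"
proof -
  define G where "G x = 0 + (\<integral>t. indicator {..x} t *\<^sub>R g t \<partial>Mh h)" for x
  have P: "primitive h G g" unfolding G_def by (rule primitive_indefinite[OF g])
  have Gl: "G (-h) = 0"
  proof -
    have "G (-h) = (\<integral>t. 0 \<partial>Mh h)" unfolding G_def add_0 by (rule Bochner_Integration.integral_cong) (auto simp: indicator_def)
    then show ?thesis by simp
  qed
  \<comment> \<open>Orthogonality to the constant cosine, q = 0, makes the primitive vanish at the
    right end as well, so the integration by parts has no boundary terms.\<close>
  have Gr: "G h = 0" using primitive_total[OF P h] orth[of 0] Gl by simp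
  have Gc: "continuous_on {-h..h} G" by (rule primitive_continuous[OF P])
  have orthS: "(\<integral>x. G x * sin (real q * angle h x) \<partial>Mh h) = 0" for q :: nat
  proof (cases "q = 0")
    case False
    let ?c = "- (real q * pi / (2 * h))"
    note B = primitive_bilinear[OF bounded_bilinear_mult P primitive_cos_angle[OF h, of "real q"]]
    have i: "integrable (Mh h) (\<lambda>x. g x * cos (real q * angle h x))"
      by (rule integrable_bilinear_continuous[OF bounded_bilinear_mult g]) (intro continuous_intros)
    have i2: "integrable (Mh h) (\<lambda>x. G x * (?c * sin (real q * angle h x)))"
      by (intro integrable_Mh_continuous continuous_intros Gc)
    have "0 = (\<integral>x. g x * cos (real q * angle h x) + G x * (?c * sin (real q * angle h x)) \<partial>Mh h)"
      using primitive_total[OF B h] Gl Gr by simp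
    also have "\<dots> = (\<integral>x. G x * (?c * sin (real q * angle h x)) \<partial>Mh h)"
      by (simp only: Bochner_Integration.integral_add[OF i i2] orth[of q] add_0)
    also have "\<dots> = (\<integral>x. ?c * (G x * sin (real q * angle h x)) \<partial>Mh h)" by (simp add: ac_simps)
    also have "\<dots> = ?c * (\<integral>x. G x * sin (real q * angle h x) \<partial>Mh h)" by (rule integral_mult_right_zero)
    finally show ?thesis using False h by simp
  qed simp
  have "G x = 0" if "x \<in> {-h..h}" for x
    using sine_orthogonal_imp_zero[OF h Gc orthS, of x] that Gl Gr by (cases "x = -h \<or> x = h") auto
  then show ?thesis by (rule primitive_zero_imp_AE_zero[OF P _ h])
qed

lemma cosine_orthogonal_imp_AE_zero:
  fixes g :: "real \<Rightarrow> complex"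
  assumes h: "0 < h" and g: "integrable (Mh h) g"
    and orth: "\<And>q::nat. (\<integral>x. g x * complex_of_real (cos (real q * angle h x)) \<partial>Mh h) = 0"
  shows "AE x in Mh h. g x = 0"
proof -
  have i: "integrable (Mh h) (\<lambda>x. g x * complex_of_real (cos (real q * angle h x)))" for q :: nat
    by (rule integrable_bilinear_continuous[OF bounded_bilinear_mult g]) (intro continuous_intros)
  have "AE x in Mh h. Re (g x) = 0"
  proof (rule cosine_orthogonal_imp_AE_zero_real[OF h])
    show "integrable (Mh h) (\<lambda>x. Re (g x))" using g by simp
    show "(\<integral>x. Re (g x) * cos (real q * angle h x) \<partial>Mh h) = 0" for q
      using arg_cong[OF orth[of q], of Re] i[of q] by (simp flip: integral_Re)
  qed
  moreover have "AE x in Mh h. Im (g x) = 0"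
  proof (rule cosine_orthogonal_imp_AE_zero_real[OF h])
    show "integrable (Mh h) (\<lambda>x. Im (g x))" using g by simp
    show "(\<integral>x. Im (g x) * cos (real q * angle h x) \<partial>Mh h) = 0" for q
      using arg_cong[OF orth[of q], of Im] i[of q] by (simp flip: integral_Im)
  qed
  ultimately show ?thesis by eventually_elim (simp add: complex_eq_iff)
qed


section \<open>Absolutely continuous representatives and six-component coordinates\<close>

lemma sq_integrable_cong_AE:
  fixes f :: "real \<Rightarrow> 'a::euclidean_space"
  assumes "sq_integrable h f" "AE x in Mh h. f x = g x"
  shows "sq_integrable h g"
proof -
  have "AE x in Mh h. (norm (f x))\<^sup>2 = (norm (g x))\<^sup>2" using assms(2) by eventually_elim simp
  note a = this
  have f: "f \<in> borel_measurable (Mh h)" "integrable (Mh h) (\<lambda>x. (norm (f x))\<^sup>2)" using assms(1) by (auto simp: sq_integrable_def)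
  show ?thesis unfolding sq_integrable_def
    by (rule conjI[OF borel_measurable_Mh_cong_AE[OF f(1) assms(2)] integrable_Mh_cong_AE[OF f(2) a]])
qed

lemma wd_spec:
  assumes "f \<in> H1 h"
  shows "sq_integrable h (wd h f)" "weak_deriv h f (wd h f)"
proof -
  have "\<exists>g. g \<in> L2 h \<and> weak_deriv h f g" using assms by (auto simp: H1_def)
  from someI_ex[OF this] show "sq_integrable h (wd h f)" "weak_deriv h f (wd h f)"
    unfolding wd_def by (auto simp: L2_iff_sq_integrable)
qed

lemma H1_imp_sq_integrable: "f \<in> H1 h \<Longrightarrow> sq_integrable h f"
  by (simp add: H1_def L2_iff_sq_integrable)

lemma H1_primitive:
  assumes "f \<in> H1 h" "0 < h"
  shows "\<exists>F. primitive h F (wd h f) \<and> (AE x in Mh h. f x = F x)"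
  by (rule weak_deriv_imp_primitive[OF wd_spec(2)[OF assms(1)] sq_integrable_imp_integrable[OF wd_spec(1)[OF assms(1)]] assms(2)])

text \<open>The chosen derivative \<open>wd\<close> is known only up to a null set, hence the form
  of the third conclusion.\<close>

lemma H1_of_primitive:
  assumes h: "0 < h" and p: "primitive h F G" and G: "sq_integrable h G" and f: "AE x in Mh h. f x = F x"
  shows "f \<in> H1 h" "weak_deriv h f G" "AE x in Mh h. wd h f x = G x"
proof -
  have f': "AE x in Mh h. F x = f x" using f by eventually_elim simp
  show w: "weak_deriv h f G"
    by (rule weak_deriv_cong_AE[OF weak_deriv_of_primitive[OF p h] f']) simp
  have "sq_integrable h f" by (rule sq_integrable_cong_AE[OF sq_integrable_continuous[OF primitive_continuous[OF p]] f'])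
  then show H: "f \<in> H1 h" using w G by (auto simp: H1_def L2_iff_sq_integrable)
  show "AE x in Mh h. wd h f x = G x" by (rule weak_deriv_unique[OF wd_spec(2)[OF H] w])
qed

definition cvec2 :: "complex \<Rightarrow> complex \<Rightarrow> cvec" where "cvec2 a b = (\<chi> i. if i = 1 then a else b)"

lemma cvec2_nth [simp]: "cvec2 a b $ 1 = a" "cvec2 a b $ 2 = b" by (simp_all add: cvec2_def)

lemma cvec2_eq_iff: "v = cvec2 a b \<longleftrightarrow> v $ 1 = a \<and> v $ 2 = b" by (auto simp: vec_eq_iff forall_2)

lemma bounded_linear_cvec2: "bounded_linear (\<lambda>a. cvec2 a 0)" "bounded_linear (\<lambda>b. cvec2 0 b)"
  by (auto intro!: linearI simp: linear_conv_bounded_linear[symmetric] vec_eq_iff forall_2)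

lemma cvec2_split: "cvec2 a b = cvec2 a 0 + cvec2 0 b" by (simp add: vec_eq_iff forall_2)

lemma primitive_cvec2:
  assumes "primitive h f f'" "primitive h g g'"
  shows "primitive h (\<lambda>x. cvec2 (f x) (g x)) (\<lambda>x. cvec2 (f' x) (g' x))"
  using primitive_add[OF primitive_bounded_linear[OF assms(1) bounded_linear_cvec2(1)]
        primitive_bounded_linear[OF assms(2) bounded_linear_cvec2(2)]]
  by (simp only: cvec2_split[symmetric])

lemma sq_integrable_cvec2:
  assumes "sq_integrable h f" "sq_integrable h g"
  shows "sq_integrable h (\<lambda>x. cvec2 (f x) (g x))"
  using sq_integrable_add[OF sq_integrable_bounded_linear[OF assms(1) bounded_linear_cvec2(1)]
        sq_integrable_bounded_linear[OF assms(2) bounded_linear_cvec2(2)]]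
  by (simp only: cvec2_split[symmetric])

text \<open>The isometry from V x H into six scalar L^2 functions: U1, its derivative, U2, two
  components each. The order is that of the data \<open>d 0\<close> to \<open>d 5\<close> in the
  first-order system; indices above 5 repeat the last component.\<close>

definition coords :: "real \<Rightarrow> hpair \<Rightarrow> nat \<Rightarrow> real \<Rightarrow> complex" where
  "coords h U j x = (if j = 0 then fst U x $ 1 else if j = 1 then fst U x $ 2
     else if j = 2 then wd h (fst U) x $ 1 else if j = 3 then wd h (fst U) x $ 2
     else if j = 4 then snd U x $ 1 else snd U x $ 2)"

lemma coords_sq_integrable:
  assumes "U \<in> Hspace h"
  shows "sq_integrable h (coords h U j)"
proof -
  have "sq_integrable h (fst U)" "sq_integrable h (wd h (fst U))" "sq_integrable h (snd U)"
    using assms wd_spec(1) H1_imp_sq_integrable by (auto simp: Hspace_def L2_iff_sq_integrable)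
  then have "sq_integrable h (\<lambda>x. fst U x $ i)" "sq_integrable h (\<lambda>x. wd h (fst U) x $ i)" "sq_integrable h (\<lambda>x. snd U x $ i)" for i
    by (auto intro: sq_integrable_bounded_linear bounded_linear_vec_nth)
  moreover have "coords h U j = (if j = 0 then (\<lambda>x. fst U x $ 1) else if j = 1 then (\<lambda>x. fst U x $ 2)
     else if j = 2 then (\<lambda>x. wd h (fst U) x $ 1) else if j = 3 then (\<lambda>x. wd h (fst U) x $ 2)
     else if j = 4 then (\<lambda>x. snd U x $ 1) else (\<lambda>x. snd U x $ 2))"
    by (auto simp: coords_def)
  ultimately show ?thesis by auto
qed

lemma H_inner_coords:
  assumes "U \<in> Hspace h" "V \<in> Hspace h"
  shows "H_inner h U V = (\<integral>x. (\<Sum>j<6. coords h U j x * cnj (coords h V j x)) \<partial>Mh h)"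
proof -
  let ?c = "\<lambda>j x. coords h U j x * cnj (coords h V j x)"
  have i: "integrable (Mh h) (?c j)" for j
    by (rule sq_integrable_mult_cnj[OF coords_sq_integrable[OF assms(1)] coords_sq_integrable[OF assms(2)]])
  have "L2_inner h (fst U) (fst V) = (\<integral>x. ?c 0 x \<partial>Mh h) + (\<integral>x. ?c 1 x \<partial>Mh h)"
    "L2_inner h (wd h (fst U)) (wd h (fst V)) = (\<integral>x. ?c 2 x \<partial>Mh h) + (\<integral>x. ?c 3 x \<partial>Mh h)"
    "L2_inner h (snd U) (snd V) = (\<integral>x. ?c 4 x \<partial>Mh h) + (\<integral>x. ?c 5 x \<partial>Mh h)"
    unfolding L2_inner_def cdot_def sum_2
    by (subst Bochner_Integration.integral_add[OF i i, symmetric], simp add: coords_def)+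
  then have "H_inner h U V = (\<Sum>j<6. \<integral>x. ?c j x \<partial>Mh h)"
    unfolding H_inner_def H1_inner_def sum_lessThan_6 by simp
  also have "\<dots> = (\<integral>x. (\<Sum>j<6. ?c j x) \<partial>Mh h)"
    by (rule Bochner_Integration.integral_sum[symmetric]) (rule i)
  finally show ?thesis .
qed

lemma H_norm_coords:
  assumes "U \<in> Hspace h"
  shows "H_norm h U = sqrt (sq_energy h 6 (coords h U))"
proof -
  have "H_inner h U U = (\<integral>x. complex_of_real (\<Sum>j<6. (cmod (coords h U j x))\<^sup>2) \<partial>Mh h)"
    unfolding H_inner_coords[OF assms assms] by (simp add: complex_norm_square[symmetric])
  also have "\<dots> = complex_of_real (sq_energy h 6 (coords h U))"
    unfolding sq_energy_def by (rule integral_complex_of_real)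
  finally show ?thesis by (simp add: H_norm_def)
qed

lemma sq_energy_cong_AE:
  assumes "AE x in Mh h. \<forall>j<n. d j x = d' j x"
  shows "sq_energy h n d = sq_energy h n d'"
  unfolding sq_energy_def by (rule integral_Mh_cong_AE) (use assms in eventually_elim, auto)

text \<open>Cosines are orthogonal in both \<open>L\<^sup>2\<close> and \<open>H\<^sup>1\<close>; the basis element with index
  \<open>n = 4 q + i\<close> is the \<open>q\<close>-th cosine in the \<open>i\<close>-th component of \<open>V \<times> H\<close>.\<close>
definition basis_coords :: "real \<Rightarrow> nat \<Rightarrow> nat \<Rightarrow> real \<Rightarrow> real" where
  "basis_coords h n j x = (let q = n div 4; i = n mod 4; c = real q * pi / (2 * h);
      \<alpha> = 1 / sqrt ((1 + c\<^sup>2) * cos_norm h q) in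
     (if i < 2 \<and> j = i then \<alpha> else if 2 \<le> i \<and> j = i + 2 then 1 / sqrt (cos_norm h q) else 0) * cos (real q * angle h x)
     + (if i < 2 \<and> j = i + 2 then - \<alpha> * c else 0) * sin (real q * angle h x))"

definition cosine_basis :: "real \<Rightarrow> nat \<Rightarrow> hpair" where
  "cosine_basis h n = ((\<lambda>x. cvec2 (basis_coords h n 0 x) (basis_coords h n 1 x)),
     (\<lambda>x. cvec2 (basis_coords h n 4 x) (basis_coords h n 5 x)))"

lemma continuous_basis_coords: "continuous_on S (basis_coords h n j)"
  unfolding basis_coords_def[abs_def] Let_def by (intro continuous_intros)

lemma primitive_basis_coords:
  assumes "0 < h"
  shows "primitive h (basis_coords h n 0) (basis_coords h n 2)" "primitive h (basis_coords h n 1) (basis_coords h n 3)"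
proof -
  let ?q = "real (n div 4)"
  have *: "primitive h (\<lambda>x. k * cos (?q * angle h x) + 0 * sin (?q * angle h x)) (\<lambda>x. 0 * cos (?q * angle h x) + (- k * (?q * pi / (2 * h))) * sin (?q * angle h x))" for k
    using primitive_cmult[OF primitive_cos_angle[OF assms, of ?q], of k] by (simp add: ac_simps)
  have i: "n mod 4 = 0 \<or> n mod 4 = 1 \<or> n mod 4 = 2 \<or> n mod 4 = 3" by auto
  have z: "primitive h (\<lambda>x::real. 0::real) (\<lambda>x. 0)" by (rule primitive_const)
  show "primitive h (basis_coords h n 0) (basis_coords h n 2)" "primitive h (basis_coords h n 1) (basis_coords h n 3)"
    unfolding basis_coords_def[abs_def] Let_def
    using i *[of "1 / sqrt ((1 + (?q * pi / (2 * h))\<^sup>2) * cos_norm h (n div 4))"] z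
    by (elim disjE; simp)+
qed

lemma cosine_basis_coords:
  assumes h: "0 < h"
  shows "cosine_basis h n \<in> Hspace h"
    and "AE x in Mh h. \<forall>j<6. coords h (cosine_basis h n) j x = complex_of_real (basis_coords h n j x)"
proof -
  let ?b = "\<lambda>j x. complex_of_real (basis_coords h n j x)"
  have p: "primitive h (\<lambda>x. cvec2 (?b 0 x) (?b 1 x)) (\<lambda>x. cvec2 (?b 2 x) (?b 3 x))"
    by (intro primitive_cvec2 primitive_bounded_linear[OF _ bounded_linear_of_real] primitive_basis_coords[OF h])
  have c: "sq_integrable h (\<lambda>x. cvec2 (?b i x) (?b j x))" for i j
    by (intro sq_integrable_cvec2 sq_integrable_continuous continuous_on_of_real continuous_basis_coords)
  have ae: "AE x in Mh h. fst (cosine_basis h n) x = cvec2 (?b 0 x) (?b 1 x)" by (simp add: cosine_basis_def)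
  note H = H1_of_primitive[OF h p c ae]
  show "cosine_basis h n \<in> Hspace h"
    using H(1) c by (auto simp: Hspace_def cosine_basis_def L2_iff_sq_integrable)
  show "AE x in Mh h. \<forall>j<6. coords h (cosine_basis h n) j x = ?b j x"
    using H(3)
  proof eventually_elim
    case (elim x)
    show ?case
    proof (intro allI impI)
      fix j :: nat assume "j < 6"
      then have "j = 0 \<or> j = 1 \<or> j = 2 \<or> j = 3 \<or> j = 4 \<or> j = 5" by auto
      then show "coords h (cosine_basis h n) j x = ?b j x"
        using elim by (elim disjE) (simp_all add: coords_def, simp_all add: cosine_basis_def)
    qed
  qed
qed

lemma cos_norm_pos: "0 < h \<Longrightarrow> 0 < cos_norm h q" by (simp add: cos_norm_def)

text \<open>Different components have disjoint coordinates. Within a component of V the inner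
  product combines cosines with their derivatives, which are multiples of sines with the same
  orthogonality; this gives the normalization (1 + c^2) times the squared norm of the
  cosine.\<close>

lemma cosine_basis_orthonormal:
  assumes h: "0 < h"
  shows "H_inner h (cosine_basis h m) (cosine_basis h n) = (if m = n then 1 else 0)"
proof -
  let ?b = "basis_coords h"
  let ?p = "m div 4" and ?q = "n div 4"
  let ?c = "\<lambda>q. real q * pi / (2 * h)"
  let ?\<alpha> = "\<lambda>q. 1 / sqrt ((1 + (?c q)\<^sup>2) * cos_norm h q)"
  let ?C = "\<lambda>x. cos (real ?p * angle h x) * cos (real ?q * angle h x)"
  let ?S = "\<lambda>x. sin (real ?p * angle h x) * sin (real ?q * angle h x)"
  have iC: "integrable (Mh h) ?C" "integrable (Mh h) ?S" by (intro integrable_Mh_continuous continuous_intros)+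
  have "H_inner h (cosine_basis h m) (cosine_basis h n)
      = (\<integral>x. (\<Sum>j<6. coords h (cosine_basis h m) j x * cnj (coords h (cosine_basis h n) j x)) \<partial>Mh h)"
    by (rule H_inner_coords[OF cosine_basis_coords(1)[OF h] cosine_basis_coords(1)[OF h]])
  also have "\<dots> = (\<integral>x. complex_of_real (\<Sum>j<6. ?b m j x * ?b n j x) \<partial>Mh h)"
    by (rule integral_Mh_cong_AE) (use cosine_basis_coords(2)[OF h, of m] cosine_basis_coords(2)[OF h, of n] in eventually_elim, simp)
  also have "\<dots> = complex_of_real (\<integral>x. (\<Sum>j<6. ?b m j x * ?b n j x) \<partial>Mh h)" by (rule integral_complex_of_real)
  also have "(\<integral>x. (\<Sum>j<6. ?b m j x * ?b n j x) \<partial>Mh h) = (if m = n then 1 else 0)"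
  proof (cases "m mod 4 = n mod 4")
    case False
    have "(\<Sum>j<6. ?b m j x * ?b n j x) = 0" for x
      by (rule sum.neutral) (use False in \<open>auto simp: basis_coords_def Let_def\<close>)
    then show ?thesis using False by auto
  next
    case True
    have mn: "m = n \<longleftrightarrow> ?p = ?q" using True by (metis div_mult_mod_eq)
    have i4: "n mod 4 < 4" by simp
    show ?thesis
    proof (cases "n mod 4 < 2")
      case lt: True
      then have i: "n mod 4 = 0 \<or> n mod 4 = 1" by auto
      have "(\<Sum>j<6. ?b m j x * ?b n j x) = (?\<alpha> ?p * ?\<alpha> ?q) * ?C x + (?\<alpha> ?p * ?\<alpha> ?q * ?c ?p * ?c ?q) * ?S x" for x
      proof -
        define \<alpha>p \<alpha>q cp cq where "\<alpha>p = ?\<alpha> ?p" and "\<alpha>q = ?\<alpha> ?q" and "cp = ?c ?p" and "cq = ?c ?q"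
        note defs = this[symmetric]
        show ?thesis using i True unfolding sum_lessThan_6 basis_coords_def Let_def defs
          by (elim disjE) simp_all
      qed
      then have "(\<integral>x. (\<Sum>j<6. ?b m j x * ?b n j x) \<partial>Mh h) = (?\<alpha> ?p * ?\<alpha> ?q) * (\<integral>x. ?C x \<partial>Mh h) + (?\<alpha> ?p * ?\<alpha> ?q * ?c ?p * ?c ?q) * (\<integral>x. ?S x \<partial>Mh h)"
        by (simp only: Bochner_Integration.integral_add[OF integrable_mult_right[OF iC(1)] integrable_mult_right[OF iC(2)]] integral_mult_right_zero)
      also have "\<dots> = (if ?p = ?q then 1 else 0)"
      proof (cases "?p = ?q")
        case pq: True
        have pos: "0 < (1 + (?c ?q)\<^sup>2) * cos_norm h ?q" using cos_norm_pos[OF h] by (intro mult_pos_pos add_pos_nonneg) auto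
        have aa: "?\<alpha> ?q * ?\<alpha> ?q = 1 / ((1 + (?c ?q)\<^sup>2) * cos_norm h ?q)" using pos by (simp only: times_divide_times_eq mult_1 real_sqrt_mult_self abs_of_pos)
        \<comment> \<open>For q = 0 the sine integral is 0 and not \<open>cos_norm\<close>, but then
          c = 0 and both sides vanish.\<close>
        have "(\<integral>x. ?S x \<partial>Mh h) * (?c ?q)\<^sup>2 = (?c ?q)\<^sup>2 * cos_norm h ?q"
          unfolding integral_cos_cos(2)[OF h] using pq by (simp add: cos_norm_def)
        moreover have "A * A * N + A * A * c * c * S = 1" if "A * A = 1 / ((1 + c\<^sup>2) * N)" "0 < (1 + c\<^sup>2) * N" "S * c\<^sup>2 = c\<^sup>2 * N" for A c N S :: real
        proof -
          have "A * A * N + A * A * c * c * S = A * A * (N + S * c\<^sup>2)" by (simp add: power2_eq_square algebra_simps)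
          also have "\<dots> = A * A * ((1 + c\<^sup>2) * N)" using that(3) by (simp add: algebra_simps)
          also have "\<dots> = 1" unfolding that(1) by (rule nonzero_eq_divide_eq[THEN iffD1, OF less_imp_neq[OF that(2), symmetric] refl])
          finally show ?thesis .
        qed
        ultimately have "?\<alpha> ?q * ?\<alpha> ?q * cos_norm h ?q + ?\<alpha> ?q * ?\<alpha> ?q * ?c ?q * ?c ?q * (\<integral>x. ?S x \<partial>Mh h) = 1"
          using aa pos by blast
        then show ?thesis unfolding integral_cos_cos(1)[OF h] using pq by (simp only: if_True simp_thms)
      next
        case False
        then show ?thesis unfolding integral_cos_cos[OF h] by simp
      qed
      finally show ?thesis using mn by simp
    next
      case ge: False
      then have i: "n mod 4 = 2 \<or> n mod 4 = 3" using i4 by linarith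
      have "(\<Sum>j<6. ?b m j x * ?b n j x) = (1 / sqrt (cos_norm h ?p) * (1 / sqrt (cos_norm h ?q))) * ?C x" for x
        using i True by (elim disjE) (simp_all add: sum_lessThan_6 basis_coords_def Let_def)
      then have "(\<integral>x. (\<Sum>j<6. ?b m j x * ?b n j x) \<partial>Mh h) = (1 / sqrt (cos_norm h ?p) * (1 / sqrt (cos_norm h ?q))) * (\<integral>x. ?C x \<partial>Mh h)"
        by (simp only: integral_mult_right_zero)
      also have "\<dots> = (if ?p = ?q then 1 else 0)"
        unfolding integral_cos_cos[OF h] using cos_norm_pos[OF h, of ?q] by (simp add: abs_of_pos)
      finally show ?thesis using mn by simp
    qed
  qed
  finally show ?thesis by simp
qed

text \<open>In the second factor orthogonality is already orthogonality to cosines in L^2. In the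
  first, integrating by parts in the derivative term gives (1 + c^2) times the cosine coefficient of
  u, with c = q pi / (2 h). So u vanishes by the L^2 result, and with it its derivative.\<close>

lemma cosine_basis_complete:
  assumes h: "0 < h" and y: "y \<in> Hspace h" and orth: "\<And>n. H_inner h y (cosine_basis h n) = 0"
  shows "H_norm h y = 0"
proof -
  let ?D = "coords h y"
  let ?cs = "\<lambda>q x. complex_of_real (cos (real q * angle h x))"
  have cancel: "v = 0" if "u * v = 0" "u \<noteq> 0" for u v :: complex using that by simp
  have Di: "integrable (Mh h) (?D j)" for j by (rule sq_integrable_imp_integrable[OF coords_sq_integrable[OF y]])
  have zero: "(\<integral>x. (\<Sum>j<6. ?D j x * complex_of_real (basis_coords h n j x)) \<partial>Mh h) = 0" for n
  proof -
    have "(\<integral>x. (\<Sum>j<6. ?D j x * complex_of_real (basis_coords h n j x)) \<partial>Mh h) = H_inner h y (cosine_basis h n)"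
      unfolding H_inner_coords[OF y cosine_basis_coords(1)[OF h]]
      by (rule integral_Mh_cong_AE) (use cosine_basis_coords(2)[OF h, of n] in eventually_elim, simp)
    then show ?thesis using orth by simp
  qed
  have second: "AE x in Mh h. ?D j x = 0" if j: "j = 4 \<or> j = 5" for j
  proof (rule cosine_orthogonal_imp_AE_zero[OF h Di])
    fix q :: nat
    let ?n = "4 * q + (j - 2)"
    have dm: "?n div 4 = q" "?n mod 4 = j - 2" using j by auto
    have "(\<Sum>j<6. ?D j x * complex_of_real (basis_coords h ?n j x)) = complex_of_real (1 / sqrt (cos_norm h q)) * (?D j x * ?cs q x)" for x
      using j unfolding sum_lessThan_6 basis_coords_def Let_def dm by (elim disjE) (simp_all add: ac_simps)
    with zero[of ?n] have "complex_of_real (1 / sqrt (cos_norm h q)) * (\<integral>x. ?D j x * ?cs q x \<partial>Mh h) = 0"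
      by (simp only: integral_mult_right_zero)
    moreover have "complex_of_real (1 / sqrt (cos_norm h q)) \<noteq> 0" using cos_norm_pos[OF h, of q] by simp
    ultimately show "(\<integral>x. ?D j x * ?cs q x \<partial>Mh h) = 0" by (rule cancel)
  qed
  have fy: "fst y \<in> H1 h" using y by (auto simp: Hspace_def)
  obtain F where F: "primitive h F (wd h (fst y))" "AE x in Mh h. fst y x = F x" using H1_primitive[OF fy h] by blast
  have first: "AE x in Mh h. ?D j x = 0 \<and> ?D (j + 2) x = 0" if j: "j = 0 \<or> j = 1" for j
  proof -
    define u where "u x = F x $ (if j = 0 then 1 else 2)" for x
    have uP: "primitive h u (?D (j + 2))"
    proof -
      have "(\<lambda>x. wd h (fst y) x $ (if j = 0 then 1 else 2)) = ?D (j + 2)" using j by (auto simp: coords_def)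
      then show ?thesis unfolding u_def using primitive_bounded_linear[OF F(1) bounded_linear_vec_nth[of "if j = 0 then 1 else 2"]] by simp
    qed
    have uD: "AE x in Mh h. ?D j x = u x" using F(2) by eventually_elim (use j in \<open>auto simp: coords_def u_def\<close>)
    have uc: "continuous_on {-h..h} u" by (rule primitive_continuous[OF uP])
    have "AE x in Mh h. u x = 0"
    proof (rule cosine_orthogonal_imp_AE_zero[OF h])
      show "integrable (Mh h) u" by (rule integrable_Mh_continuous[OF uc])
      fix q :: nat
      let ?n = "4 * q + j"
      let ?c = "real q * pi / (2 * h)"
      let ?sn = "\<lambda>x. complex_of_real (- ?c * sin (real q * angle h x))"
      define \<alpha> where "\<alpha> = 1 / sqrt ((1 + ?c\<^sup>2) * cos_norm h q)"
      have \<alpha>: "complex_of_real \<alpha> \<noteq> 0"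
      proof -
        have "0 < (1 + ?c\<^sup>2) * cos_norm h q" using cos_norm_pos[OF h] by (intro mult_pos_pos add_pos_nonneg) auto
        then have "0 < \<alpha>" unfolding \<alpha>_def by (simp only: zero_less_divide_1_iff real_sqrt_gt_0_iff)
        then show ?thesis by simp
      qed
      have dm: "?n div 4 = q" "?n mod 4 = j" using j by auto
      have "(\<Sum>j<6. ?D j x * complex_of_real (basis_coords h ?n j x)) = complex_of_real \<alpha> * (?D j x * ?cs q x + ?D (j + 2) x * ?sn x)" for x
        using j unfolding sum_lessThan_6 basis_coords_def Let_def dm \<alpha>_def[symmetric]
        by (elim disjE) (simp_all add: algebra_simps numeral_2_eq_2 numeral_3_eq_3)
      with zero[of ?n] have "complex_of_real \<alpha> * (\<integral>x. ?D j x * ?cs q x + ?D (j + 2) x * ?sn x \<partial>Mh h) = 0"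
        by (simp only: integral_mult_right_zero)
      then have z1: "(\<integral>x. ?D j x * ?cs q x + ?D (j + 2) x * ?sn x \<partial>Mh h) = 0" by (rule cancel[OF _ \<alpha>])
      have z2: "(\<integral>x. u x * ?cs q x + ?D (j + 2) x * ?sn x \<partial>Mh h) = 0"
      proof -
        have "(\<integral>x. u x * ?cs q x + ?D (j + 2) x * ?sn x \<partial>Mh h) = (\<integral>x. ?D j x * ?cs q x + ?D (j + 2) x * ?sn x \<partial>Mh h)"
          by (rule integral_Mh_cong_AE) (use uD in eventually_elim, simp)
        then show ?thesis using z1 by simp
      qed
      have "primitive h ?sn (\<lambda>x. complex_of_real (- ?c * (?c * cos (real q * angle h x))))"
        by (rule primitive_bounded_linear[OF primitive_cmult[OF primitive_sin_angle[OF h]] bounded_linear_of_real])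
      note B = primitive_bilinear[OF bounded_bilinear_mult uP this]
      \<comment> \<open>Vanishing of the sine at both ends removes the boundary term, whatever the
        boundary values of \<open>u\<close>.\<close>
      have sz: "sin (real q * pi) = 0" by (simp add: sin_npi)
      have z3: "(\<integral>x. ?D (j + 2) x * ?sn x + u x * complex_of_real (- ?c * (?c * cos (real q * angle h x))) \<partial>Mh h) = 0"
        using primitive_total[OF B h] h sz by (simp add: angle_ends)
      have i1: "integrable (Mh h) (\<lambda>x. u x * ?cs q x)" by (intro integrable_Mh_continuous continuous_intros uc)
      have i2: "integrable (Mh h) (\<lambda>x. ?D (j + 2) x * ?sn x)"
        by (rule integrable_bilinear_continuous[OF bounded_bilinear_mult Di]) (intro continuous_intros)
      have i3: "integrable (Mh h) (\<lambda>x. u x * complex_of_real (- ?c * (?c * cos (real q * angle h x))))"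
        by (intro integrable_Mh_continuous continuous_intros uc)
      have e3: "(\<integral>x. u x * complex_of_real (- ?c * (?c * cos (real q * angle h x))) \<partial>Mh h) = - complex_of_real (?c\<^sup>2) * (\<integral>x. u x * ?cs q x \<partial>Mh h)"
        unfolding integral_mult_right_zero[symmetric]
        by (rule Bochner_Integration.integral_cong) (auto simp: power2_eq_square)
      have elim_term: "complex_of_real (1 + e) * I = 0" if "I + K = 0" "K + - complex_of_real e * I = 0" for I K and e :: real
      proof -
        have "complex_of_real (1 + e) * I = (I + K) - (K + - complex_of_real e * I)" by (simp add: algebra_simps)
        then show ?thesis using that by simp
      qed
      have "(\<integral>x. u x * ?cs q x \<partial>Mh h) + (\<integral>x. ?D (j + 2) x * ?sn x \<partial>Mh h) = 0"
        using z2 by (simp only: Bochner_Integration.integral_add[OF i1 i2])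
      moreover have "(\<integral>x. ?D (j + 2) x * ?sn x \<partial>Mh h) + - complex_of_real (?c\<^sup>2) * (\<integral>x. u x * ?cs q x \<partial>Mh h) = 0"
        using z3 by (simp only: Bochner_Integration.integral_add[OF i2 i3] e3)
      ultimately have "complex_of_real (1 + ?c\<^sup>2) * (\<integral>x. u x * ?cs q x \<partial>Mh h) = 0"
        by (rule elim_term)
      moreover have "complex_of_real (1 + ?c\<^sup>2) \<noteq> 0"
      proof -
        have "1 + ?c\<^sup>2 > 0" by (intro add_pos_nonneg) auto
        then show ?thesis by (simp only: of_real_eq_0_iff)
      qed
      ultimately show "(\<integral>x. u x * ?cs q x \<partial>Mh h) = 0" by (rule cancel)
    qed
    then have u0: "u x = 0" if "x \<in> {-h..h}" for x
      using continuous_AE_eq_imp_eq[OF uc continuous_on_const _ h that] by blast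
    have "AE x in Mh h. ?D (j + 2) x = 0" by (rule primitive_zero_imp_AE_zero[OF uP u0 h])
    moreover have "AE x in Mh h. ?D j x = 0" using uD \<open>AE x in Mh h. u x = 0\<close> by eventually_elim simp
    ultimately show ?thesis by eventually_elim simp
  qed
  have "AE x in Mh h. ?D 0 x = 0 \<and> ?D 2 x = 0" "AE x in Mh h. ?D 1 x = 0 \<and> ?D 3 x = 0"
    "AE x in Mh h. ?D 4 x = 0" "AE x in Mh h. ?D 5 x = 0"
    using first[of 0] first[of 1] second[of 4] second[of 5] by (simp_all add: numeral_2_eq_2 numeral_3_eq_3)
  then have "AE x in Mh h. \<forall>j<6. ?D j x = 0"
  proof eventually_elim
    case (elim x)
    show ?case
    proof (intro allI impI)
      fix j :: nat assume "j < 6"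
      then have "j = 0 \<or> j = 1 \<or> j = 2 \<or> j = 3 \<or> j = 4 \<or> j = 5" by auto
      then show "?D j x = 0" using elim by (elim disjE) simp_all
    qed
  qed
  then have "sq_energy h 6 ?D = sq_energy h 6 (\<lambda>_ _. 0)" by (rule sq_energy_cong_AE)
  then show ?thesis by (simp add: H_norm_coords[OF y]) (simp add: sq_energy_def)
qed

lemma complete_orthonormal_cosine_basis:
  assumes "0 < h"
  shows "complete_orthonormal_seq h (cosine_basis h)"
  unfolding complete_orthonormal_seq_def
  using cosine_basis_coords(1)[OF assms] cosine_basis_orthonormal[OF assms] cosine_basis_complete[OF assms] by blast

section \<open>The resolvent\<close>

text \<open>Duality in finite dimension: the bound on c -> sum c n T n is tested with c equal to the
  conjugate of T. The result does not depend on N.\<close>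

lemma bessel_bound:
  fixes T :: "nat \<Rightarrow> complex"
  assumes C: "0 \<le> C" and b: "\<And>c. (cmod (\<Sum>n<N. c n * T n))\<^sup>2 \<le> C * (\<Sum>n<N. (cmod (c n))\<^sup>2)"
  shows "(\<Sum>n<N. (cmod (T n))\<^sup>2) \<le> C"
proof -
  let ?S = "\<Sum>n<N. (cmod (T n))\<^sup>2"
  have S0: "0 \<le> ?S" by (rule sum_nonneg) simp
  have "(\<Sum>n<N. cnj (T n) * T n) = complex_of_real ?S"
    by (simp only: of_real_sum complex_norm_square mult.commute[of _ "cnj _"])
  then have "cmod (\<Sum>n<N. cnj (T n) * T n) = ?S" using S0 by (simp only: norm_of_real abs_of_nonneg)
  with b[of "\<lambda>n. cnj (T n)"] have "?S * ?S \<le> C * ?S" by (simp add: power2_eq_square)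
  then show ?thesis using S0 C by (cases "?S = 0") (auto simp: mult_le_cancel_right)
qed

text \<open>This identifies the energy of combined data with the sum of squared coefficients, the
  right-hand side that \<open>bessel_bound\<close> asks for.\<close>

lemma sq_energy_orthonormal_sum:
  fixes d :: "nat \<Rightarrow> nat \<Rightarrow> real \<Rightarrow> complex" and c :: "nat \<Rightarrow> complex"
  assumes d: "\<And>n j. j < J \<Longrightarrow> sq_integrable h (d n j)"
    and orth: "\<And>m n. (\<integral>x. (\<Sum>j<J. d m j x * cnj (d n j x)) \<partial>Mh h) = (if m = n then 1 else 0)"
  shows "sq_energy h J (\<lambda>j x. \<Sum>n<N. c n * d n j x) = (\<Sum>n<N. (cmod (c n))\<^sup>2)"
proof -
  let ?g = "\<lambda>m n x. \<Sum>j<J. d m j x * cnj (d n j x)"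
  have gi: "integrable (Mh h) (?g m n)" for m n
    by (intro Bochner_Integration.integrable_sum sq_integrable_mult_cnj d) auto
  have pt: "complex_of_real (\<Sum>j<J. (cmod (\<Sum>n<N. c n * d n j x))\<^sup>2) = (\<Sum>m<N. \<Sum>n<N. (c m * cnj (c n)) * ?g m n x)" for x
  proof -
    have "complex_of_real (\<Sum>j<J. (cmod (\<Sum>n<N. c n * d n j x))\<^sup>2)
      = (\<Sum>j<J. (\<Sum>m<N. c m * d m j x) * (\<Sum>n<N. cnj (c n) * cnj (d n j x)))"
      by (simp only: of_real_sum complex_norm_square cnj_sum complex_cnj_mult)
    also have "\<dots> = (\<Sum>j<J. \<Sum>m<N. \<Sum>n<N. (c m * cnj (c n)) * (d m j x * cnj (d n j x)))"
      by (simp add: sum_product ac_simps)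
    also have "\<dots> = (\<Sum>m<N. \<Sum>j<J. \<Sum>n<N. (c m * cnj (c n)) * (d m j x * cnj (d n j x)))"
      by (rule sum.swap)
    also have "\<dots> = (\<Sum>m<N. \<Sum>n<N. \<Sum>j<J. (c m * cnj (c n)) * (d m j x * cnj (d n j x)))"
      by (rule sum.cong[OF refl], rule sum.swap)
    also have "\<dots> = (\<Sum>m<N. \<Sum>n<N. (c m * cnj (c n)) * ?g m n x)" by (simp only: sum_distrib_left)
    finally show ?thesis .
  qed
  have "complex_of_real (sq_energy h J (\<lambda>j x. \<Sum>n<N. c n * d n j x))
     = (\<integral>x. complex_of_real (\<Sum>j<J. (cmod (\<Sum>n<N. c n * d n j x))\<^sup>2) \<partial>Mh h)"
    unfolding sq_energy_def by (rule integral_complex_of_real[symmetric])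
  also have "\<dots> = (\<integral>x. (\<Sum>m<N. \<Sum>n<N. (c m * cnj (c n)) * ?g m n x) \<partial>Mh h)" by (simp only: pt)
  also have "\<dots> = (\<Sum>m<N. \<Sum>n<N. (c m * cnj (c n)) * (\<integral>x. ?g m n x \<partial>Mh h))"
    by (simp only: Bochner_Integration.integral_sum Bochner_Integration.integrable_sum integrable_mult_right gi integral_mult_right_zero)
  also have "\<dots> = (\<Sum>m<N. c m * cnj (c m))" 
  proof (rule sum.cong[OF refl])
    fix m assume "m \<in> {..<N}"
    have "(\<Sum>n<N. (c m * cnj (c n)) * (\<integral>x. ?g m n x \<partial>Mh h)) = (\<Sum>n<N. if m = n then c m * cnj (c n) else 0)"
      unfolding orth by (intro sum.cong) auto
    also have "\<dots> = (if m \<in> {..<N} then c m * cnj (c m) else 0)" by (rule sum.delta'[OF finite_lessThan])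
    finally show "(\<Sum>n<N. (c m * cnj (c n)) * (\<integral>x. ?g m n x \<partial>Mh h)) = c m * cnj (c m)"
      using \<open>m \<in> {..<N}\<close> by simp
  qed
  also have "\<dots> = complex_of_real (\<Sum>n<N. (cmod (c n))\<^sup>2)" by (simp only: of_real_sum complex_norm_square)
  finally show ?thesis by (simp only: of_real_eq_iff)
qed

lemma bounded_linear_smult_cvec: "bounded_linear (\<lambda>v::cvec. z *s v)"
  by (auto intro!: linearI simp: linear_conv_bounded_linear[symmetric] vec_eq_iff algebra_simps)

lemma has_trace_of_continuous:
  "continuous_on {-h..h} g \<Longrightarrow> (AE y in Mh h. f y = g y) \<Longrightarrow> has_trace h f x (g x)"
  unfolding has_trace_def by blast

text \<open>The traces under the existential quantifier in \<open>domA\<close> become point values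
  of a continuous representative.\<close>

lemma has_trace_unique:
  assumes "has_trace h f x c" "continuous_on {-h..h} g" "AE y in Mh h. f y = g y" "0 < h" "x \<in> {-h..h}"
  shows "c = g x"
proof -
  obtain g' where g': "continuous_on {-h..h} g'" "AE y in Mh h. f y = g' y" "g' x = c"
    using assms(1) by (auto simp: has_trace_def)
  have "AE y in Mh h. g' y = g y" using g'(2) assms(3) by eventually_elim simp
  then show ?thesis using continuous_AE_eq_imp_eq[OF g'(1) assms(2) _ assms(4,5)] g'(3) by simp
qed

lemma clear_denominator:
  fixes M :: complex
  assumes "M \<noteq> 0"
  shows "v = - (X / M) - W / M - Z \<longleftrightarrow> M * v = - X - W - M * Z"
  using assms by (auto simp: field_simps)

section \<open>Passage between the operator equation and the first-order system\<close>

context lame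
begin

lemma matrix_vector_explicit:
  "matA l m *v x = cvec2 (a * x $ 1) (m * x $ 2)"
  "matB l m *v x = cvec2 ((l + m) * x $ 2) ((l + m) * x $ 1)"
  "matC l m *v x = cvec2 (m * x $ 1) (a * x $ 2)"
  "matD l m *v x = cvec2 (l * x $ 2) (m * x $ 1)"
  by (simp_all add: matA_def matB_def matC_def matD_def a_def matrix_vector_mult_def cvec2_eq_iff sum_2)

text \<open>\<open>matrix_inv\<close> is a choice, so an inverse is exhibited before its defining
  property can be used; the value then follows by writing x as \<open>matC\<close> applied to the
  claimed vector.\<close>

lemma matrix_inv_matC: "matrix_inv (matC l m) *v x = cvec2 (x $ 1 / m) (x $ 2 / a)"
proof -
  let ?N = "vector [vector [complex_of_real (1 / m), 0], vector [0, complex_of_real (1 / a)]] :: complex^2^2"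
  have "matC l m ** ?N = mat 1" "?N ** matC l m = mat 1"
    using m a by (simp_all add: matC_def a_def matrix_matrix_mult_def mat_def vec_eq_iff forall_2 sum_2 vector_2 flip: of_real_mult of_real_add)
  then have "\<exists>N. matC l m ** N = mat 1 \<and> N ** matC l m = mat 1" by blast
  then have inv: "matrix_inv (matC l m) ** matC l m = mat 1" unfolding matrix_inv_def by (rule someI2_ex) blast
  have "matC l m *v cvec2 (x $ 1 / m) (x $ 2 / a) = x"
    unfolding matrix_vector_explicit using m a by (simp add: vec_eq_iff forall_2)
  then have "matrix_inv (matC l m) *v x = (matrix_inv (matC l m) ** matC l m) *v cvec2 (x $ 1 / m) (x $ 2 / a)"
    by (metis matrix_vector_mul_assoc)
  then show ?thesis unfolding inv by simp
qed

lemma operator_components: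
  fixes v p q e w :: cvec and z :: complex
  shows "v = - (matrix_inv (matC l m) *v (complex_of_real r *s p + matA l m *v q))
       - matrix_inv (matC l m) *v (matB l m *v e) - z *s w \<longleftrightarrow>
     v $ 1 = - ((r * p $ 1 + a * q $ 1) / m) - (l + m) * e $ 2 / m - z * w $ 1 \<and>
     v $ 2 = - ((r * p $ 2 + m * q $ 2) / a) - (l + m) * e $ 1 / a - z * w $ 2"
  unfolding matrix_inv_matC matrix_vector_explicit by (simp add: vec_eq_iff forall_2)

text \<open>Elements of the domain are functions up to null sets; from here on they are replaced by
  absolutely continuous representatives, for which the boundary condition is a pointwise
  equation.\<close>

lemma domA_representatives:
  assumes "U \<in> domA h l m"
  shows "\<exists>u u' u'' V V'. primitive h u u' \<and> primitive h u' u'' \<and> primitive h V V' \<and> sq_integrable h u'' \<and> sq_integrable h V' \<and>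
    (AE x in Mh h. fst U x = u x) \<and> (AE x in Mh h. snd U x = V x) \<and>
    (\<forall>x\<in>{-h, h}. a * u' x $ 1 + l * V x $ 2 = 0 \<and> m * u' x $ 2 + m * V x $ 1 = 0)"
proof -
  have U: "fst U \<in> H2 h" "snd U \<in> H1 h" using assms by (auto simp: domA_def)
  obtain g where g: "g \<in> H1 h" "weak_deriv h (fst U) g" and U1: "fst U \<in> H1 h" using U(1) by (auto simp: H2_def)
  obtain u' where u': "primitive h u' (wd h g)" "AE x in Mh h. g x = u' x" using H1_primitive[OF g(1) h] by blast
  have gi: "integrable (Mh h) g" by (rule sq_integrable_imp_integrable[OF H1_imp_sq_integrable[OF g(1)]])
  obtain u where u0: "primitive h u g" "AE x in Mh h. fst U x = u x" using weak_deriv_imp_primitive[OF g(2) gi h] by blast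
  have u: "primitive h u u'"
    by (rule primitive_cong_AE[OF u0(1) u'(2)]) (rule borel_measurable_Mh_continuous[OF primitive_continuous[OF u'(1)]])
  obtain V where V: "primitive h V (wd h (snd U))" "AE x in Mh h. snd U x = V x" using H1_primitive[OF U(2) h] by blast
  obtain d where d: "weak_deriv h (fst U) d" and tr: "\<And>x. x \<in> {-h, h} \<Longrightarrow> \<exists>a b. has_trace h d x a \<and> has_trace h (snd U) x b \<and>
           matA l m *v a + matD l m *v b = 0" using assms by (auto simp: domA_def)
  \<comment> \<open>The derivative \<open>d\<close> in the boundary condition and the derivative
    \<open>g\<close> from \<open>H2\<close> are weak derivatives of the same function, so they share
    the continuous representative.\<close>
  have dae: "AE x in Mh h. d x = u' x" using weak_deriv_unique[OF d g(2)] u'(2) by eventually_elim simp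
  have "a * u' x $ 1 + l * V x $ 2 = 0 \<and> m * u' x $ 2 + m * V x $ 1 = 0" if x: "x \<in> {-h, h}" for x
  proof -
    obtain a' b' where t: "has_trace h d x a'" "has_trace h (snd U) x b'" "matA l m *v a' + matD l m *v b' = 0" using tr[OF x] by blast
    have xI: "x \<in> {-h..h}" using x h by auto
    have "a' = u' x" "b' = V x"
      using has_trace_unique[OF t(1) primitive_continuous[OF u'(1)] dae h xI]
        has_trace_unique[OF t(2) primitive_continuous[OF V(1)] V(2) h xI] by auto
    with t(3) show ?thesis unfolding matrix_vector_explicit by (simp add: vec_eq_iff forall_2)
  qed
  then show ?thesis using u u' V u0(2) wd_spec(1)[OF g(1)] wd_spec(1)[OF U(2)] by blast
qed

lemma resolvent_equation:
  assumes r: "r = om\<^sup>2 * rho" and op: "opA_minus h l m rho om z U F"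
    and u: "primitive h u u'" and u': "primitive h u' u''" and V: "primitive h V V'"
    and U1: "AE x in Mh h. fst U x = u x" and U2: "AE x in Mh h. snd U x = V x"
  shows "AE x in Mh h. fst F x = V x - z *s u x \<and>
     snd F x $ 1 = - ((r * u x $ 1 + a * u'' x $ 1) / m) - (l + m) * V' x $ 2 / m - z * V x $ 1 \<and>
     snd F x $ 2 = - ((r * u x $ 2 + m * u'' x $ 2) / a) - (l + m) * V' x $ 1 / a - z * V x $ 2"
proof -
  obtain d1 d2 e where w: "weak_deriv h (fst U) d1" "weak_deriv h d1 d2" "weak_deriv h (snd U) e"
    and ae: "AE x in Mh h. fst F x = snd U x - z *s fst U x \<and>
          snd F x = - (matrix_inv (matC l m) *v (of_real (om^2 * rho) *s fst U x + matA l m *v d2 x))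
                    - matrix_inv (matC l m) *v (matB l m *v e x) - z *s snd U x"
    using op unfolding opA_minus_def by blast
  have z: "AE x in Mh h. g x = g x" for g :: cfun by simp
  have wu: "weak_deriv h u d1" by (rule weak_deriv_cong_AE[OF w(1) U1 z])
  have d1: "AE x in Mh h. d1 x = u' x" by (rule weak_deriv_unique[OF wu weak_deriv_of_primitive[OF u h]])
  have wu': "weak_deriv h u' d2" by (rule weak_deriv_cong_AE[OF w(2) d1 z])
  have d2: "AE x in Mh h. d2 x = u'' x" by (rule weak_deriv_unique[OF wu' weak_deriv_of_primitive[OF u' h]])
  have wV: "weak_deriv h V e" by (rule weak_deriv_cong_AE[OF w(3) U2 z])
  have e: "AE x in Mh h. e x = V' x" by (rule weak_deriv_unique[OF wV weak_deriv_of_primitive[OF V h]])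
  show ?thesis using ae U1 U2 d2 e
  proof eventually_elim
    case (elim x)
    then show ?case using operator_components[of "snd F x" "u x" "u'' x" "V' x" z "V x"] by (simp add: r)
  qed
qed

text \<open>The coordinates of \<open>U = (U\<^sub>1, U\<^sub>2)\<close> in terms of a solution of the first-order system.\<close>
definition resolvent_coords :: "complex \<Rightarrow> complex \<Rightarrow> (nat \<Rightarrow> real \<Rightarrow> complex) \<Rightarrow> (nat \<Rightarrow> real \<Rightarrow> complex) \<Rightarrow> nat \<Rightarrow> real \<Rightarrow> complex" where
  "resolvent_coords k s d Y j x = (if j = 0 then Y 0 x / k else if j = 1 then Y 1 x / k
     else if j = 2 then (Y 2 x - l * (s * Y 1 x + d 1 x)) / a
     else if j = 3 then (Y 3 x - m * (s * Y 0 x + d 0 x)) / m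
     else if j = 4 then s * Y 0 x + d 0 x else s * Y 1 x + d 1 x)"
  for k s :: complex and d Y :: "nat \<Rightarrow> real \<Rightarrow> complex"

lemma domA_imp_Hspace: "U \<in> domA h l m \<Longrightarrow> U \<in> Hspace h"
  by (cases U) (auto simp: domA_def Hspace_def H2_def H1_def)

text \<open>\<open>opA_minus\<close> relates \<open>U\<close> to an arbitrary pair \<open>F\<close>,
  so membership of \<open>F\<close> in the space is a claim of its own. Its first component is V - z
  u with both terms absolutely continuous; its second is a combination of square-integrable
  functions.\<close>

lemma resolvent_range_in_Hspace:
  assumes r: "r = om\<^sup>2 * rho" and U: "U \<in> domA h l m" and op: "opA_minus h l m rho om z U F"
  shows "F \<in> Hspace h"
proof -
  obtain u u' u'' V V' where u: "primitive h u u'" and u': "primitive h u' u''" and V: "primitive h V V'" and sq: "sq_integrable h u''" "sq_integrable h V'"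
    and ae: "AE x in Mh h. fst U x = u x" "AE x in Mh h. snd U x = V x" using domA_representatives[OF U] by blast
  note eq = resolvent_equation[OF r op u u' V ae]
  have f1: "AE x in Mh h. fst F x = V x - z *s u x" using eq by eventually_elim simp
  have p: "primitive h (\<lambda>x. V x - z *s u x) (\<lambda>x. V' x - z *s u' x)"
    by (rule primitive_diff[OF V primitive_bounded_linear[OF u bounded_linear_smult_cvec]])
  have "sq_integrable h (\<lambda>x. V' x - z *s u' x)"
    by (rule sq_integrable_diff[OF sq(2) sq_integrable_bounded_linear[OF sq_integrable_continuous[OF primitive_continuous[OF u']] bounded_linear_smult_cvec]])
  from H1_of_primitive(1)[OF h p this f1] have "fst F \<in> H1 h" .
  moreover have "snd F \<in> L2 h" unfolding L2_iff_sq_integrable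
  proof (rule sq_integrable_cong_AE)
    let ?g1 = "\<lambda>x. - ((r * u x $ 1 + a * u'' x $ 1) / m) - (l + m) * V' x $ 2 / m - z * V x $ 1"
    let ?g2 = "\<lambda>x. - ((r * u x $ 2 + m * u'' x $ 2) / a) - (l + m) * V' x $ 1 / a - z * V x $ 2"
    have n: "sq_integrable h (\<lambda>x. u x $ i)" "sq_integrable h (\<lambda>x. V x $ i)" "sq_integrable h (\<lambda>x. u'' x $ i)" "sq_integrable h (\<lambda>x. V' x $ i)" for i
      using sq sq_integrable_continuous[OF primitive_continuous[OF u]] sq_integrable_continuous[OF primitive_continuous[OF V]]
      by (auto intro: sq_integrable_bounded_linear[OF _ bounded_linear_vec_nth])
    have "sq_integrable h ?g1" "sq_integrable h ?g2"
      unfolding divide_inverse mult.commute[of _ "inverse _"]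
      by (intro sq_integrable_diff sq_integrable_uminus sq_integrable_add sq_integrable_cmult n)+
    then show "sq_integrable h (\<lambda>x. cvec2 (?g1 x) (?g2 x))" by (rule sq_integrable_cvec2)
    show "AE x in Mh h. cvec2 (?g1 x) (?g2 x) = snd F x" using eq by eventually_elim (simp add: cvec2_eq_iff eq_commute[of "cvec2 _ _"])
  qed
  ultimately show ?thesis by (cases F) (simp add: Hspace_def)
qed

text \<open>The first data are not the given values of F1 but the continuous function V - z u. This
  makes the first two equations pointwise identities and gives \<open>d 0\<close> and
  \<open>d 1\<close> the derivatives \<open>d 2\<close> and \<open>d 3\<close>, which the later
  pointwise bound requires. The last two equations hold almost everywhere.\<close>

lemma resolvent_imp_stress_system:
  assumes r: "r = om\<^sup>2 * rho" and U: "U \<in> domA h l m" and F: "F \<in> Hspace h" and op: "opA_minus h l m rho om (s * k) U F"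
    and s: "s * s = -1" and k: "k \<noteq> 0"
  shows "\<exists>d Y. stress_system k s d Y \<and> stress_free Y \<and> (\<forall>j<6. sq_integrable h (d j)) \<and>
    primitive h (d 0) (d 2) \<and> primitive h (d 1) (d 3) \<and>
    (AE x in Mh h. \<forall>j<6. coords h F j x = d j x) \<and>
    (AE x in Mh h. \<forall>j<6. coords h U j x = resolvent_coords k s d Y j x)"
proof -
  let ?z = "s * k"
  obtain u u' u'' V V' where u: "primitive h u u'" and u': "primitive h u' u''" and V: "primitive h V V'" and sq: "sq_integrable h u''" "sq_integrable h V'"
    and U1: "AE x in Mh h. fst U x = u x" and U2: "AE x in Mh h. snd U x = V x"
    and bc: "\<And>x. x \<in> {-h, h} \<Longrightarrow> a * u' x $ 1 + l * V x $ 2 = 0 \<and> m * u' x $ 2 + m * V x $ 1 = 0"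
    using domA_representatives[OF U] by blast
  note eq = resolvent_equation[OF r op u u' V U1 U2]
  define f where "f x = V x - ?z *s u x" for x
  define f' where "f' x = V' x - ?z *s u' x" for x
  have f: "primitive h f f'" unfolding f_def f'_def
    by (rule primitive_diff[OF V primitive_bounded_linear[OF u bounded_linear_smult_cvec]])
  have fs: "sq_integrable h f'" unfolding f'_def
    by (rule sq_integrable_diff[OF sq(2) sq_integrable_bounded_linear[OF sq_integrable_continuous[OF primitive_continuous[OF u']] bounded_linear_smult_cvec]])
  have f1: "AE x in Mh h. fst F x = f x" using eq by eventually_elim (simp add: f_def)
  note H = H1_of_primitive[OF h f fs f1]
  define d where "d j = (if j = 0 then (\<lambda>x. f x $ 1) else if j = 1 then (\<lambda>x. f x $ 2) else if j = 2 then (\<lambda>x. f' x $ 1)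
     else if j = 3 then (\<lambda>x. f' x $ 2) else if j = 4 then (\<lambda>x. snd F x $ 1) else (\<lambda>x. snd F x $ 2))" for j :: nat
  define Y where "Y j = (if j = 0 then (\<lambda>x. k * u x $ 1) else if j = 1 then (\<lambda>x. k * u x $ 2)
     else if j = 2 then (\<lambda>x. a * u' x $ 1 + l * V x $ 2) else (\<lambda>x. m * u' x $ 2 + m * V x $ 1))" for j :: nat
  have ca: "complex_of_real a \<noteq> 0" "complex_of_real m \<noteq> 0" using a m by auto
  note nth = primitive_bounded_linear[OF _ bounded_linear_vec_nth]
  have snF: "sq_integrable h (snd F)" using F by (auto simp: Hspace_def L2_iff_sq_integrable)
  have ds: "sq_integrable h (d j)" for j
    unfolding d_def using fs snF sq_integrable_continuous[OF primitive_continuous[OF f]]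
    by (auto intro: sq_integrable_bounded_linear[OF _ bounded_linear_vec_nth])
  have dP: "primitive h (d 0) (d 2)" "primitive h (d 1) (d 3)" by (simp_all add: d_def nth[OF f])
  have dm: "d j \<in> borel_measurable (Mh h)" for j using ds[of j] by (simp add: sq_integrable_def)
  have Yc: "continuous_on {-h..h} (Y j)" for j unfolding Y_def
    using primitive_continuous[OF u] primitive_continuous[OF u'] primitive_continuous[OF V] by (auto intro!: continuous_intros)
  have Ym: "Y j \<in> borel_measurable (Mh h)" for j by (rule borel_measurable_Mh_continuous[OF Yc])
  have "stress_system k s d Y" unfolding stress_system_def
  proof (intro conjI)
    have "(\<lambda>x. k * u' x $ 1) = (\<lambda>x. k * (Y 2 x - l * s * Y 1 x - l * d 1 x) / a)"
      using ca by (auto simp: Y_def d_def f_def field_simps)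
    then show "primitive h (Y 0) (\<lambda>x. k * (Y 2 x - l * s * Y 1 x - l * d 1 x) / a)"
      using primitive_cmult[OF nth[OF u, of 1], of k] by (simp add: Y_def)
    have "(\<lambda>x. k * u' x $ 2) = (\<lambda>x. k * (Y 3 x / m - s * Y 0 x - d 0 x))"
      using ca by (auto simp: Y_def d_def f_def field_simps)
    then show "primitive h (Y 1) (\<lambda>x. k * (Y 3 x / m - s * Y 0 x - d 0 x))"
      using primitive_cmult[OF nth[OF u, of 2], of k] by (simp add: Y_def)
    have p2: "primitive h (Y 2) (\<lambda>x. a * u'' x $ 1 + l * V' x $ 2)"
      unfolding Y_def using primitive_add[OF primitive_cmult[OF nth[OF u', of 1], of a] primitive_cmult[OF nth[OF V, of 2], of l]] by simp
    show "primitive h (Y 2) (\<lambda>x. - (k * s * Y 3 x) - m * d 3 x - r / k * Y 0 x - m * d 4 x)"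
    proof (rule primitive_cong_AE[OF p2])
      show "AE x in Mh h. a * u'' x $ 1 + l * V' x $ 2 = - (k * s * Y 3 x) - m * d 3 x - r / k * Y 0 x - m * d 4 x"
        using eq
      proof eventually_elim
        case (elim x)
        then have e: "m * snd F x $ 1 = - (r * u x $ 1 + a * u'' x $ 1) - (l + m) * V' x $ 2 - m * (?z * V x $ 1)"
          by (intro clear_denominator[THEN iffD1] ca) blast
        have rk: "r / k * (k * u x $ 1) = r * u x $ 1" using k by simp
        \<comment> \<open>The derivative of U2 is traded for data: V2' - s k u2' is
          \<open>d 3\<close>, and the remaining -s k (m u2' + m V1) is -s k times the stress
          \<open>Y 3\<close>.\<close>
        have "a * u'' x $ 1 + l * V' x $ 2 = - (k * s * (m * u' x $ 2 + m * V x $ 1)) - m * (V' x $ 2 - s * k * u' x $ 2) - r * u x $ 1 - m * snd F x $ 1"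
          using e unfolding of_real_add by algebra
        then show ?case using k by (simp add: Y_def d_def f'_def rk)
      qed
      show "(\<lambda>x. - (k * s * Y 3 x) - m * d 3 x - r / k * Y 0 x - m * d 4 x) \<in> borel_measurable (Mh h)"
        by (intro borel_measurable_diff borel_measurable_uminus borel_measurable_times borel_measurable_const dm Ym)
    qed
    have p3: "primitive h (Y 3) (\<lambda>x. m * u'' x $ 2 + m * V' x $ 1)"
      unfolding Y_def using primitive_add[OF primitive_cmult[OF nth[OF u', of 2], of m] primitive_cmult[OF nth[OF V, of 1], of m]] by simp
    show "primitive h (Y 3) (\<lambda>x. k * (- (s * (l / a) * Y 2 x) + E * Y 1 x - s * E * d 1 x) - l * d 2 x - r / k * Y 1 x - a * d 5 x)"
    proof (rule primitive_cong_AE[OF p3])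
      show "AE x in Mh h. m * u'' x $ 2 + m * V' x $ 1 = k * (- (s * (l / a) * Y 2 x) + E * Y 1 x - s * E * d 1 x) - l * d 2 x - r / k * Y 1 x - a * d 5 x"
        using eq
      proof eventually_elim
        case (elim x)
        then have e: "a * snd F x $ 2 = - (r * u x $ 2 + m * u'' x $ 2) - (l + m) * V' x $ 1 - a * (?z * V x $ 2)"
          by (intro clear_denominator[THEN iffD1] ca) blast
        define ia where "ia = 1 / complex_of_real a"
        have ia: "complex_of_real a * ia = 1" "complex_of_real E = 4 * m * (l + m) * ia" "complex_of_real (l / a) = l * ia"
          "complex_of_real a = complex_of_real l + 2 * complex_of_real m"
          using complex_constants by (auto simp: ia_def)
        have rk: "r / k * (k * u x $ 2) = r * u x $ 2" using k by simp
        \<comment> \<open>Eliminating u1' through the first stress leaves the coefficient (a^2 -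
          l^2) / a of V2, which is \<open>E\<close>; the relation for \<open>s\<close> then splits
          V2 into solution and data.\<close>
        have "k * (- (s * (l * ia) * (a * u' x $ 1 + l * V x $ 2)) + E * (k * u x $ 2) - s * E * (V x $ 2 - s * k * u x $ 2))
           - l * (V' x $ 1 - s * k * u' x $ 1) - r * u x $ 2 - a * snd F x $ 2 = m * u'' x $ 2 + m * V' x $ 1"
          using e s ia(1,2,4) unfolding of_real_add of_real_mult of_real_numeral by algebra
        then show ?case using k by (simp add: Y_def d_def f_def f'_def rk ia(3) del: of_real_divide)
      qed
      show "(\<lambda>x. k * (- (s * (l / a) * Y 2 x) + E * Y 1 x - s * E * d 1 x) - l * d 2 x - r / k * Y 1 x - a * d 5 x) \<in> borel_measurable (Mh h)"
        by (intro borel_measurable_diff borel_measurable_add borel_measurable_uminus borel_measurable_times borel_measurable_const dm Ym)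
    qed
  qed
  moreover have "stress_free Y" using bc by (simp add: stress_free_def Y_def)
  moreover have "AE x in Mh h. \<forall>j<6. coords h F j x = d j x"
    using f1 H(3) by eventually_elim (auto simp: coords_def d_def)
  moreover have "AE x in Mh h. \<forall>j<6. coords h U j x = resolvent_coords k s d Y j x"
  proof -
    have "sq_integrable h u'" by (rule sq_integrable_continuous[OF primitive_continuous[OF u']])
    from H1_of_primitive(3)[OF h u this U1] have "AE x in Mh h. wd h (fst U) x = u' x" .
    then show ?thesis using U1 U2
    proof eventually_elim
      case (elim x)
      then show ?case using k ca by (auto simp: coords_def resolvent_coords_def d_def Y_def f_def field_simps)
    qed
  qed
  ultimately show ?thesis using ds dP by blast
qed

text \<open>A stress-free solution of the first-order system is read backwards: U1 = w / k, U2 = s w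
  + F1, and the derivative of U1 is solved from the stress. The first two equations say that this is
  indeed the derivative of U1; the last two are the second component of the operator
  equation.\<close>

lemma resolvent_solvable:
  assumes r: "r = om\<^sup>2 * rho" and F: "F \<in> Hspace h" and s: "s * s = -1" and k: "k \<noteq> 0"
    and uniq: "\<And>Y. stress_system k s (\<lambda>_ _. 0) Y \<Longrightarrow> stress_free Y \<Longrightarrow> sq_energy h 4 Y = 0"
  shows "\<exists>U\<in>domA h l m. opA_minus h l m rho om (s * k) U F"
proof -
  have F1: "fst F \<in> H1 h" and F2: "sq_integrable h (snd F)" using F by (auto simp: Hspace_def L2_iff_sq_integrable)
  obtain f where f: "primitive h f (wd h (fst F))" "AE x in Mh h. fst F x = f x" using H1_primitive[OF F1 h] by blast
  note fs = wd_spec(1)[OF F1]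
  define d where "d j = (if j = 0 then (\<lambda>x. f x $ 1) else if j = 1 then (\<lambda>x. f x $ 2) else if j = 2 then (\<lambda>x. wd h (fst F) x $ 1)
     else if j = 3 then (\<lambda>x. wd h (fst F) x $ 2) else if j = 4 then (\<lambda>x. snd F x $ 1) else (\<lambda>x. snd F x $ 2))" for j :: nat
  have ds: "sq_integrable h (d j)" for j
    unfolding d_def using fs F2 sq_integrable_continuous[OF primitive_continuous[OF f(1)]]
    by (auto intro: sq_integrable_bounded_linear[OF _ bounded_linear_vec_nth])
  have dP: "primitive h (d 0) (d 2)" "primitive h (d 1) (d 3)"
    by (simp_all add: d_def primitive_bounded_linear[OF f(1) bounded_linear_vec_nth])
  obtain Y where sys: "stress_system k s d Y" and free: "stress_free Y" using stress_system_solvable[of k s d, OF uniq ds] by auto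
  have Ys: "sq_integrable h (Y j)" if "j < 4" for j by (rule sq_integrable_continuous[OF stress_system_continuous[OF sys that]])
  define D0 where "D0 x = k * (Y 2 x - l * s * Y 1 x - l * d 1 x) / a" for x
  define D1 where "D1 x = k * (Y 3 x / m - s * Y 0 x - d 0 x)" for x
  define D2 where "D2 x = - (k * s * Y 3 x) - m * d 3 x - r / k * Y 0 x - m * d 4 x" for x
  define D3 where "D3 x = k * (- (s * (l / a) * Y 2 x) + E * Y 1 x - s * E * d 1 x) - l * d 2 x - r / k * Y 1 x - a * d 5 x" for x
  have P: "primitive h (Y 0) D0" "primitive h (Y 1) D1" "primitive h (Y 2) D2" "primitive h (Y 3) D3"
    using sys by (simp_all add: stress_system_def D0_def[abs_def] D1_def[abs_def] D2_def[abs_def] D3_def[abs_def])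
  have Ds: "sq_integrable h D0" "sq_integrable h D1" "sq_integrable h D2" "sq_integrable h D3"
    unfolding D0_def[abs_def] D1_def[abs_def] D2_def[abs_def] D3_def[abs_def] divide_inverse mult.commute[of _ "inverse _"]
    by (intro sq_integrable_diff sq_integrable_add sq_integrable_uminus sq_integrable_cmult ds Ys; simp)+
  \<comment> \<open>\<open>q1\<close> and \<open>q2\<close> are the components of the derivative of
    U1, expressed through the stress and the datum F1. Since F1 is in H^1 they are absolutely
    continuous, and this is what puts U1 in H^2.\<close>
  define q1 where "q1 x = (1 / a) * (Y 2 x + (- (l * s)) * Y 1 x + (- complex_of_real l) * d 1 x)" for x
  define q2 where "q2 x = (1 / m) * Y 3 x + (- s) * Y 0 x + (- 1) * d 0 x" for x
  define q1' where "q1' x = (1 / a) * (D2 x + (- (l * s)) * D1 x + (- complex_of_real l) * d 3 x)" for x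
  define q2' where "q2' x = (1 / m) * D3 x + (- s) * D0 x + (- 1) * d 2 x" for x
  have qP: "primitive h q1 q1'" "primitive h q2 q2'"
    unfolding q1_def[abs_def] q2_def[abs_def] q1'_def[abs_def] q2'_def[abs_def]
    by (intro primitive_add primitive_cmult P dP)+
  have qs: "sq_integrable h q1'" "sq_integrable h q2'"
    unfolding q1'_def[abs_def] q2'_def[abs_def] by (intro sq_integrable_add sq_integrable_cmult Ds ds)+
  have ca: "complex_of_real a \<noteq> 0" "complex_of_real m \<noteq> 0" using a m by auto
  have q: "(1 / k) * D0 x = q1 x" "(1 / k) * D1 x = q2 x" for x
    using k ca by (simp_all add: D0_def D1_def q1_def q2_def field_simps)
  define u where "u x = cvec2 ((1 / k) * Y 0 x) ((1 / k) * Y 1 x)" for x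
  define u' where "u' x = cvec2 (q1 x) (q2 x)" for x
  define u'' where "u'' x = cvec2 (q1' x) (q2' x)" for x
  define V where "V x = cvec2 (s * Y 0 x + d 0 x) (s * Y 1 x + d 1 x)" for x
  define V' where "V' x = cvec2 (s * D0 x + d 2 x) (s * D1 x + d 3 x)" for x
  have uP: "primitive h u u'" unfolding u_def[abs_def] u'_def[abs_def]
    using primitive_cvec2[OF primitive_cmult[OF P(1), of "1 / k"] primitive_cmult[OF P(2), of "1 / k"]] by (simp only: q)
  have u'P: "primitive h u' u''" unfolding u'_def[abs_def] u''_def[abs_def] by (rule primitive_cvec2[OF qP])
  have VP: "primitive h V V'" unfolding V_def[abs_def] V'_def[abs_def]
    by (intro primitive_cvec2 primitive_add primitive_cmult P dP)
  have u''s: "sq_integrable h u''" unfolding u''_def[abs_def] by (rule sq_integrable_cvec2[OF qs])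
  have V's: "sq_integrable h V'" unfolding V'_def[abs_def]
    by (intro sq_integrable_cvec2 sq_integrable_add sq_integrable_cmult Ds ds)
  have u's: "sq_integrable h u'" by (rule sq_integrable_continuous[OF primitive_continuous[OF u'P]])
  have refl_AE: "AE x in Mh h. g x = g x" for g :: cfun by simp
  note Hu = H1_of_primitive[OF h uP u's refl_AE] and Hu' = H1_of_primitive[OF h u'P u''s refl_AE]
    and HV = H1_of_primitive[OF h VP V's refl_AE]
  have "u \<in> H2 h" unfolding H2_def using Hu(1,2) Hu'(1) by blast
  have dom: "(u, V) \<in> domA h l m" unfolding domA_def mem_Collect_eq fst_conv snd_conv
  proof (intro conjI exI[of _ u'] ballI)
    fix x assume x: "x \<in> {-h, h}"
    have z: "Y 2 x = 0" "Y 3 x = 0" using free x by (auto simp: stress_free_def)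
    have "matA l m *v u' x + matD l m *v V x = 0"
      unfolding matrix_vector_explicit using z ca by (simp add: vec_eq_iff forall_2 u'_def V_def q1_def q2_def field_simps)
    then show "\<exists>a b. has_trace h u' x a \<and> has_trace h V x b \<and> matA l m *v a + matD l m *v b = 0"
      using has_trace_of_continuous[OF primitive_continuous[OF u'P] refl_AE] has_trace_of_continuous[OF primitive_continuous[OF VP] refl_AE] by blast
  qed (fact \<open>u \<in> H2 h\<close> HV(1) Hu(2))+
  have "opA_minus h l m rho om (s * k) (u, V) F" unfolding opA_minus_def fst_conv snd_conv
  proof (rule exI[of _ u'], rule exI[of _ u''], rule exI[of _ V'], intro conjI)
    show "weak_deriv h u u'" "weak_deriv h u' u''" "weak_deriv h V V'" by (fact Hu(2) Hu'(2) HV(2))+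
    have "f x = V x - (s * k) *s u x" for x
      using k by (simp add: vec_eq_iff forall_2 V_def u_def d_def)
    moreover have "snd F x = - (matrix_inv (matC l m) *v (of_real (om\<^sup>2 * rho) *s u x + matA l m *v u'' x))
                    - matrix_inv (matC l m) *v (matB l m *v V' x) - (s * k) *s V x" for x
      unfolding r[symmetric] operator_components
    proof
      define ia where "ia = 1 / complex_of_real a"
      define im where "im = 1 / complex_of_real m"
      define R where "R = complex_of_real r / k"
      have ia: "complex_of_real a * ia = 1" "complex_of_real m * im = 1" "complex_of_real E = 4 * m * (l + m) * ia" "complex_of_real (l / a) = l * ia"
          "complex_of_real a = complex_of_real l + 2 * complex_of_real m"
        using complex_constants by (auto simp: ia_def im_def)
      have rk: "r * (1 / k * y) = R * y" for y by (simp add: R_def)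
      have e: "D0 x = k * (Y 2 x - l * s * Y 1 x - l * d 1 x) * ia" "D1 x = k * (Y 3 x * im - s * Y 0 x - d 0 x)"
        "D2 x = - (k * s * Y 3 x) - m * d 3 x - R * Y 0 x - m * d 4 x"
        "D3 x = k * (- (s * (l * ia) * Y 2 x) + E * Y 1 x - s * E * d 1 x) - l * d 2 x - R * Y 1 x - a * d 5 x"
        by (simp_all add: D0_def D1_def D2_def D3_def ia_def im_def R_def)
      have q': "q1' x = ia * (D2 x + (- (l * s)) * D1 x + (- complex_of_real l) * d 3 x)" "q2' x = im * D3 x + (- s) * D0 x + (- 1) * d 2 x"
        by (simp_all add: q1'_def q2'_def ia_def im_def)
      have c: "snd F x $ 1 = d 4 x" "snd F x $ 2 = d 5 x" by (simp_all add: d_def)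
      have "m * d 4 x = - (R * Y 0 x + a * q1' x) - (l + m) * (s * D1 x + d 3 x) - m * (s * k * (s * Y 0 x + d 0 x))"
        using ia(1,2,3,5) s e(2,3) q'(1) unfolding of_real_add by algebra
      then show "snd F x $ 1 = - ((r * u x $ 1 + a * u'' x $ 1) / m) - (l + m) * V' x $ 2 / m - s * k * V x $ 1"
        unfolding c u_def u''_def V'_def V_def cvec2_nth rk by (rule clear_denominator[OF ca(2), THEN iffD2])
      have "a * d 5 x = - (R * Y 1 x + m * q2' x) - (l + m) * (s * D0 x + d 2 x) - a * (s * k * (s * Y 1 x + d 1 x))"
        using ia(1,2,3,5) s e(1,4) q'(2) unfolding of_real_add of_real_mult of_real_numeral by algebra
      then show "snd F x $ 2 = - ((r * u x $ 2 + m * u'' x $ 2) / a) - (l + m) * V' x $ 1 / a - s * k * V x $ 2"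
        unfolding c u_def u''_def V'_def V_def cvec2_nth rk by (rule clear_denominator[OF ca(1), THEN iffD2])
    qed
    ultimately show "AE x in Mh h. fst F x = V x - (s * k) *s u x \<and>
          snd F x = - (matrix_inv (matC l m) *v (of_real (om\<^sup>2 * rho) *s u x + matA l m *v u'' x))
                    - matrix_inv (matC l m) *v (matB l m *v V' x) - (s * k) *s V x"
      using f(2) by (auto elim!: eventually_mono)
  qed
  then show ?thesis using dom by blast
qed

text \<open>No positive power of k occurs: U1 is the solution divided by k, while U2 and the
  derivative of U1 combine solution and datum with fixed coefficients and |s| = 1. Hence one
  constant serves all |k| \<ge> 1.\<close>

lemma resolvent_coords_bound:
  "\<exists>C>0. \<forall>(k::complex) (s::complex) (d :: nat \<Rightarrow> real \<Rightarrow> complex) (Y :: nat \<Rightarrow> real \<Rightarrow> complex) x j. 1 \<le> cmod k \<longrightarrow> s * s = -1 \<longrightarrow>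
     (cmod (resolvent_coords k s d Y j x))\<^sup>2 \<le> C * ((\<Sum>j<4. (cmod (Y j x))\<^sup>2) + ((cmod (d 0 x))\<^sup>2 + (cmod (d 1 x))\<^sup>2))"
proof -
  define C where "C = 2 + (1 + 2 * \<bar>l\<bar>) / a + (1 + 2 * m) / m"
  have q: "0 < (1 + 2 * \<bar>l\<bar>) / a" "0 < (1 + 2 * m) / m" using a m by (auto intro!: divide_pos_pos add_pos_nonneg)
  have C0: "0 < C" using q by (simp add: C_def)
  have "(cmod (resolvent_coords k s d Y j x))\<^sup>2 \<le> C\<^sup>2 * ((\<Sum>j<4. (cmod (Y j x))\<^sup>2) + ((cmod (d 0 x))\<^sup>2 + (cmod (d 1 x))\<^sup>2))"
    if k: "1 \<le> cmod k" and s: "s * s = -1" for k s :: complex and d Y :: "nat \<Rightarrow> real \<Rightarrow> complex" and x j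
  proof -
    have "cmod s * cmod s = 1" using arg_cong[OF s, of cmod] by (simp add: norm_mult)
    then have ns: "cmod s = 1" by (metis abs_norm_cancel real_sqrt_abs2 real_sqrt_one)
    define G where "G = (\<Sum>j<4. (cmod (Y j x))\<^sup>2) + ((cmod (d 0 x))\<^sup>2 + (cmod (d 1 x))\<^sup>2)"
    define R where "R = sqrt G"
    have G0: "0 \<le> G" unfolding G_def by (intro add_nonneg_nonneg sum_nonneg) auto
    then have R0: "0 \<le> R" by (simp add: R_def)
    have Yj: "cmod (Y i x) \<le> R" if "i < 4" for i
    proof -
      have "(cmod (Y i x))\<^sup>2 \<le> (\<Sum>j<4. (cmod (Y j x))\<^sup>2)" by (rule member_le_sum) (use that in auto)
      also have "\<dots> \<le> G" by (simp add: G_def)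
      finally show ?thesis unfolding R_def by (rule real_le_rsqrt)
    qed
    have "0 \<le> (\<Sum>j<4. (cmod (Y j x))\<^sup>2)" by (rule sum_nonneg) simp
    then have "(cmod (d 0 x))\<^sup>2 \<le> G" "(cmod (d 1 x))\<^sup>2 \<le> G" by (simp_all add: G_def add_increasing add_increasing2)
    then have dj: "cmod (d 0 x) \<le> R" "cmod (d 1 x) \<le> R" unfolding R_def by (auto intro: real_le_rsqrt)
    have V: "cmod (s * Y i x + v) \<le> 2 * R" if "i < 4" "cmod v \<le> R" for i v
      using norm_triangle_mono[of "s * Y i x" R v R] Yj[OF that(1)] that(2) ns by (simp add: norm_mult)
    have div: "cmod (Y i x / k) \<le> C * R" if "i < 4" for i
    proof -
      have "cmod (Y i x / k) \<le> cmod (Y i x)"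
        using k by (simp add: norm_divide divide_le_eq mult_left_le_one_le mult_le_cancel_left1 le_divide_eq_1 mult_ge1_I)
      also have "\<dots> \<le> 1 * R" using Yj[OF that] by simp
      also have "\<dots> \<le> C * R" using R0 q by (intro mult_right_mono) (auto simp: C_def)
      finally show ?thesis .
    qed
    have lin: "cmod ((y - c * v) / e) \<le> (1 + 2 * \<bar>c\<bar>) / e * R" if "cmod y \<le> R" "cmod v \<le> 2 * R" "0 < e" for y v :: complex and c e :: real
    proof -
      have "cmod (y - c * v) \<le> R + \<bar>c\<bar> * (2 * R)"
        by (rule norm_triangle_le_diff) (use that in \<open>auto simp: norm_mult intro!: add_mono mult_left_mono\<close>)
      then have "cmod (y - c * v) / e \<le> (R + \<bar>c\<bar> * (2 * R)) / e" using that(3) by (intro divide_right_mono) auto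
      then show ?thesis using that(3) by (simp add: norm_divide algebra_simps)
    qed
    have up: "X \<le> C * R" if "X \<le> c * R" "c \<le> C" for X c
      using that mult_right_mono[OF that(2) R0] by linarith
    have b: "cmod (resolvent_coords k s d Y j x) \<le> C * R"
    proof -
      have "cmod ((Y 2 x - l * (s * Y 1 x + d 1 x)) / a) \<le> C * R"
        by (rule up[OF lin[OF Yj V[OF _ dj(2)] a]]) (use q in \<open>auto simp: C_def\<close>)
      moreover have "cmod ((Y 3 x - m * (s * Y 0 x + d 0 x)) / m) \<le> C * R"
        by (rule up[OF lin[OF Yj V[OF _ dj(1)] m]]) (use q m in \<open>auto simp: C_def\<close>)
      moreover have "cmod (s * Y 0 x + d 0 x) \<le> C * R" by (rule up[OF V[OF _ dj(1)]]) (use q in \<open>auto simp: C_def\<close>)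
      moreover have "cmod (s * Y 1 x + d 1 x) \<le> C * R" by (rule up[OF V[OF _ dj(2)]]) (use q in \<open>auto simp: C_def\<close>)
      ultimately show ?thesis using div[of 0] div[of 1] by (simp add: resolvent_coords_def)
    qed
    have "(cmod (resolvent_coords k s d Y j x))\<^sup>2 \<le> (C * R)\<^sup>2" by (rule power_mono[OF b]) simp
    also have "\<dots> = C\<^sup>2 * G" using G0 by (simp add: power_mult_distrib R_def)
    finally show ?thesis by (simp only: G_def)
  qed
  then show ?thesis using C0 by (intro exI[of _ "C\<^sup>2"]) auto
qed

text \<open>Here the constant may depend on k: the bound serves the Hilbert-Schmidt property, which
  concerns one value of k at a time.\<close>

lemma system_derivative_bound:
  fixes k s :: complex
  shows "\<exists>C\<ge>0. \<forall>(d :: nat \<Rightarrow> real \<Rightarrow> complex) Y. stress_system k s d Y \<longrightarrow>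
     (\<forall>j<4. \<exists>Z. primitive h (Y j) Z \<and> (\<forall>x. (cmod (Z x))\<^sup>2 \<le> C * ((\<Sum>j<4. (cmod (Y j x))\<^sup>2) + (\<Sum>j<6. (cmod (d j x))\<^sup>2))))"
proof -
  define K where "K = cmod k * (1 + \<bar>l\<bar> * cmod s + \<bar>l\<bar>) / a + cmod k * (1 / m + cmod s + 1)
     + (cmod k * cmod s + m + cmod (r / k) + m) + (cmod k * (cmod s * \<bar>l / a\<bar> + E + cmod s * E) + \<bar>l\<bar> + cmod (r / k) + a)"
  have n0: "0 \<le> cmod k * (1 + \<bar>l\<bar> * cmod s + \<bar>l\<bar>) / a" "0 \<le> cmod k * (1 / m + cmod s + 1)" "0 \<le> cmod k * cmod s + m + cmod (r / k) + m"
    "0 \<le> cmod k * (cmod s * \<bar>l / a\<bar> + E + cmod s * E) + \<bar>l\<bar> + cmod (r / k) + a"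
    using a m E by (auto intro!: add_nonneg_nonneg mult_nonneg_nonneg divide_nonneg_nonneg)
  show ?thesis
  proof (rule exI[of _ "K\<^sup>2"], intro conjI allI impI)
    show "0 \<le> K\<^sup>2" by simp
    fix d Y :: "nat \<Rightarrow> real \<Rightarrow> complex" and j :: nat assume sys: "stress_system k s d Y" and j: "j < 4"
    define G where "G x = (\<Sum>j<4. (cmod (Y j x))\<^sup>2) + (\<Sum>j<6. (cmod (d j x))\<^sup>2)" for x
    define R where "R x = sqrt (G x)" for x
    have s0: "0 \<le> (\<Sum>j<4. (cmod (Y j x))\<^sup>2)" "0 \<le> (\<Sum>j<6. (cmod (d j x))\<^sup>2)" for x by (auto intro: sum_nonneg)
    have G0: "0 \<le> G x" for x using s0[of x] by (simp add: G_def)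
    have R0: "0 \<le> R x" for x using G0 by (simp add: R_def)
    have Yj: "cmod (Y i x) \<le> R x" if "i < 4" for i x
      unfolding R_def using member_le_sum[of i "{..<4}" "\<lambda>j. (cmod (Y j x))\<^sup>2"] s0[of x] that by (intro real_le_rsqrt) (auto simp: G_def)
    have dj: "cmod (d i x) \<le> R x" if "i < 6" for i x
      unfolding R_def using member_le_sum[of i "{..<6}" "\<lambda>j. (cmod (d j x))\<^sup>2"] s0[of x] that by (intro real_le_rsqrt) (auto simp: G_def)
    have c: "cmod (c * v) \<le> C * R x" if "cmod v \<le> R x" "cmod c = C" for c v :: complex and C x
      using mult_left_mono[OF that(1), of C] that(2) by (metis norm_ge_zero norm_mult)
    have c': "cmod (c * v) \<le> cmod c * (C * R x)" if "cmod v \<le> C * R x" for c v :: complex and C x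
      using mult_left_mono[OF that, of "cmod c"] by (simp add: norm_mult)
    have fin: "(cmod z)\<^sup>2 \<le> K\<^sup>2 * G x" if "cmod z \<le> C * R x" "C \<le> K" "0 \<le> C" for z :: complex and C x
    proof -
      have "cmod z \<le> K * R x" using that(1) mult_right_mono[OF that(2) R0[of x]] by linarith
      then have "(cmod z)\<^sup>2 \<le> (K * R x)\<^sup>2" by (rule power_mono) simp
      then show ?thesis using G0 by (simp add: power_mult_distrib R_def)
    qed
    have dm: "norm (u - v) \<le> A + B" if "norm u \<le> A" "norm v \<le> B" for u v :: complex and A B
      using that norm_triangle_ineq4[of u v] by linarith
    have b0: "cmod (k * (Y 2 x - l * s * Y 1 x - l * d 1 x) / a) \<le> (cmod k * (1 + \<bar>l\<bar> * cmod s + \<bar>l\<bar>) / a) * R x" for x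
    proof -
      have "cmod (Y 2 x - l * s * Y 1 x - l * d 1 x) \<le> R x + (\<bar>l\<bar> * cmod s) * R x + \<bar>l\<bar> * R x"
        by (intro dm c Yj dj) (auto simp: norm_mult)
      then have "cmod k * cmod (Y 2 x - l * s * Y 1 x - l * d 1 x) / a \<le> cmod k * (R x + (\<bar>l\<bar> * cmod s) * R x + \<bar>l\<bar> * R x) / a"
        using a by (intro divide_right_mono mult_left_mono) auto
      also have "\<dots> = (cmod k * (1 + \<bar>l\<bar> * cmod s + \<bar>l\<bar>) / a) * R x" by (simp add: algebra_simps)
      finally show ?thesis using a by (simp only: norm_mult norm_divide norm_of_real abs_of_pos)
    qed
    have b1: "cmod (k * (Y 3 x / m - s * Y 0 x - d 0 x)) \<le> (cmod k * (1 / m + cmod s + 1)) * R x" for x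
    proof -
      have "cmod (complex_of_real (1 / m) * Y 3 x - s * Y 0 x - d 0 x) \<le> (1 / m) * R x + cmod s * R x + R x"
        using m by (intro dm c Yj dj) (auto simp: norm_divide)
      then have "cmod k * cmod (complex_of_real (1 / m) * Y 3 x - s * Y 0 x - d 0 x) \<le> cmod k * ((1 / m) * R x + cmod s * R x + R x)"
        by (intro mult_left_mono) auto
      also have "\<dots> = (cmod k * (1 / m + cmod s + 1)) * R x" by (simp add: algebra_simps)
      finally show ?thesis by (simp add: norm_mult)
    qed
    have b2: "cmod (- (k * s * Y 3 x) - m * d 3 x - r / k * Y 0 x - m * d 4 x) \<le> (cmod k * cmod s + m + cmod (r / k) + m) * R x" for x
    proof -
      have "cmod (- (k * s) * Y 3 x - m * d 3 x - r / k * Y 0 x - m * d 4 x) \<le> (cmod k * cmod s) * R x + m * R x + cmod (r / k) * R x + m * R x"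
        using m by (intro dm c Yj dj) (auto simp: norm_mult)
      then show ?thesis by (simp add: algebra_simps)
    qed
    have b3: "cmod (k * (- (s * (l / a) * Y 2 x) + E * Y 1 x - s * E * d 1 x) - l * d 2 x - r / k * Y 1 x - a * d 5 x)
       \<le> (cmod k * (cmod s * \<bar>l / a\<bar> + E + cmod s * E) + \<bar>l\<bar> + cmod (r / k) + a) * R x" for x
    proof -
      have "cmod (- (s * (l / a)) * Y 2 x + E * Y 1 x - s * E * d 1 x) \<le> (cmod s * \<bar>l / a\<bar>) * R x + E * R x + (cmod s * E) * R x"
        using E by (intro dm norm_triangle_mono c Yj dj) (auto simp: norm_mult norm_divide)
      then have "cmod (- (s * (l / a)) * Y 2 x + E * Y 1 x - s * E * d 1 x) \<le> (cmod s * \<bar>l / a\<bar> + E + cmod s * E) * R x" by (simp add: algebra_simps)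
      then have "cmod (k * (- (s * (l / a)) * Y 2 x + E * Y 1 x - s * E * d 1 x) - l * d 2 x - r / k * Y 1 x - a * d 5 x)
         \<le> cmod k * ((cmod s * \<bar>l / a\<bar> + E + cmod s * E) * R x) + \<bar>l\<bar> * R x + cmod (r / k) * R x + a * R x"
        using a by (intro dm c' c Yj dj) auto
      then show ?thesis by (simp add: algebra_simps)
    qed
    have le: "cmod k * (1 + \<bar>l\<bar> * cmod s + \<bar>l\<bar>) / a \<le> K" "cmod k * (1 / m + cmod s + 1) \<le> K" "cmod k * cmod s + m + cmod (r / k) + m \<le> K"
      "cmod k * (cmod s * \<bar>l / a\<bar> + E + cmod s * E) + \<bar>l\<bar> + cmod (r / k) + a \<le> K"
      unfolding K_def using n0 by linarith+
    have "j = 0 \<or> j = 1 \<or> j = 2 \<or> j = 3" using j by auto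
    then have "\<exists>Z. primitive h (Y j) Z \<and> (\<forall>x. (cmod (Z x))\<^sup>2 \<le> K\<^sup>2 * G x)"
      using sys[unfolded stress_system_def] fin[OF b0 le(1) n0(1)] fin[OF b1 le(2) n0(2)] fin[OF b2 le(3) n0(3)] fin[OF b3 le(4) n0(4)]
      by (elim disjE conjE) (simp only:, rule exI, rule conjI, assumption, blast)+
    then show "\<exists>Z. primitive h (Y j) Z \<and> (\<forall>x. (cmod (Z x))\<^sup>2 \<le> K\<^sup>2 * ((\<Sum>j<4. (cmod (Y j x))\<^sup>2) + (\<Sum>j<6. (cmod (d j x))\<^sup>2)))"
      by (simp only: G_def)
  qed
qed

lemma resolvent_coords_lincomb:
  "resolvent_coords k s (\<lambda>j x. d j x + c * d' j x) (\<lambda>j x. Y j x + c * Y' j x) j x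
     = resolvent_coords k s d Y j x + c * resolvent_coords k s d' Y' j x"
  by (simp add: resolvent_coords_def algebra_simps add_divide_distrib diff_divide_distrib)

lemma stress_system_sum:
  fixes d Y :: "nat \<Rightarrow> nat \<Rightarrow> real \<Rightarrow> complex" and c :: "nat \<Rightarrow> complex" and N :: nat
  assumes "\<And>n. stress_system k s (d n) (Y n)" "\<And>n. stress_free (Y n)"
  shows "stress_system k s (\<lambda>j x. \<Sum>n<N. c n * d n j x) (\<lambda>j x. \<Sum>n<N. c n * Y n j x) \<and>
    stress_free (\<lambda>j x. \<Sum>n<N. c n * Y n j x) \<and>
    (\<forall>j x. resolvent_coords k s (\<lambda>j x. \<Sum>n<N. c n * d n j x) (\<lambda>j x. \<Sum>n<N. c n * Y n j x) j x
       = (\<Sum>n<N. c n * resolvent_coords k s (d n) (Y n) j x))"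
proof (induction N)
  case 0
  show ?case by (simp add: stress_system_zero stress_free_def) (simp add: resolvent_coords_def)
next
  case (Suc N)
  then show ?case
    using stress_system_lincomb[OF conjunct1[OF Suc] assms(1)[of N], of "c N"]
      stress_free_lincomb[OF conjunct1[OF conjunct2[OF Suc]] assms(2)[of N], of "c N"]
    by (simp add: resolvent_coords_lincomb)
qed

lemma sq_energy_member:
  assumes "\<And>j. j < n \<Longrightarrow> sq_integrable h (d j)" "i < n"
  shows "(\<integral>x. (cmod (d i x))\<^sup>2 \<partial>Mh h) \<le> sq_energy h n d"
  unfolding sq_energy_def
proof (rule integral_mono)
  show "integrable (Mh h) (\<lambda>x. (cmod (d i x))\<^sup>2)" using assms by (auto simp: sq_integrable_def)
  show "integrable (Mh h) (\<lambda>x. \<Sum>j<n. (cmod (d j x))\<^sup>2)"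
    using assms by (intro Bochner_Integration.integrable_sum) (auto simp: sq_integrable_def)
  show "(cmod (d i x))\<^sup>2 \<le> (\<Sum>j<n. (cmod (d j x))\<^sup>2)" for x
    by (rule member_le_sum) (use assms in auto)
qed

text \<open>Sobolev's inequality, applied to each \<open>Y j\<close>, whose derivative the system
  controls, and to \<open>d 0\<close> and \<open>d 1\<close>, whose derivatives are among the data.
  The values at one point thus become bounded functionals of the data, ready for Bessel's
  inequality.\<close>

lemma resolvent_pointwise_bound:
  assumes k: "1 \<le> cmod k" and s: "s * s = -1" and C0: "0 \<le> C0"
    and est: "\<And>d Y. (\<And>j. j < 6 \<Longrightarrow> sq_integrable h (d j)) \<Longrightarrow> stress_system k s d Y \<Longrightarrow> stress_free Y \<Longrightarrow> sq_energy h 4 Y \<le> C0 * sq_energy h 6 d"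
  shows "\<exists>C\<ge>0. \<forall>d Y j x. (\<forall>j<6. sq_integrable h (d j)) \<longrightarrow> stress_system k s d Y \<longrightarrow> stress_free Y \<longrightarrow>
    primitive h (d 0) (d 2) \<longrightarrow> primitive h (d 1) (d 3) \<longrightarrow> x \<in> {-h..h} \<longrightarrow>
    (cmod (resolvent_coords k s d Y j x))\<^sup>2 \<le> C * sq_energy h 6 d"
proof -
  obtain C1 where C1: "0 < C1" "\<And>d Y x j. (cmod (resolvent_coords k s d Y j x))\<^sup>2 \<le> C1 * ((\<Sum>j<4. (cmod (Y j x))\<^sup>2) + ((cmod (d 0 x))\<^sup>2 + (cmod (d 1 x))\<^sup>2))"
    using resolvent_coords_bound k s by blast
  obtain C2 where C2: "0 \<le> C2" "\<And>d Y j. stress_system k s d Y \<Longrightarrow> j < 4 \<Longrightarrow>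
     \<exists>Z. primitive h (Y j) Z \<and> (\<forall>x. (cmod (Z x))\<^sup>2 \<le> C2 * ((\<Sum>j<4. (cmod (Y j x))\<^sup>2) + (\<Sum>j<6. (cmod (d j x))\<^sup>2)))"
    using system_derivative_bound[of k s] by blast
  define c where "c = 1 + 1 / (2 * h)"
  have c: "0 \<le> c" using h by (simp add: c_def)
  define C3 where "C3 = c * C0 + C2 * (C0 + 1)"
  define C where "C = C1 * (4 * C3 + 2 * (c + 1))"
  have pos: "0 \<le> C3" "0 \<le> C" using C1 C2 C0 c by (auto simp: C3_def C_def intro!: add_nonneg_nonneg mult_nonneg_nonneg)
  show ?thesis
  proof (rule exI[of _ C], intro conjI allI impI)
    show "0 \<le> C" by fact
    fix d Y :: "nat \<Rightarrow> real \<Rightarrow> complex" and j x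
    assume d': "\<forall>j<6. sq_integrable h (d j)" and sys: "stress_system k s d Y" and free: "stress_free Y"
      and p: "primitive h (d 0) (d 2)" "primitive h (d 1) (d 3)" and x: "x \<in> {-h..h}"
    have d: "sq_integrable h (d j)" if "j < 6" for j using d' that by blast
    define ed where "ed = sq_energy h 6 d"
    define eY where "eY = sq_energy h 4 Y"
    have e0: "0 \<le> ed" "0 \<le> eY" by (simp_all add: ed_def eY_def sq_energy_nonneg)
    have eYd: "eY \<le> C0 * ed" unfolding eY_def ed_def by (rule est[OF d sys free])
    have Ys: "sq_integrable h (Y j)" if "j < 4" for j by (rule sq_integrable_continuous[OF stress_system_continuous[OF sys that]])
    have iY: "integrable (Mh h) (\<lambda>x. \<Sum>j<4. (cmod (Y j x))\<^sup>2)"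
      using Ys by (intro Bochner_Integration.integrable_sum) (auto simp: sq_integrable_def)
    have id: "integrable (Mh h) (\<lambda>x. \<Sum>j<6. (cmod (d j x))\<^sup>2)"
      using d by (intro Bochner_Integration.integrable_sum) (auto simp: sq_integrable_def)
    have Yb: "(cmod (Y i x))\<^sup>2 \<le> C3 * ed" if i: "i < 4" for i
    proof -
      obtain Z where Z: "primitive h (Y i) Z" "\<And>x. (cmod (Z x))\<^sup>2 \<le> C2 * ((\<Sum>j<4. (cmod (Y j x))\<^sup>2) + (\<Sum>j<6. (cmod (d j x))\<^sup>2))"
        using C2(2)[OF sys i] by blast
      have iZ: "integrable (Mh h) (\<lambda>x. C2 * ((\<Sum>j<4. (cmod (Y j x))\<^sup>2) + (\<Sum>j<6. (cmod (d j x))\<^sup>2)))"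
        by (intro integrable_mult_right Bochner_Integration.integrable_add iY id)
      have Zs: "sq_integrable h Z"
        by (rule sq_integrable_bound[OF iZ _ Z(2)]) (use primitive_integrable[OF Z(1)] in auto)
      have "(\<integral>x. (cmod (Z x))\<^sup>2 \<partial>Mh h) \<le> (\<integral>x. C2 * ((\<Sum>j<4. (cmod (Y j x))\<^sup>2) + (\<Sum>j<6. (cmod (d j x))\<^sup>2)) \<partial>Mh h)"
        by (rule integral_mono[OF _ iZ Z(2)]) (use Zs in \<open>simp add: sq_integrable_def\<close>)
      also have "\<dots> = C2 * (eY + ed)" unfolding eY_def ed_def sq_energy_def
        by (simp only: integral_mult_right_zero Bochner_Integration.integral_add[OF iY id])
      also have "\<dots> \<le> C2 * ((C0 + 1) * ed)" using eYd C2(1) by (intro mult_left_mono) (auto simp: algebra_simps)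
      finally have 1: "(\<integral>x. (cmod (Z x))\<^sup>2 \<partial>Mh h) \<le> C2 * ((C0 + 1) * ed)" .
      have "(\<integral>x. (cmod (Y i x))\<^sup>2 \<partial>Mh h) \<le> C0 * ed" using sq_energy_member[of 4 Y, OF Ys i] eYd unfolding eY_def by linarith
      then have 2: "c * (\<integral>x. (cmod (Y i x))\<^sup>2 \<partial>Mh h) \<le> c * (C0 * ed)" using c by (rule mult_left_mono)
      have "(cmod (Y i x))\<^sup>2 \<le> c * (C0 * ed) + C2 * ((C0 + 1) * ed)"
        using primitive_sup_bound[OF Z(1) Zs h x, folded c_def] 1 2 by linarith
      then show ?thesis by (simp add: C3_def algebra_simps)
    qed
    have db: "(cmod (d i x))\<^sup>2 \<le> (c + 1) * ed" if i: "i = 0 \<or> i = 1" for i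
    proof -
      have P: "primitive h (d i) (d (i + 2))" using p i by (auto simp: numeral_2_eq_2 numeral_3_eq_3)
      have "i < 6" "i + 2 < 6" using i by auto
      note b = sq_energy_member[of 6 d, OF d this(1)] sq_energy_member[of 6 d, OF d this(2)]
      have "c * (\<integral>x. (cmod (d i x))\<^sup>2 \<partial>Mh h) \<le> c * ed" unfolding ed_def by (rule mult_left_mono[OF b(1) c])
      then have "(cmod (d i x))\<^sup>2 \<le> c * ed + ed"
        using primitive_sup_bound[OF P d[OF \<open>i + 2 < 6\<close>] h x, folded c_def] b(2) unfolding ed_def by linarith
      then show ?thesis by (simp add: algebra_simps)
    qed
    have "(\<Sum>j<4. (cmod (Y j x))\<^sup>2) \<le> 4 * (C3 * ed)"
      using Yb[of 0] Yb[of 1] Yb[of 2] Yb[of 3] by (simp add: sum_lessThan_4)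
    then have "(\<Sum>j<4. (cmod (Y j x))\<^sup>2) + ((cmod (d 0 x))\<^sup>2 + (cmod (d 1 x))\<^sup>2) \<le> (4 * C3 + 2 * (c + 1)) * ed"
      using db[of 0] db[of 1] by (simp add: algebra_simps)
    then have "C1 * ((\<Sum>j<4. (cmod (Y j x))\<^sup>2) + ((cmod (d 0 x))\<^sup>2 + (cmod (d 1 x))\<^sup>2)) \<le> C1 * ((4 * C3 + 2 * (c + 1)) * ed)"
      using C1(1) by (intro mult_left_mono) auto
    then show "(cmod (resolvent_coords k s d Y j x))\<^sup>2 \<le> C * sq_energy h 6 d"
      using C1(2)[of d Y j x] unfolding C_def ed_def[symmetric] mult.assoc by linarith
  qed
qed

text \<open>The factor 6 counts the coordinates, \<open>C1\<close> bounds each of them pointwise,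
  and \<open>C0 + 1\<close> collects the energy of the solution and that of the data.\<close>

lemma resolvent_energy_bound:
  assumes C1: "\<And>d Y x j. (cmod (resolvent_coords k s d Y j x))\<^sup>2 \<le> C1 * ((\<Sum>j<4. (cmod (Y j x))\<^sup>2) + ((cmod (d 0 x))\<^sup>2 + (cmod (d 1 x))\<^sup>2))"
    and C10: "0 \<le> C1"
    and d: "\<And>j. j < 6 \<Longrightarrow> sq_integrable h (d j)" and Y: "\<And>j. j < 4 \<Longrightarrow> sq_integrable h (Y j)"
    and est: "sq_energy h 4 Y \<le> C0 * sq_energy h 6 d"
  shows "sq_energy h 6 (resolvent_coords k s d Y) \<le> 6 * C1 * (C0 + 1) * sq_energy h 6 d"
proof -
  have iY: "integrable (Mh h) (\<lambda>x. \<Sum>j<4. (cmod (Y j x))\<^sup>2)"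
    using Y by (intro Bochner_Integration.integrable_sum) (auto simp: sq_integrable_def)
  have id: "integrable (Mh h) (\<lambda>x. \<Sum>j<6. (cmod (d j x))\<^sup>2)"
    using d by (intro Bochner_Integration.integrable_sum) (auto simp: sq_integrable_def)
  have ds: "sq_integrable h (d 0)" "sq_integrable h (d 1)" and Ys: "sq_integrable h (Y 0)" "sq_integrable h (Y 1)" "sq_integrable h (Y 2)" "sq_integrable h (Y 3)"
    using d Y by auto
  have rc: "sq_integrable h (resolvent_coords k s d Y j)" for j
  proof -
    have "resolvent_coords k s d Y j = (if j = 0 then (\<lambda>x. (1 / k) * Y 0 x) else if j = 1 then (\<lambda>x. (1 / k) * Y 1 x)
     else if j = 2 then (\<lambda>x. (1 / a) * (Y 2 x - l * (s * Y 1 x + d 1 x)))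
     else if j = 3 then (\<lambda>x. (1 / m) * (Y 3 x - m * (s * Y 0 x + d 0 x)))
     else if j = 4 then (\<lambda>x. s * Y 0 x + d 0 x) else (\<lambda>x. s * Y 1 x + d 1 x))"
      by (auto simp: resolvent_coords_def)
    moreover have "sq_integrable h (\<lambda>x. (1 / k) * Y 0 x)" "sq_integrable h (\<lambda>x. (1 / k) * Y 1 x)"
      "sq_integrable h (\<lambda>x. (1 / a) * (Y 2 x - l * (s * Y 1 x + d 1 x)))"
      "sq_integrable h (\<lambda>x. (1 / m) * (Y 3 x - m * (s * Y 0 x + d 0 x)))"
      "sq_integrable h (\<lambda>x. s * Y 0 x + d 0 x)" "sq_integrable h (\<lambda>x. s * Y 1 x + d 1 x)"
      by (intro sq_integrable_cmult sq_integrable_add sq_integrable_diff ds Ys)+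
    ultimately show ?thesis by (simp split: if_split)
  qed
  let ?t = "\<lambda>x. (6 * C1) * ((\<Sum>j<4. (cmod (Y j x))\<^sup>2) + (\<Sum>j<6. (cmod (d j x))\<^sup>2))"
  have "sq_energy h 6 (resolvent_coords k s d Y) \<le> (\<integral>x. ?t x \<partial>Mh h)"
    unfolding sq_energy_def
  proof (rule integral_mono)
    show "integrable (Mh h) (\<lambda>x. \<Sum>j<6. (cmod (resolvent_coords k s d Y j x))\<^sup>2)"
      using rc by (intro Bochner_Integration.integrable_sum) (auto simp: sq_integrable_def)
    show "integrable (Mh h) ?t" by (intro integrable_mult_right Bochner_Integration.integrable_add iY id)
    fix x
    have "(cmod (resolvent_coords k s d Y j x))\<^sup>2 \<le> C1 * ((\<Sum>j<4. (cmod (Y j x))\<^sup>2) + (\<Sum>j<6. (cmod (d j x))\<^sup>2))" for j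
      by (rule order_trans[OF C1 mult_left_mono[OF _ C10]]) (simp add: sum_lessThan_6 add_increasing2)
    then have "(\<Sum>j<6. (cmod (resolvent_coords k s d Y j x))\<^sup>2) \<le> (\<Sum>j<6::nat. C1 * ((\<Sum>j<4. (cmod (Y j x))\<^sup>2) + (\<Sum>j<6. (cmod (d j x))\<^sup>2)))"
      by (rule sum_mono)
    then show "(\<Sum>j<6. (cmod (resolvent_coords k s d Y j x))\<^sup>2) \<le> ?t x" by simp
  qed
  also have "\<dots> = (6 * C1) * (sq_energy h 4 Y + sq_energy h 6 d)" unfolding sq_energy_def
    by (simp only: integral_mult_right_zero Bochner_Integration.integral_add[OF iY id])
  also have "\<dots> \<le> (6 * C1) * ((C0 + 1) * sq_energy h 6 d)" using est C10 by (intro mult_left_mono) (auto simp: algebra_simps)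
  finally show ?thesis by (simp only: mult.assoc)
qed

text \<open>The choice in \<open>wd\<close> is not linear, so the derivative coordinates subtract
  only almost everywhere, by uniqueness of weak derivatives.\<close>

lemma pair_diff_coords:
  assumes U: "U \<in> Hspace h" and V: "V \<in> Hspace h"
  shows "pair_diff U V \<in> Hspace h" "AE x in Mh h. \<forall>j<6. coords h (pair_diff U V) j x = coords h U j x - coords h V j x"
proof -
  have H: "fst U \<in> H1 h" "fst V \<in> H1 h" and L: "sq_integrable h (snd U)" "sq_integrable h (snd V)"
    using U V by (auto simp: Hspace_def L2_iff_sq_integrable)
  obtain u where u: "primitive h u (wd h (fst U))" "AE x in Mh h. fst U x = u x" using H1_primitive[OF H(1) h] by blast
  obtain v where v: "primitive h v (wd h (fst V))" "AE x in Mh h. fst V x = v x" using H1_primitive[OF H(2) h] by blast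
  have ae: "AE x in Mh h. fst (pair_diff U V) x = u x - v x" using u(2) v(2) by eventually_elim (simp add: pair_diff_def)
  note D = H1_of_primitive[OF h primitive_diff[OF u(1) v(1)] sq_integrable_diff[OF wd_spec(1)[OF H(1)] wd_spec(1)[OF H(2)]] ae]
  show "pair_diff U V \<in> Hspace h" using D(1) sq_integrable_diff[OF L] by (simp add: Hspace_def pair_diff_def L2_iff_sq_integrable)
  show "AE x in Mh h. \<forall>j<6. coords h (pair_diff U V) j x = coords h U j x - coords h V j x"
    using D(3) by eventually_elim (auto simp: coords_def, auto simp: pair_diff_def)
qed

section \<open>Resolvent set, norm bound and Hilbert-Schmidt property at a fixed k\<close>

lemma resolvent_properties:
  assumes r: "r = om\<^sup>2 * rho" and k: "1 \<le> cmod k" and s: "s * s = -1" and C0: "0 \<le> C0" and C10: "0 \<le> C1"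
    and C1: "\<And>d Y x j. (cmod (resolvent_coords k s d Y j x))\<^sup>2 \<le> C1 * ((\<Sum>j<4. (cmod (Y j x))\<^sup>2) + ((cmod (d 0 x))\<^sup>2 + (cmod (d 1 x))\<^sup>2))"
    and est: "\<And>d Y. (\<And>j. j < 6 \<Longrightarrow> sq_integrable h (d j)) \<Longrightarrow> stress_system k s d Y \<Longrightarrow> stress_free Y \<Longrightarrow> sq_energy h 4 Y \<le> C0 * sq_energy h 6 d"
  shows "in_resolvent_set h l m rho om (s * k)"
    and "resolvent_norm_le h l m rho om (s * k) (sqrt (6 * C1 * (C0 + 1)))"
    and "resolvent_hilbert_schmidt h l m rho om (s * k)"
proof -
  have k0: "k \<noteq> 0" using k by auto
  have uniq: "sq_energy h 4 Y = 0" if "stress_system k s (\<lambda>_ _. 0) Y" "stress_free Y" for Y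
  proof -
    have "sq_energy h 4 Y \<le> C0 * sq_energy h 6 (\<lambda>_ _. 0)" by (rule est[OF sq_integrable_zero that])
    then show ?thesis using sq_energy_nonneg[of h 4 Y] by (simp add: sq_energy_def)
  qed
  note solvable = resolvent_solvable[OF r _ s k0 uniq]
  note system = resolvent_imp_stress_system[OF r _ _ _ s k0]
  have Ys: "sq_integrable h (Y j)" if "stress_system k s d Y" "j < 4" for d Y j
    by (rule sq_integrable_continuous[OF stress_system_continuous[OF that]])
  have unique: "H_norm h (pair_diff U V) = 0"
    if U: "U \<in> domA h l m" and V: "V \<in> domA h l m" and opU: "opA_minus h l m rho om (s * k) U F" and opV: "opA_minus h l m rho om (s * k) V F" for U V F
  proof -
    have F: "F \<in> Hspace h" by (rule resolvent_range_in_Hspace[OF r U opU])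
    obtain d Y where dY: "stress_system k s d Y" "stress_free Y" "\<forall>j<6. sq_integrable h (d j)" "AE x in Mh h. \<forall>j<6. coords h F j x = d j x"
      "AE x in Mh h. \<forall>j<6. coords h U j x = resolvent_coords k s d Y j x" using system[OF U F opU] by blast
    obtain d' Y' where dY': "stress_system k s d' Y'" "stress_free Y'" "\<forall>j<6. sq_integrable h (d' j)" "AE x in Mh h. \<forall>j<6. coords h F j x = d' j x"
      "AE x in Mh h. \<forall>j<6. coords h V j x = resolvent_coords k s d' Y' j x" using system[OF V F opV] by blast
    \<comment> \<open>Both solutions come with their own representatives of the same
      \<open>F\<close>, so the data of the difference vanish almost everywhere and not identically;
      zero energy is what the estimate uses.\<close>
    define e where "e = (\<lambda>j x. d j x + (-1) * d' j x)"
    define Z where "Z = (\<lambda>j x. Y j x + (-1) * Y' j x)"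
    have sys: "stress_system k s e Z" unfolding e_def Z_def by (rule stress_system_lincomb[OF dY(1) dY'(1)])
    have free: "stress_free Z" unfolding Z_def by (rule stress_free_lincomb[OF dY(2) dY'(2)])
    have es: "sq_integrable h (e j)" if "j < 6" for j
      unfolding e_def using dY(3) dY'(3) that by (intro sq_integrable_add sq_integrable_cmult) auto
    have "AE x in Mh h. \<forall>j<6. e j x = 0" using dY(4) dY'(4) by eventually_elim (simp add: e_def)
    then have e0: "sq_energy h 6 e = 0" using sq_energy_cong_AE[where h = h and n = 6 and d = e and d' = "\<lambda>_ _. 0"] by (simp add: sq_energy_def)
    note D = pair_diff_coords[OF domA_imp_Hspace[OF U] domA_imp_Hspace[OF V]]
    have "AE x in Mh h. \<forall>j<6. coords h (pair_diff U V) j x = resolvent_coords k s e Z j x"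
      using D(2) dY(5) dY'(5)
    proof eventually_elim
      case (elim x)
      have "resolvent_coords k s e Z j x = resolvent_coords k s d Y j x + (-1) * resolvent_coords k s d' Y' j x" for j
        unfolding e_def Z_def by (rule resolvent_coords_lincomb)
      then show ?case using elim by simp
    qed
    then have "sq_energy h 6 (coords h (pair_diff U V)) = sq_energy h 6 (resolvent_coords k s e Z)" by (rule sq_energy_cong_AE)
    also have "\<dots> \<le> 6 * C1 * (C0 + 1) * sq_energy h 6 e"
      by (rule resolvent_energy_bound[OF C1 C10 es Ys[OF sys] est[OF es sys free]])
    finally have "sq_energy h 6 (coords h (pair_diff U V)) \<le> 0" using e0 by simp
    then show ?thesis using sq_energy_nonneg[of h 6 "coords h (pair_diff U V)"] H_norm_coords[OF D(1)] by simp
  qed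
  show "in_resolvent_set h l m rho om (s * k)" unfolding in_resolvent_set_def
    using resolvent_range_in_Hspace[OF r] solvable unique by blast
  show "resolvent_norm_le h l m rho om (s * k) (sqrt (6 * C1 * (C0 + 1)))" unfolding resolvent_norm_le_def
  proof (intro ballI impI)
    fix F U assume F: "F \<in> Hspace h" and U: "U \<in> domA h l m" and op: "opA_minus h l m rho om (s * k) U F"
    obtain d Y where dY: "stress_system k s d Y" "stress_free Y" "\<forall>j<6. sq_integrable h (d j)" "AE x in Mh h. \<forall>j<6. coords h F j x = d j x"
      "AE x in Mh h. \<forall>j<6. coords h U j x = resolvent_coords k s d Y j x" using system[OF U F op] by blast
    have ds: "sq_integrable h (d j)" if "j < 6" for j using dY(3) that by blast
    have "sq_energy h 6 (coords h U) = sq_energy h 6 (resolvent_coords k s d Y)" by (rule sq_energy_cong_AE[OF dY(5)])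
    also have "\<dots> \<le> 6 * C1 * (C0 + 1) * sq_energy h 6 d"
      by (rule resolvent_energy_bound[OF C1 C10 ds Ys[OF dY(1)] est[OF ds dY(1,2)]])
    also have "sq_energy h 6 d = sq_energy h 6 (coords h F)" by (rule sq_energy_cong_AE[OF dY(4), symmetric])
    finally show "H_norm h U \<le> sqrt (6 * C1 * (C0 + 1)) * H_norm h F"
      unfolding H_norm_coords[OF F] H_norm_coords[OF domA_imp_Hspace[OF U]] real_sqrt_mult[symmetric] by (rule real_sqrt_le_mono)
  qed
  show "resolvent_hilbert_schmidt h l m rho om (s * k)"
  proof -
    let ?e = "cosine_basis h"
    have eH: "?e n \<in> Hspace h" for n by (rule cosine_basis_coords(1)[OF h])
    have "\<forall>n. \<exists>U. U \<in> domA h l m \<and> opA_minus h l m rho om (s * k) U (?e n)" using solvable[OF eH] by blast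
    then obtain U where U: "\<And>n. U n \<in> domA h l m" "\<And>n. opA_minus h l m rho om (s * k) (U n) (?e n)" by metis
    \<comment> \<open>One predicate, so that system and data are chosen together for every n. The
      data agree almost everywhere with the coordinates of the n-th basis element and inherit
      orthonormality, while keeping the derivative relations of the pointwise bound.\<close>
    define good where "good n d Y \<longleftrightarrow> stress_system k s d Y \<and> stress_free Y \<and> (\<forall>j<6. sq_integrable h (d j)) \<and>
      primitive h (d 0) (d 2) \<and> primitive h (d 1) (d 3) \<and>
      (AE x in Mh h. \<forall>j<6. coords h (?e n) j x = d j x) \<and>
      (AE x in Mh h. \<forall>j<6. coords h (U n) j x = resolvent_coords k s d Y j x)" for n d Y
    have "\<forall>n. \<exists>d Y. good n d Y" unfolding good_def using system[OF U(1) eH U(2)] by blast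
    then obtain d Y where "\<And>n. good n (d n) (Y n)" by metis
    then have sys: "\<And>n. stress_system k s (d n) (Y n)" and free: "\<And>n. stress_free (Y n)" and ds: "\<And>n j. j < 6 \<Longrightarrow> sq_integrable h (d n j)"
      and dP: "\<And>n. primitive h (d n 0) (d n 2)" "\<And>n. primitive h (d n 1) (d n 3)"
      and dae: "\<And>n. AE x in Mh h. \<forall>j<6. coords h (?e n) j x = d n j x"
      and Uae: "\<And>n. AE x in Mh h. \<forall>j<6. coords h (U n) j x = resolvent_coords k s (d n) (Y n) j x"
      unfolding good_def by blast+
    have orth: "(\<integral>x. (\<Sum>j<6. d p j x * cnj (d q j x)) \<partial>Mh h) = (if p = q then 1 else 0)" for p q
    proof -
      have "(\<integral>x. (\<Sum>j<6. d p j x * cnj (d q j x)) \<partial>Mh h) = H_inner h (?e p) (?e q)"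
        unfolding H_inner_coords[OF eH eH]
        by (rule integral_Mh_cong_AE) (use dae[of p] dae[of q] in eventually_elim, simp)
      then show ?thesis using cosine_basis_orthonormal[OF h] by simp
    qed
    obtain C where C: "0 \<le> C" "\<And>d Y j x. (\<forall>j<6. sq_integrable h (d j)) \<Longrightarrow> stress_system k s d Y \<Longrightarrow> stress_free Y \<Longrightarrow>
      primitive h (d 0) (d 2) \<Longrightarrow> primitive h (d 1) (d 3) \<Longrightarrow> x \<in> {-h..h} \<Longrightarrow>
      (cmod (resolvent_coords k s d Y j x))\<^sup>2 \<le> C * sq_energy h 6 d"
      using resolvent_pointwise_bound[OF k s C0 est] by blast
    define T where "T n j x = resolvent_coords k s (d n) (Y n) j x" for n j x
    \<comment> \<open>At fixed x and j, a finite combination of the solutions is the solution for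
      the combined data, of energy equal to the sum of squared coefficients; duality bounds the sum
      of squares uniformly in N.\<close>
    have Tb: "(\<Sum>n<N. (cmod (T n j x))\<^sup>2) \<le> C" if x: "x \<in> {-h..h}" for N j x
    proof (rule bessel_bound[OF C(1)])
      fix c :: "nat \<Rightarrow> complex"
      note S = stress_system_sum[of k s d Y, OF sys free, where N = N and c = c]
      let ?d = "\<lambda>j x. \<Sum>n<N. c n * d n j x"
      have "(cmod (resolvent_coords k s ?d (\<lambda>j x. \<Sum>n<N. c n * Y n j x) j x))\<^sup>2 \<le> C * sq_energy h 6 ?d"
      proof (rule C(2)[OF _ conjunct1[OF S] conjunct1[OF conjunct2[OF S]] _ _ x])
        show "\<forall>j<6. sq_integrable h (?d j)" by (intro allI impI sq_integrable_sum sq_integrable_cmult ds)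
        show "primitive h (?d 0) (?d 2)" "primitive h (?d 1) (?d 3)" by (intro primitive_sum primitive_cmult dP)+
      qed
      also have "sq_energy h 6 ?d = (\<Sum>n<N. (cmod (c n))\<^sup>2)" by (rule sq_energy_orthonormal_sum[OF ds orth])
      finally show "(cmod (\<Sum>n<N. c n * T n j x))\<^sup>2 \<le> C * (\<Sum>n<N. (cmod (c n))\<^sup>2)" using S by (simp add: T_def)
    qed
    have cs: "integrable (Mh h) (\<lambda>x. \<Sum>j<6. (cmod (coords h (U n) j x))\<^sup>2)" for n
      using coords_sq_integrable[OF domA_imp_Hspace[OF U(1)]] by (intro Bochner_Integration.integrable_sum) (auto simp: sq_integrable_def)
    have "summable (\<lambda>n. (H_norm h (U n))\<^sup>2)"
    proof (rule summableI_nonneg_bounded)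
      show "0 \<le> (H_norm h (U n))\<^sup>2" for n by simp
      fix N :: nat
      have "(\<Sum>n<N. (H_norm h (U n))\<^sup>2) = (\<Sum>n<N. sq_energy h 6 (coords h (U n)))"
        by (simp add: H_norm_coords[OF domA_imp_Hspace[OF U(1)]] sq_energy_nonneg)
      also have "\<dots> = (\<integral>x. (\<Sum>n<N. \<Sum>j<6. (cmod (coords h (U n) j x))\<^sup>2) \<partial>Mh h)"
        unfolding sq_energy_def by (rule Bochner_Integration.integral_sum[symmetric]) (rule cs)
      \<comment> \<open>The pointwise Bessel bound for each of the six coordinates, integrated over
        an interval of finite length; the result does not depend on N.\<close>
      also have "\<dots> \<le> (\<integral>x. 6 * C \<partial>Mh h)"
      proof (rule integral_mono_AE)
        show "integrable (Mh h) (\<lambda>x. \<Sum>n<N. \<Sum>j<6. (cmod (coords h (U n) j x))\<^sup>2)"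
          by (rule Bochner_Integration.integrable_sum) (rule cs)
        show "integrable (Mh h) (\<lambda>x. 6 * C)" by (rule finite_measure.integrable_const[OF finite_measure_Mh])
        have "AE x in Mh h. \<forall>n. \<forall>j<6. coords h (U n) j x = T n j x"
          unfolding T_def by (subst AE_all_countable) (use Uae in blast)
        then show "AE x in Mh h. (\<Sum>n<N. \<Sum>j<6. (cmod (coords h (U n) j x))\<^sup>2) \<le> 6 * C"
          using AE_space
        proof eventually_elim
          case (elim x)
          have "(\<Sum>n<N. \<Sum>j<6. (cmod (coords h (U n) j x))\<^sup>2) = (\<Sum>n<N. \<Sum>j<6. (cmod (T n j x))\<^sup>2)" using elim(1) by simp
          also have "\<dots> = (\<Sum>j<6. \<Sum>n<N. (cmod (T n j x))\<^sup>2)" by (rule sum.swap)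
          also have "\<dots> \<le> (\<Sum>j<6::nat. C)" by (rule sum_mono, rule Tb) (use elim(2) in auto)
          finally show ?case by simp
        qed
      qed
      also have "\<dots> = 2 * h * (6 * C)" using h by (simp add: measure_restrict_space)
      finally show "(\<Sum>n<N. (H_norm h (U n))\<^sup>2) \<le> 2 * h * (6 * C)" .
    qed
    then show ?thesis unfolding resolvent_hilbert_schmidt_def
      using complete_orthonormal_cosine_basis[OF h] U by blast
  qed
qed

end

section \<open>From the sector to the half-plane, and the final assembly\<close>

lemma sector_real_part:
  assumes "\<beta> \<in> sector \<theta>0" "0 < \<theta>0" "\<theta>0 < pi / 2"
  shows "cos \<theta>0 * cmod \<beta> \<le> \<bar>Re \<beta>\<bar>"
proof -
  obtain \<theta> where \<theta>: "\<beta> = complex_of_real (cmod \<beta>) * cis \<theta>" "\<bar>\<theta>\<bar> \<le> \<theta>0 \<or> \<bar>\<theta> - pi\<bar> \<le> \<theta>0"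
    using assms(1) by (auto simp: sector_def)
  have mono: "cos \<theta>0 \<le> cos t" if "\<bar>t\<bar> \<le> \<theta>0" for t
    using cos_monotone_0_pi_le[of "\<bar>t\<bar>" \<theta>0] that assms by simp
  \<comment> \<open>This reduces the left half of the sector to the right half, at the price of the
    absolute value.\<close>
  have "cos (\<theta> - pi) = - cos \<theta>" by (simp add: cos_diff)
  then have "cos \<theta>0 \<le> \<bar>cos \<theta>\<bar>" using \<theta>(2) mono[of \<theta>] mono[of "\<theta> - pi"] by auto
  moreover have "Re \<beta> = cmod \<beta> * cos \<theta>" using arg_cong[OF \<theta>(1), of Re] by simp
  ultimately show ?thesis by (simp add: abs_mult mult.commute mult_left_mono)
qed

theorem theorem2:
  fixes h lam mu rho om \<theta>0 :: real
  assumes "h > 0" and "mu > 0" and "3 * lam + 2 * mu > 0" and "rho > 0" and "om > 0"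
    and "0 < \<theta>0" and "\<theta>0 < pi / 2"
  shows "\<exists>B0 > 0. \<exists>K > 0. \<forall>\<beta> \<in> sector \<theta>0. cmod \<beta> \<ge> B0 \<longrightarrow>
           in_resolvent_set h lam mu rho om (\<i> * \<beta>) \<and>
           resolvent_norm_le h lam mu rho om (\<i> * \<beta>) K \<and>
           resolvent_hilbert_schmidt h lam mu rho om (\<i> * \<beta>)"
proof -
  \<comment> \<open>The locale condition lam + mu > 0 holds because 3 (lam + mu) is the sum of 3 lam
    + 2 mu and mu.\<close>
  interpret lame h lam mu "om\<^sup>2 * rho" by unfold_locales (use assms in auto)
  define c where "c = cos \<theta>0"
  have c: "0 < c" unfolding c_def using assms by (intro cos_gt_zero_pi) auto
  obtain B C where BC: "0 < B" "0 < C" "\<And>k s d Y. B \<le> cmod k \<Longrightarrow> c * cmod k \<le> Re k \<Longrightarrow> s * s = -1 \<Longrightarrow>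
    (\<forall>j<6. sq_integrable h (d j)) \<Longrightarrow> stress_system k s d Y \<Longrightarrow> stress_free Y \<Longrightarrow> sq_energy h 4 Y \<le> C * sq_energy h 6 d"
    using stress_system_estimate[OF c] by blast
  obtain C1 where C1: "0 < C1" "\<And>k s d Y x j. 1 \<le> cmod k \<Longrightarrow> s * s = -1 \<Longrightarrow>
     (cmod (resolvent_coords k s d Y j x))\<^sup>2 \<le> C1 * ((\<Sum>j<4. (cmod (Y j x))\<^sup>2) + ((cmod (d 0 x))\<^sup>2 + (cmod (d 1 x))\<^sup>2))"
    using resolvent_coords_bound by blast
  \<comment> \<open>The energy estimate supplies \<open>B\<close>; the value 1 is the threshold in
    the bound for the recovered coordinates.\<close>
  let ?B = "max B 1" and ?K = "sqrt (6 * C1 * (C + 1))"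
  have "in_resolvent_set h lam mu rho om (\<i> * \<beta>) \<and> resolvent_norm_le h lam mu rho om (\<i> * \<beta>) ?K \<and>
      resolvent_hilbert_schmidt h lam mu rho om (\<i> * \<beta>)" if \<beta>: "\<beta> \<in> sector \<theta>0" "cmod \<beta> \<ge> ?B" for \<beta>
  proof -
    \<comment> \<open>The sign that moves \<beta> into the right half-plane. As its square is 1,
      putting it also into \<open>s\<close> leaves the spectral parameter unchanged.\<close>
    define t :: complex where "t = (if Re \<beta> \<ge> 0 then 1 else -1)"
    define k where "k = t * \<beta>"
    define s where "s = \<i> * t"
    have tt: "t * t = 1" by (simp add: t_def)
    have nk: "cmod k = cmod \<beta>" by (simp add: k_def t_def norm_mult)
    have "c * cmod \<beta> \<le> \<bar>Re \<beta>\<bar>" unfolding c_def by (rule sector_real_part[OF \<beta>(1) assms(6,7)])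
    then have kc: "c * cmod k \<le> Re k" by (auto simp: nk k_def t_def)
    have kB: "B \<le> cmod k" "1 \<le> cmod k" using \<beta>(2) nk by auto
    have s: "s * s = -1" using tt by (simp add: s_def t_def)
    have sk: "s * k = \<i> * \<beta>" using tt by (simp add: s_def k_def t_def)
    have est: "sq_energy h 4 Y \<le> C * sq_energy h 6 d"
      if "\<And>j. j < 6 \<Longrightarrow> sq_integrable h (d j)" "stress_system k s d Y" "stress_free Y" for d Y
      using BC(3)[OF kB(1) kc s _ that(2,3)] that(1) by blast
    note R = resolvent_properties[OF refl kB(2) s less_imp_le[OF BC(2)] less_imp_le[OF C1(1)] C1(2)[OF kB(2) s] est, unfolded sk]
    show ?thesis by (intro conjI R)
  qed
  moreover have "0 < ?B" "0 < ?K" using BC C1 by auto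
  ultimately show ?thesis by blast
qed

end
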